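(* Let $a>0$ and $\psi(x)=\operatorname{sech}(ax)=\frac{2}{e^{ax}+e^{-ax}}$. Let $\Lambda\subseteq\mathbb{R}$ be a separated set and $m_\Lambda:\Lambda\to\mathbb{N}$ a multiplicity function with $\sup_{\lambda\in\Lambda}m_\Lambda(\lambda)<\infty$. (i) If $D^-(\Lambda,m_\Lambda)>1$, then $(\Lambda,m_\Lambda)$ is a sampling set for $V^p(\psi)$ for every $1\le p\le\infty$. (ii) Conversely, if $(\Lambda,m_\Lambda)$ is a sampling set for $V^2(\psi)$, then $D^-(\Lambda,m_\Lambda)\ge1$.
   Context: For $1\le p\le\infty$, $V^p(\psi)=\{f\in L^p(\mathbb{R}): f=\sum_{k\in\mathbb{Z}}c_k \psi(\cdot-k),\ c\in\ell^p(\mathbb{Z})\}$. A set $\Lambda\subseteq\mathbb{R}$ is separated if $\inf\{|\lambda-\lambda'|:\lambda\ne\lambda'\in\Lambda\}>0$. $(\Lambda,m_\Lambda)$ is a sampling set for $V^p(\psi)$, $1\le p<\infty$, if there are $A,B>0$ with $A\|f\|_p^p\le\sum_{\lambda\in\Lambda}\sum_{j=0}^{m_\Lambda(\lambda)-1}|f^{(j)}(\lambda)|^p\le B\|f\|_p^p$ for all $f\in V^p(\psi)$; for $p=\infty$: $A\|f\|_\infty\le\sup_{\lambda\in\Lambda}\max_{0\le j\le m_\Lambda(\lambda)-1}|f^{(j)}(\lambda)|\le B\|f\|_\infty$ for all $f\in V^\infty(\psi)$. $D^-(\Lambda,m_\Lambda)=\liminf_{r\to\infty}\inf_{x\in\mathbb{R}}\frac{1}{2r}\sum_{\lambda\in\Lambda\cap[x-r,x+r]}m_\Lambda(\lambda)$.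 *)

theory Defs
  imports "HOL-Analysis.Analysis" "HOL-Probability.Essential_Supremum"
begin

definition sech_a :: "real \<Rightarrow> real \<Rightarrow> real" where
  "sech_a a x = 2 / (exp (a * x) + exp (- (a * x)))"

definition lp_seq :: "real \<Rightarrow> (int \<Rightarrow> complex) \<Rightarrow> bool" where
  "lp_seq p c \<longleftrightarrow> (\<lambda>k. norm (c k) powr p) summable_on UNIV"

definition linf_seq :: "(int \<Rightarrow> complex) \<Rightarrow> bool" where
  "linf_seq c \<longleftrightarrow> bounded (range c)"

definition Lp_fun :: "real \<Rightarrow> (real \<Rightarrow> complex) \<Rightarrow> bool" where
  "Lp_fun p f \<longleftrightarrow> f \<in> borel_measurable lborel \<and> integrable lborel (\<lambda>x. norm (f x) powr p)"

definition Lp_norm :: "real \<Rightarrow> (real \<Rightarrow> complex) \<Rightarrow> real" where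
  "Lp_norm p f = (\<integral>x. norm (f x) powr p \<partial>lborel) powr (1 / p)"

definition Linf_norm :: "(real \<Rightarrow> complex) \<Rightarrow> ereal" where
  "Linf_norm f = esssup lborel (\<lambda>x. ereal (norm (f x)))"

definition Linf_fun :: "(real \<Rightarrow> complex) \<Rightarrow> bool" where
  "Linf_fun f \<longleftrightarrow> f \<in> borel_measurable lborel \<and> Linf_norm f < \<infinity>"

definition generated_by :: "(real \<Rightarrow> real) \<Rightarrow> (int \<Rightarrow> complex) \<Rightarrow> (real \<Rightarrow> complex) \<Rightarrow> bool" where
  "generated_by \<psi> c f \<longleftrightarrow>
     (\<forall>x. ((\<lambda>k. c k * complex_of_real (\<psi> (x - real_of_int k))) has_sum f x) UNIV)"

definition Vp :: "real \<Rightarrow> (real \<Rightarrow> real) \<Rightarrow> (real \<Rightarrow> complex) set" where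
  "Vp p \<psi> = {f. Lp_fun p f \<and> (\<exists>c. lp_seq p c \<and> generated_by \<psi> c f)}"

definition Vinf :: "(real \<Rightarrow> real) \<Rightarrow> (real \<Rightarrow> complex) set" where
  "Vinf \<psi> = {f. Linf_fun f \<and> (\<exists>c. linf_seq c \<and> generated_by \<psi> c f)}"

definition hderiv :: "nat \<Rightarrow> (real \<Rightarrow> complex) \<Rightarrow> real \<Rightarrow> complex" where
  "hderiv j f = ((\<lambda>g x. vector_derivative g (at x)) ^^ j) f"

definition separated :: "real set \<Rightarrow> bool" where
  "separated \<Lambda> \<longleftrightarrow> (\<exists>\<delta>>0. \<forall>l\<in>\<Lambda>. \<forall>l'\<in>\<Lambda>. l \<noteq> l' \<longrightarrow> \<delta> \<le> \<bar>l - l'\<bar>)"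

definition sampling_set_p :: "real \<Rightarrow> (real \<Rightarrow> real) \<Rightarrow> real set \<Rightarrow> (real \<Rightarrow> nat) \<Rightarrow> bool" where
  "sampling_set_p p \<psi> \<Lambda> m \<longleftrightarrow>
     (\<exists>A>0. \<exists>B>0. \<forall>f\<in>Vp p \<psi>.
        (\<lambda>l. \<Sum>j<m l. norm (hderiv j f l) powr p) summable_on \<Lambda> \<and>
        A * Lp_norm p f powr p \<le> (\<Sum>\<^sub>\<infinity>l\<in>\<Lambda>. \<Sum>j<m l. norm (hderiv j f l) powr p) \<and>
        (\<Sum>\<^sub>\<infinity>l\<in>\<Lambda>. \<Sum>j<m l. norm (hderiv j f l) powr p) \<le> B * Lp_norm p f powr p)"

definition sampling_set_inf :: "(real \<Rightarrow> real) \<Rightarrow> real set \<Rightarrow> (real \<Rightarrow> nat) \<Rightarrow> bool" where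
  "sampling_set_inf \<psi> \<Lambda> m \<longleftrightarrow>
     (\<exists>A>0. \<exists>B>0. \<forall>f\<in>Vinf \<psi>.
        ereal A * Linf_norm f \<le> (SUP l\<in>\<Lambda>. SUP j\<in>{..<m l}. ereal (norm (hderiv j f l))) \<and>
        (SUP l\<in>\<Lambda>. SUP j\<in>{..<m l}. ereal (norm (hderiv j f l))) \<le> ereal B * Linf_norm f)"

definition lower_density :: "real set \<Rightarrow> (real \<Rightarrow> nat) \<Rightarrow> ereal" where
  "lower_density \<Lambda> m =
     Liminf at_top (\<lambda>r::real. INF x. ereal ((\<Sum>l\<in>\<Lambda> \<inter> {x - r..x + r}. real (m l)) / (2 * r)))"

end

theory Submission
  imports Defs "HOL-Complex_Analysis.Complex_Analysis"
begin

text \<open>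
  Write \<open>f = (\<Sum>l. c l * sech (a (x - l)))\<close>. For an integer \<open>k\<close> let \<open>K\<close> be the quotient of a
  product over the integers \<open>l \<noteq> k\<close> near \<open>k\<close>, with simple zeros at the poles \<open>l + \<i> \<pi> / (2 a)\<close> of
  \<open>f\<close>, by a product over the nodes near \<open>k\<close>, with zeros of order \<open>m\<close>. Since
  \<open>sech (a (z - l)) K(z)\<close> is \<open>\<i> \<pi> / a\<close>-periodic and decays, its residues over one period add up
  to 0; the residue at the pole \<open>l + \<i> \<pi> / (2 a)\<close> is a multiple of the value of \<open>K\<close> there, which
  vanishes for \<open>l \<noteq> k\<close> near \<open>k\<close>, and summing over \<open>l\<close> with weights \<open>c l\<close> turns the residues at
  the nodes into combinations of the derivatives of \<open>f\<close>. Density above 1 makes the denominator of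
  \<open>K\<close> outgrow the numerator, so the coefficients of this formula for \<open>c k\<close> decay exponentially in
  the distance to \<open>k\<close>, uniformly in \<open>k\<close>. Schur's test then bounds the coefficient sequence by the
  samples for every \<open>p\<close>.

  Conversely, if some long interval contains few nodes, a dimension count gives \<open>c \<noteq> 0\<close>, supported
  in a slightly shorter interval, whose \<open>f\<close> vanishes at all these nodes to the prescribed order.
  By exponential decay its remaining samples are negligible compared with its norm.
\<close>

section \<open>Separated families and exponentially weighted sums\<close>

definition separated_family :: "real \<Rightarrow> ('i \<Rightarrow> real) \<Rightarrow> 'i set \<Rightarrow> bool" where
  "separated_family \<delta> u I \<longleftrightarrow> (\<forall>i\<in>I. \<forall>j\<in>I. i \<noteq> j \<longrightarrow> \<delta> \<le> \<bar>u i - u j\<bar>)"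

abbreviation separated_by :: "real \<Rightarrow> real set \<Rightarrow> bool" where
  "separated_by \<delta> \<equiv> separated_family \<delta> (\<lambda>x. x)"

lemma separated_familyD:
  "\<delta> \<le> \<bar>u i - u j\<bar>" if "separated_family \<delta> u I" "i \<in> I" "j \<in> I" "i \<noteq> j"
  using that unfolding separated_family_def by blast

lemma separated_family_subset: "separated_family \<delta> u I \<Longrightarrow> J \<subseteq> I \<Longrightarrow> separated_family \<delta> u J"
  unfolding separated_family_def by blast

lemma separated_family_mono: "separated_family \<delta> u I \<Longrightarrow> \<delta>' \<le> \<delta> \<Longrightarrow> separated_family \<delta>' u I"
  unfolding separated_family_def by force

lemma separated_family_of_int:
  assumes "\<delta> \<le> 1"
  shows "separated_family \<delta> real_of_int I"
proof -
  have "separated_family 1 real_of_int I"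
    unfolding separated_family_def by (auto simp flip: of_int_diff of_int_abs)
  then show ?thesis using assms by (rule separated_family_mono)
qed

lemma inj_on_floor_separated:
  assumes "\<delta> > 0" and sep: "separated_family \<delta> u I"
  shows "inj_on (\<lambda>i. \<lfloor>(u i - x) / \<delta>\<rfloor>) I"
proof (rule inj_onI, rule ccontr)
  fix i j assume ij: "i \<in> I" "j \<in> I" "\<lfloor>(u i - x) / \<delta>\<rfloor> = \<lfloor>(u j - x) / \<delta>\<rfloor>" "i \<noteq> j"
  then have "\<bar>(u i - x) / \<delta> - (u j - x) / \<delta>\<bar> < 1" by linarith
  then have "\<bar>u i - u j\<bar> < \<delta>" using assms(1) by (simp add: field_simps abs_less_iff)
  then show False using separated_familyD[OF sep ij(1,2,4)] by simp
qed

lemma finite_separated_Int_Icc: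
  assumes "\<delta> > 0" "separated_by \<delta> A"
  shows "finite (A \<inter> {x..y})"
proof (rule finite_imageD)
  have "(\<lambda>l. \<lfloor>(l - 0) / \<delta>\<rfloor>) ` (A \<inter> {x..y}) \<subseteq> {\<lfloor>x / \<delta>\<rfloor>..\<lfloor>y / \<delta>\<rfloor>}"
    using assms by (auto intro!: floor_mono divide_right_mono)
  then show "finite ((\<lambda>l. \<lfloor>(l - 0) / \<delta>\<rfloor>) ` (A \<inter> {x..y}))"
    by (rule finite_subset) simp
  show "inj_on (\<lambda>l. \<lfloor>(l - 0) / \<delta>\<rfloor>) (A \<inter> {x..y})"
    using assms(1) separated_family_subset[OF assms(2)] by (intro inj_on_floor_separated) auto
qed

lemma sum_power_nat_abs_le:
  fixes q :: real
  assumes "0 \<le> q" "q < 1" "finite F"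
  shows "(\<Sum>n\<in>F. q ^ nat \<bar>n\<bar>) \<le> 2 / (1 - q)"
proof -
  have geometric: "(\<Sum>n\<in>N. q ^ n) \<le> 1 / (1 - q)" if "finite N" for N :: "nat set"
    using sum_le_suminf[OF summable_geometric[of q] that] suminf_geometric[of q] assms by simp
  have one_sided: "(\<Sum>n\<in>G. q ^ nat \<bar>n\<bar>) \<le> 1 / (1 - q)"
    if "finite G" "inj_on (\<lambda>n. nat \<bar>n\<bar>) G" for G :: "int set"
    using geometric[of "(\<lambda>n. nat \<bar>n\<bar>) ` G"] that by (simp add: sum.reindex)
  have "(\<Sum>n\<in>F. q ^ nat \<bar>n\<bar>) = (\<Sum>n\<in>F \<inter> {0..}. q ^ nat \<bar>n\<bar>) + (\<Sum>n\<in>F - {0..}. q ^ nat \<bar>n\<bar>)"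
    using sum.Int_Diff[OF assms(3)] by blast
  also have "\<dots> \<le> 1 / (1 - q) + 1 / (1 - q)"
    using assms by (intro add_mono one_sided) (auto simp: inj_on_def)
  finally show ?thesis by simp
qed

definition exp_sum_bound :: "real \<Rightarrow> real \<Rightarrow> real" where
  "exp_sum_bound \<epsilon> \<delta> = exp (\<epsilon> * \<delta>) * (2 / (1 - exp (- (\<epsilon> * \<delta>))))"

lemma exp_sum_bound_pos: "\<epsilon> > 0 \<Longrightarrow> \<delta> > 0 \<Longrightarrow> exp_sum_bound \<epsilon> \<delta> > 0"
  by (simp add: exp_sum_bound_def)

lemma exp_neg_abs_le_power_floor:
  fixes \<epsilon> \<delta> y :: real
  assumes "\<epsilon> > 0" "\<delta> > 0"
  shows "exp (- \<epsilon> * \<bar>y\<bar>) \<le> exp (\<epsilon> * \<delta>) * exp (- (\<epsilon> * \<delta>)) ^ nat \<bar>\<lfloor>y / \<delta>\<rfloor>\<bar>"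
proof -
  have "real_of_int \<bar>\<lfloor>y / \<delta>\<rfloor>\<bar> \<le> \<bar>y / \<delta>\<bar> + 1" by linarith
  then have "(\<epsilon> * \<delta>) * real_of_int \<bar>\<lfloor>y / \<delta>\<rfloor>\<bar> \<le> (\<epsilon> * \<delta>) * (\<bar>y / \<delta>\<bar> + 1)"
    using assms by (intro mult_left_mono) auto
  also have "\<dots> = \<epsilon> * \<bar>y\<bar> + \<epsilon> * \<delta>" using assms by (simp add: field_simps)
  finally have "- \<epsilon> * \<bar>y\<bar> \<le> \<epsilon> * \<delta> + real (nat \<bar>\<lfloor>y / \<delta>\<rfloor>\<bar>) * (- (\<epsilon> * \<delta>))"
    by (simp add: algebra_simps)
  then have "exp (- \<epsilon> * \<bar>y\<bar>) \<le> exp (\<epsilon> * \<delta> + real (nat \<bar>\<lfloor>y / \<delta>\<rfloor>\<bar>) * (- (\<epsilon> * \<delta>)))" by simp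
  also have "\<dots> = exp (\<epsilon> * \<delta>) * exp (- (\<epsilon> * \<delta>)) ^ nat \<bar>\<lfloor>y / \<delta>\<rfloor>\<bar>"
    unfolding exp_add exp_of_nat_mult ..
  finally show ?thesis .
qed

lemma sum_exp_separated_le:
  fixes \<epsilon> \<delta> :: real
  assumes "\<epsilon> > 0" "\<delta> > 0" and sep: "separated_family \<delta> u I" and fin: "finite I"
  shows "(\<Sum>i\<in>I. exp (- \<epsilon> * \<bar>x - u i\<bar>)) \<le> exp_sum_bound \<epsilon> \<delta>"
proof -
  define q where "q = exp (- (\<epsilon> * \<delta>))"
  define n where "n i = \<lfloor>(u i - x) / \<delta>\<rfloor>" for i
  have inj: "inj_on n I"
    unfolding n_def by (rule inj_on_floor_separated[OF assms(2) sep])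
  have "(\<Sum>i\<in>I. exp (- \<epsilon> * \<bar>x - u i\<bar>)) \<le> (\<Sum>i\<in>I. exp (\<epsilon> * \<delta>) * q ^ nat \<bar>n i\<bar>)"
    unfolding n_def q_def abs_minus_commute[of x]
    by (intro sum_mono exp_neg_abs_le_power_floor assms)
  also have "\<dots> = exp (\<epsilon> * \<delta>) * (\<Sum>k\<in>n ` I. q ^ nat \<bar>k\<bar>)"
    by (simp add: sum_distrib_left sum.reindex[OF inj])
  also have "\<dots> \<le> exp (\<epsilon> * \<delta>) * (2 / (1 - q))"
    using assms by (intro mult_left_mono sum_power_nat_abs_le) (auto simp: q_def)
  finally show ?thesis by (simp add: exp_sum_bound_def q_def)
qed

definition exp_conv :: "real \<Rightarrow> ('i \<Rightarrow> real) \<Rightarrow> 'i set \<Rightarrow> ('i \<Rightarrow> real) \<Rightarrow> real \<Rightarrow> real" where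
  "exp_conv \<epsilon> u I y x = (\<Sum>\<^sub>\<infinity>i\<in>I. exp (- \<epsilon> * \<bar>x - u i\<bar>) * y i)"

lemma exp_conv_nonneg: "(\<And>i. i \<in> I \<Longrightarrow> y i \<ge> 0) \<Longrightarrow> exp_conv \<epsilon> u I y x \<ge> 0"
  unfolding exp_conv_def by (intro infsum_nonneg) auto

lemma exp_summable_on_separated:
  assumes "\<epsilon> > 0" "\<delta> > 0" and sep: "separated_family \<delta> u I"
  shows "(\<lambda>i. exp (- \<epsilon> * \<bar>x - u i\<bar>)) summable_on I"
proof (rule nonneg_bdd_above_summable_on)
  show "bdd_above (sum (\<lambda>i. exp (- \<epsilon> * \<bar>x - u i\<bar>)) ` {F. F \<subseteq> I \<and> finite F})"
    by (rule bdd_aboveI2,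
      rule sum_exp_separated_le[OF assms(1,2) separated_family_subset[OF sep]]) auto
qed simp

lemma exp_conv_has_sum:
  assumes "\<epsilon> > 0" "\<delta> > 0" and sep: "separated_family \<delta> u I"
    and "\<And>i. i \<in> I \<Longrightarrow> 0 \<le> y i" "\<And>i. i \<in> I \<Longrightarrow> y i \<le> B"
  shows "((\<lambda>i. exp (- \<epsilon> * \<bar>x - u i\<bar>) * y i) has_sum exp_conv \<epsilon> u I y x) I"
  unfolding exp_conv_def
proof (rule has_sum_infsum, rule summable_on_comparison_test)
  show "(\<lambda>i. exp (- \<epsilon> * \<bar>x - u i\<bar>) * B) summable_on I"
    by (intro summable_on_cmult_left exp_summable_on_separated[OF assms(1-3)])
qed (use assms in \<open>auto intro: mult_left_mono\<close>)

lemma exp_conv_le: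
  assumes "\<epsilon> > 0" "\<delta> > 0" and sep: "separated_family \<delta> u I"
    and y: "\<And>i. i \<in> I \<Longrightarrow> 0 \<le> y i" "\<And>i. i \<in> I \<Longrightarrow> y i \<le> B" and B: "B \<ge> 0"
  shows "exp_conv \<epsilon> u I y x \<le> exp_sum_bound \<epsilon> \<delta> * B"
proof (rule has_sum_le_finite_sums[OF exp_conv_has_sum[OF assms(1-3) y]])
  fix F assume F: "finite F" "F \<subseteq> I"
  have "(\<Sum>i\<in>F. exp (- \<epsilon> * \<bar>x - u i\<bar>) * y i) \<le> (\<Sum>i\<in>F. exp (- \<epsilon> * \<bar>x - u i\<bar>)) * B"
    unfolding sum_distrib_right using F y by (intro sum_mono mult_left_mono) auto
  also have "\<dots> \<le> exp_sum_bound \<epsilon> \<delta> * B"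
    using F B by (intro mult_right_mono sum_exp_separated_le assms separated_family_subset[OF sep])
  finally show "(\<Sum>i\<in>F. exp (- \<epsilon> * \<bar>x - u i\<bar>) * y i) \<le> exp_sum_bound \<epsilon> \<delta> * B" .
qed

section \<open>Schur's test\<close>

lemma powr_weighted_sum_le_of_pos:
  fixes w y :: "'a \<Rightarrow> real"
  assumes p: "p \<ge> 1" and S: "finite S" "S \<noteq> {}" and pos: "\<And>i. i \<in> S \<Longrightarrow> w i > 0" "\<And>i. i \<in> S \<Longrightarrow> y i > 0"
  shows "(\<Sum>i\<in>S. w i * y i) powr p \<le> (\<Sum>i\<in>S. w i) powr (p - 1) * (\<Sum>i\<in>S. w i * y i powr p)"
proof -
  define W where "W = (\<Sum>i\<in>S. w i)"
  have W: "0 < W" unfolding W_def using S pos(1) by (rule sum_pos)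
  have jensen: "(\<Sum>i\<in>S. (w i / W) *\<^sub>R y i) powr p \<le> (\<Sum>i\<in>S. w i / W * y i powr p)"
  proof (rule convex_on_sum[OF S powr_convex[OF p]])
    show "(\<Sum>i\<in>S. w i / W) = 1"
      using W unfolding sum_divide_distrib[symmetric] W_def by simp
  qed (use W pos in \<open>auto intro: less_imp_le\<close>)
  have "(\<Sum>i\<in>S. w i * y i) powr p = (W * (\<Sum>i\<in>S. (w i / W) *\<^sub>R y i)) powr p"
    using W by (simp add: sum_distrib_left)
  also have "\<dots> = W powr p * (\<Sum>i\<in>S. (w i / W) *\<^sub>R y i) powr p"
    by (rule powr_mult)
  also have "\<dots> \<le> W powr p * (\<Sum>i\<in>S. w i / W * y i powr p)"
    by (intro mult_left_mono jensen) simp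
  also have "\<dots> = W powr (p - 1) * (\<Sum>i\<in>S. w i * y i powr p)"
    using W by (simp add: powr_diff sum_distrib_left)
  finally show ?thesis unfolding W_def .
qed

lemma powr_weighted_sum_le:
  fixes w y :: "'a \<Rightarrow> real"
  assumes p: "p \<ge> 1" and fin: "finite F" and w: "\<And>i. i \<in> F \<Longrightarrow> w i \<ge> 0" and y: "\<And>i. i \<in> F \<Longrightarrow> y i \<ge> 0"
    and E: "(\<Sum>i\<in>F. w i) \<le> E"
  shows "(\<Sum>i\<in>F. w i * y i) powr p \<le> E powr (p - 1) * (\<Sum>i\<in>F. w i * y i powr p)"
proof -
  define S where "S = {i\<in>F. w i > 0 \<and> y i > 0}"
  have restrict: "(\<Sum>i\<in>F. w i * g (y i)) = (\<Sum>i\<in>S. w i * g (y i))" if "g 0 = 0" for g :: "real \<Rightarrow> real"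
  proof (rule sum.mono_neutral_right[OF fin])
    show "\<forall>i\<in>F - S. w i * g (y i) = 0"
    proof
      fix i assume "i \<in> F - S"
      then have "w i = 0 \<or> y i = 0" using w[of i] y[of i] by (auto simp: S_def)
      then show "w i * g (y i) = 0" using that by auto
    qed
  qed (auto simp: S_def)
  have "(\<Sum>i\<in>S. w i * y i) powr p \<le> E powr (p - 1) * (\<Sum>i\<in>S. w i * y i powr p)"
  proof (cases "S = {}")
    case False
    have "(\<Sum>i\<in>S. w i) \<le> (\<Sum>i\<in>F. w i)" using fin w by (intro sum_mono2) (auto simp: S_def)
    then have "(\<Sum>i\<in>S. w i) powr (p - 1) \<le> E powr (p - 1)"
      using E p by (intro powr_mono2 sum_nonneg) (auto simp: S_def)
    moreover have "(\<Sum>i\<in>S. w i * y i) powr p \<le> (\<Sum>i\<in>S. w i) powr (p - 1) * (\<Sum>i\<in>S. w i * y i powr p)"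
      by (rule powr_weighted_sum_le_of_pos[OF p _ False]) (use fin in \<open>auto simp: S_def\<close>)
    moreover have "0 \<le> (\<Sum>i\<in>S. w i * y i powr p)" by (intro sum_nonneg) (auto simp: S_def)
    ultimately show ?thesis using order_trans mult_right_mono by blast
  qed simp
  then show ?thesis using restrict[of "\<lambda>t. t"] restrict[of "\<lambda>t. t powr p"] by simp
qed

lemma schur_test_finite:
  fixes g :: "'a \<Rightarrow> 'b \<Rightarrow> real"
  assumes "p \<ge> 1" "finite K" "finite F"
    and "\<And>k i. k \<in> K \<Longrightarrow> i \<in> F \<Longrightarrow> g k i \<ge> 0" and "\<And>i. i \<in> F \<Longrightarrow> y i \<ge> 0"
    and row: "\<And>k. k \<in> K \<Longrightarrow> (\<Sum>i\<in>F. g k i) \<le> E"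
    and col: "\<And>i. i \<in> F \<Longrightarrow> (\<Sum>k\<in>K. g k i) \<le> E'"
  shows "(\<Sum>k\<in>K. (\<Sum>i\<in>F. g k i * y i) powr p) \<le> E powr (p - 1) * E' * (\<Sum>i\<in>F. y i powr p)"
proof -
  have "(\<Sum>k\<in>K. (\<Sum>i\<in>F. g k i * y i) powr p) \<le> (\<Sum>k\<in>K. E powr (p - 1) * (\<Sum>i\<in>F. g k i * y i powr p))"
    using assms by (intro sum_mono powr_weighted_sum_le) auto
  also have "\<dots> = E powr (p - 1) * (\<Sum>i\<in>F. (\<Sum>k\<in>K. g k i) * y i powr p)"
    unfolding sum_distrib_left[symmetric] sum_distrib_right by (subst sum.swap) simp
  also have "\<dots> \<le> E powr (p - 1) * (\<Sum>i\<in>F. E' * y i powr p)"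
    by (intro mult_left_mono sum_mono mult_right_mono col) auto
  also have "\<dots> = E powr (p - 1) * E' * (\<Sum>i\<in>F. y i powr p)"
    by (simp add: sum_distrib_left mult.assoc)
  finally show ?thesis .
qed

lemma schur_test:
  fixes g :: "'a \<Rightarrow> 'b \<Rightarrow> real"
  assumes p: "p \<ge> 1"
    and g: "\<And>k i. k \<in> A \<Longrightarrow> i \<in> B \<Longrightarrow> g k i \<ge> 0" and y: "\<And>i. i \<in> B \<Longrightarrow> y i \<ge> 0"
    and row: "\<And>k F. k \<in> A \<Longrightarrow> finite F \<Longrightarrow> F \<subseteq> B \<Longrightarrow> (\<Sum>i\<in>F. g k i) \<le> E"
    and col: "\<And>i F. i \<in> B \<Longrightarrow> finite F \<Longrightarrow> F \<subseteq> A \<Longrightarrow> (\<Sum>k\<in>F. g k i) \<le> E'"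
    and b: "\<And>k. k \<in> A \<Longrightarrow> ((\<lambda>i. g k i * y i) has_sum b k) B"
    and y_summable: "(\<lambda>i. y i powr p) summable_on B" and "E' \<ge> 0"
  shows "(\<lambda>k. b k powr p) summable_on A"
    and "(\<Sum>\<^sub>\<infinity>k\<in>A. b k powr p) \<le> E powr (p - 1) * E' * (\<Sum>\<^sub>\<infinity>i\<in>B. y i powr p)"
proof -
  define C where "C = E powr (p - 1) * E' * (\<Sum>\<^sub>\<infinity>i\<in>B. y i powr p)"
  have finite_sum_le: "(\<Sum>k\<in>K. b k powr p) \<le> C" if K: "finite K" "K \<subseteq> A" for K
  proof (rule tendsto_upperbound)
    show "((\<lambda>F. \<Sum>k\<in>K. (\<Sum>i\<in>F. g k i * y i) powr p) \<longlongrightarrow> (\<Sum>k\<in>K. b k powr p)) (finite_subsets_at_top B)"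
    proof (intro tendsto_sum tendsto_powr')
      fix k assume "k \<in> K"
      then show "((\<lambda>F. \<Sum>i\<in>F. g k i * y i) \<longlongrightarrow> b k) (finite_subsets_at_top B)"
        using b[of k] K by (auto simp: has_sum_def)
      show "b k \<noteq> 0 \<or> p > 0 \<and> (\<forall>\<^sub>F F in finite_subsets_at_top B. 0 \<le> (\<Sum>i\<in>F. g k i * y i))"
        using p K \<open>k \<in> K\<close>
        by (intro disjI2 conjI eventually_finite_subsets_at_top_weakI sum_nonneg
            mult_nonneg_nonneg g y) auto
    qed simp
    show "\<forall>\<^sub>F F in finite_subsets_at_top B. (\<Sum>k\<in>K. (\<Sum>i\<in>F. g k i * y i) powr p) \<le> C"
    proof (rule eventually_finite_subsets_at_top_weakI)
      fix F assume F: "finite F" "F \<subseteq> B"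
      have "(\<Sum>k\<in>K. (\<Sum>i\<in>F. g k i * y i) powr p) \<le> E powr (p - 1) * E' * (\<Sum>i\<in>F. y i powr p)"
        using F K by (intro schur_test_finite p g y row col) auto
      also have "\<dots> \<le> C"
        unfolding C_def using F \<open>E' \<ge> 0\<close> y_summable
        by (intro mult_left_mono finite_sum_le_infsum) auto
      finally show "(\<Sum>k\<in>K. (\<Sum>i\<in>F. g k i * y i) powr p) \<le> C" .
    qed
  qed simp
  show "(\<lambda>k. b k powr p) summable_on A"
    by (rule nonneg_bdd_above_summable_on) (auto intro!: bdd_aboveI[of _ C] finite_sum_le)
  then show "(\<Sum>\<^sub>\<infinity>k\<in>A. b k powr p) \<le> E powr (p - 1) * E' * (\<Sum>\<^sub>\<infinity>i\<in>B. y i powr p)"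
    unfolding C_def[symmetric] by (rule infsum_le_finite_sums) (use finite_sum_le in auto)
qed

lemma le_infsum_powr:
  fixes y :: "'i \<Rightarrow> real"
  assumes "p > 0" "(\<lambda>i. y i powr p) summable_on I" "i \<in> I" "y i \<ge> 0"
  shows "y i \<le> (\<Sum>\<^sub>\<infinity>i\<in>I. y i powr p) powr (1 / p)"
proof -
  have "y i powr p \<le> (\<Sum>\<^sub>\<infinity>i\<in>I. y i powr p)"
    using finite_sum_le_infsum[OF assms(2), of "{i}"] assms(3) by simp
  then have "(y i powr p) powr (1 / p) \<le> (\<Sum>\<^sub>\<infinity>i\<in>I. y i powr p) powr (1 / p)"
    using assms(1) by (intro powr_mono2) auto
  then show ?thesis using assms(1,4) by (simp add: powr_powr)
qed

lemma exp_conv_schur: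
  assumes \<epsilon>: "\<epsilon> > 0" and \<delta>: "\<delta> > 0" and p: "p \<ge> 1"
    and u: "separated_family \<delta> u I" and v: "separated_family \<delta> v J"
    and y: "\<And>i. i \<in> I \<Longrightarrow> y i \<ge> 0" and y_summable: "(\<lambda>i. y i powr p) summable_on I"
  shows "(\<lambda>k. exp_conv \<epsilon> u I y (v k) powr p) summable_on J"
    and "(\<Sum>\<^sub>\<infinity>k\<in>J. exp_conv \<epsilon> u I y (v k) powr p) \<le> exp_sum_bound \<epsilon> \<delta> powr p * (\<Sum>\<^sub>\<infinity>i\<in>I. y i powr p)"
proof -
  define E where "E = exp_sum_bound \<epsilon> \<delta>"
  have E: "E > 0" unfolding E_def by (rule exp_sum_bound_pos[OF \<epsilon> \<delta>])
  have row: "(\<Sum>i\<in>F. exp (- \<epsilon> * \<bar>v k - u i\<bar>)) \<le> E" if "finite F" "F \<subseteq> I" for k F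
    unfolding E_def using that by (intro sum_exp_separated_le \<epsilon> \<delta> separated_family_subset[OF u])
  have col: "(\<Sum>k\<in>F. exp (- \<epsilon> * \<bar>v k - u i\<bar>)) \<le> E" if "finite F" "F \<subseteq> J" for i F
    unfolding E_def abs_minus_commute[of "v _"]
    using that by (intro sum_exp_separated_le \<epsilon> \<delta> separated_family_subset[OF v])
  have conv: "((\<lambda>i. exp (- \<epsilon> * \<bar>v k - u i\<bar>) * y i) has_sum exp_conv \<epsilon> u I y (v k)) I" for k
    using le_infsum_powr[OF _ y_summable] p y by (intro exp_conv_has_sum[OF \<epsilon> \<delta> u]) auto
  note schur = schur_test[where A = J and B = I and y = y
      and g = "\<lambda>k i. exp (- \<epsilon> * \<bar>v k - u i\<bar>)" and b = "\<lambda>k. exp_conv \<epsilon> u I y (v k)",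
      OF p exp_ge_zero y row col conv y_summable less_imp_le[OF E]]
  show "(\<lambda>k. exp_conv \<epsilon> u I y (v k) powr p) summable_on J"
    by (rule schur(1)) auto
  have "(\<Sum>\<^sub>\<infinity>k\<in>J. exp_conv \<epsilon> u I y (v k) powr p) \<le> E powr (p - 1) * E * (\<Sum>\<^sub>\<infinity>i\<in>I. y i powr p)"
    by (rule schur(2)) auto
  also have "E powr (p - 1) * E = E powr p" using E by (simp add: powr_diff)
  finally show "(\<Sum>\<^sub>\<infinity>k\<in>J. exp_conv \<epsilon> u I y (v k) powr p)
      \<le> exp_sum_bound \<epsilon> \<delta> powr p * (\<Sum>\<^sub>\<infinity>i\<in>I. y i powr p)"
    unfolding E_def .
qed

section \<open>Underdetermined linear systems\<close>

lemma underdetermined_system: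
  fixes A :: "'j \<Rightarrow> 'i \<Rightarrow> 'a :: field"
  assumes "finite J" "finite I" "card J < card I"
  shows "\<exists>c. (\<forall>i. i \<notin> I \<longrightarrow> c i = 0) \<and> (\<exists>i. c i \<noteq> 0) \<and> (\<forall>j\<in>J. (\<Sum>i\<in>I. A j i * c i) = 0)"
  using assms
proof (induction J arbitrary: A I rule: finite_induct)
  case empty
  then obtain i0 where "i0 \<in> I" by fastforce
  then show ?case by (intro exI[of _ "\<lambda>i. if i = i0 then 1 else 0"]) auto
next
  case (insert j J)
  show ?case
  proof (cases "\<exists>i0\<in>I. A j i0 \<noteq> 0")
    case False
    then have "(\<Sum>i\<in>I. A j i * c i) = 0" for c by simp
    then show ?thesis using insert.IH[of I A] insert.prems insert.hyps by auto
  next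
    case True
    then obtain i0 where i0: "i0 \<in> I" "A j i0 \<noteq> 0" by blast
    define eliminated where "eliminated k i = A k i - A k i0 / A j i0 * A j i" for k i
    have "card J < card (I - {i0})" using insert.prems insert.hyps i0(1) by simp
    then obtain c i1 where c: "\<And>i. i \<notin> I - {i0} \<Longrightarrow> c i = 0" "c i1 \<noteq> 0"
        and eliminated_eq_0: "\<And>k. k \<in> J \<Longrightarrow> (\<Sum>i\<in>I - {i0}. eliminated k i * c i) = 0"
      using insert.IH[of "I - {i0}" eliminated] insert.prems by blast
    define d where "d = c(i0 := - (\<Sum>i\<in>I - {i0}. A j i * c i) / A j i0)"
    have "(\<Sum>i\<in>I. A k i * d i) = (\<Sum>i\<in>I - {i0}. eliminated k i * c i)" for k
      using sum.remove[OF insert.prems(1) i0(1), of "\<lambda>i. A k i * d i"]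
      by (simp add: d_def eliminated_def left_diff_distrib sum_subtractf sum_distrib_left
          sum_divide_distrib mult.assoc)
    moreover have "eliminated j i = 0" for i using i0(2) by (simp add: eliminated_def)
    ultimately have "\<forall>k\<in>insert j J. (\<Sum>i\<in>I. A k i * d i) = 0" using eliminated_eq_0 by simp
    moreover have "d i1 \<noteq> 0" using c by (auto simp: d_def)
    moreover have "\<forall>i. i \<notin> I \<longrightarrow> d i = 0" using c(1) i0(1) by (auto simp: d_def)
    ultimately show ?thesis by blast
  qed
qed

section \<open>Derivatives of functions in the shift-invariant space\<close>

lemma open_strip: "open {z. \<bar>Im z\<bar> < r}"
  by (intro open_Collect_less continuous_intros)

lemma norm_cosh_ge: "cosh (Re w) * cos (Im w) \<le> norm (cosh w)"
proof -
  have "cosh (Re w) * cos (Im w) = Re (cosh w)"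
    by (simp add: cosh_field_def Re_exp algebra_simps add_divide_distrib)
  also have "\<dots> \<le> norm (cosh w)" by (rule complex_Re_le_cmod)
  finally show ?thesis .
qed

lemma higher_deriv_sum:
  assumes "\<And>i. i \<in> I \<Longrightarrow> f i holomorphic_on A" "open A" "z \<in> A"
  shows "(deriv ^^ n) (\<lambda>w. \<Sum>i\<in>I. f i w) z = (\<Sum>i\<in>I. (deriv ^^ n) (f i) z)"
  using assms(1)
proof (induction I rule: infinite_finite_induct)
  case (insert i I)
  then have "(deriv ^^ n) (\<lambda>w. f i w + (\<Sum>i\<in>I. f i w)) z
      = (deriv ^^ n) (f i) z + (deriv ^^ n) (\<lambda>w. \<Sum>i\<in>I. f i w) z"
    using assms by (intro higher_deriv_add) (auto intro!: holomorphic_intros)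
  then show ?case using insert by simp
qed simp_all

lemma
  fixes g :: "'i \<Rightarrow> complex \<Rightarrow> complex"
  assumes g: "\<And>i. g i holomorphic_on A" and A: "open A"
    and dominated: "\<And>i z. z \<in> A \<Longrightarrow> norm (g i z) \<le> b i" and b: "b summable_on UNIV"
    and F: "\<And>z. z \<in> A \<Longrightarrow> ((\<lambda>i. g i z) has_sum F z) UNIV"
  shows holomorphic_on_has_sum: "F holomorphic_on A"
    and higher_deriv_has_sum: "z \<in> A \<Longrightarrow> ((\<lambda>i. (deriv ^^ j) (g i) z) has_sum (deriv ^^ j) F z) UNIV"
proof -
  have uniform: "uniform_limit A (\<lambda>X z. \<Sum>i\<in>X. g i z) F (finite_subsets_at_top UNIV)"
    using dominated F b by (intro Weierstrass_m_test_general'[where M = b]) auto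
  have partial_sums: "(\<lambda>z. \<Sum>i\<in>X. g i z) holomorphic_on A" for X
    using g by (intro holomorphic_intros)
  show "F holomorphic_on A"
  proof (rule holomorphic_onI)
    fix z assume "z \<in> A"
    then obtain r where r: "r > 0" "cball z r \<subseteq> A" using A open_contains_cball by blast
    have "F holomorphic_on ball z r"
    proof (rule holomorphic_uniform_limit)
      show "\<forall>\<^sub>F X in finite_subsets_at_top UNIV. continuous_on (cball z r) (\<lambda>z. \<Sum>i\<in>X. g i z) \<and>
            (\<lambda>z. \<Sum>i\<in>X. g i z) holomorphic_on ball z r"
        using r by (intro always_eventually allI conjI)
          (auto intro!: holomorphic_on_imp_continuous_on holomorphic_on_subset[OF partial_sums])
      show "uniform_limit (cball z r) (\<lambda>X z. \<Sum>i\<in>X. g i z) F (finite_subsets_at_top UNIV)"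
        using uniform r(2) by (rule uniform_limit_on_subset)
    qed auto
    then show "F field_differentiable at z within A"
      using r holomorphic_on_imp_differentiable_at[of F "ball z r" z]
      by (auto intro: field_differentiable_at_within)
  qed
  assume z: "z \<in> A"
  have "((\<lambda>X. (deriv ^^ j) (\<lambda>z. \<Sum>i\<in>X. g i z) z) \<longlongrightarrow> (deriv ^^ j) F z) (finite_subsets_at_top UNIV)"
    by (rule higher_deriv_complex_uniform_limit[OF uniform _ _ A z]) (auto simp: partial_sums)
  then show "((\<lambda>i. (deriv ^^ j) (g i) z) has_sum (deriv ^^ j) F z) UNIV"
    unfolding has_sum_def using higher_deriv_sum[of _ g A z j, OF g A z] by simp
qed

lemma hderiv_of_holomorphic:
  assumes "F holomorphic_on A" "open A" "\<And>x. of_real x \<in> A"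
  shows "hderiv j (\<lambda>x. F (of_real x)) x = (deriv ^^ j) F (of_real x)"
proof (induction j arbitrary: x)
  case 0 then show ?case by (simp add: hderiv_def)
next
  case (Suc j)
  have "((\<lambda>x. (deriv ^^ j) F (of_real x))
      has_vector_derivative (deriv ^^ Suc j) F (of_real x)) (at x)"
    using has_field_derivative_higher_deriv[OF assms(1,2) assms(3)]
    by (intro has_vector_derivative_real_field) auto
  moreover have "hderiv j (\<lambda>x. F (of_real x)) = (\<lambda>x. (deriv ^^ j) F (of_real x))"
    using Suc by blast
  ultimately show ?case by (simp add: hderiv_def vector_derivative_at)
qed

lemma hderiv_0 [simp]: "hderiv 0 f = f"
  by (simp add: hderiv_def)

lemma generated_by_translate:
  assumes "generated_by \<psi> c f"
  shows "generated_by \<psi> (\<lambda>l. c (l + k)) (\<lambda>x. f (x + real_of_int k))"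
  unfolding generated_by_def
proof
  fix x
  have "((\<lambda>l. c l * complex_of_real (\<psi> (x + real_of_int k - real_of_int l)))
      has_sum f (x + real_of_int k)) UNIV"
    using assms unfolding generated_by_def by blast
  then show "((\<lambda>l. c (l + k) * complex_of_real (\<psi> (x - real_of_int l)))
      has_sum f (x + real_of_int k)) UNIV"
    by (rule has_sum_reindex_bij_witness[of _ "\<lambda>l. l + k" "\<lambda>l. l - k", THEN iffD1, rotated -1])
      (auto simp: algebra_simps)
qed

locale sech_generator =
  fixes a :: real
  assumes a_pos: "a > 0"
begin

abbreviation pole_height :: real where
  "pole_height \<equiv> pi / (2 * a)"

abbreviation radius :: real where
  "radius \<equiv> pi / (3 * a)"

abbreviation strip :: "complex set" where
  "strip \<equiv> {z. \<bar>Im z\<bar> < pole_height}"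

lemma radius_pos: "0 < radius"
  using a_pos by simp

lemma radius_less: "radius < pole_height"
  using a_pos by (simp add: field_simps)

lemma cball_subset_strip: "cball (of_real x) radius \<subseteq> strip"
proof
  fix z assume "z \<in> cball (complex_of_real x) radius"
  then have "\<bar>Im z\<bar> \<le> radius"
    using abs_Im_le_cmod[of "z - of_real x"] by (simp add: dist_norm norm_minus_commute)
  then show "z \<in> strip" using radius_less by simp
qed

definition csech :: "complex \<Rightarrow> complex" where
  "csech z = 1 / cosh (of_real a * z)"

definition dsech :: "nat \<Rightarrow> real \<Rightarrow> complex" where
  "dsech j x = (deriv ^^ j) csech (of_real x)"

lemma csech_of_real: "csech (of_real x) = of_real (sech_a a x)"
  by (simp add: csech_def sech_a_def cosh_field_def exp_of_real flip: of_real_mult of_real_minus)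

lemma csech_holomorphic: "csech holomorphic_on strip"
proof -
  have "cosh (of_real a * z) \<noteq> 0" if "z \<in> strip" for z
  proof -
    have "\<bar>a * Im z\<bar> < pi / 2" using that a_pos by (simp add: abs_mult field_simps)
    then have "cos (a * Im z) > 0" by (intro cos_gt_zero_pi) auto
    then have "cosh (a * Re z) * cos (a * Im z) > 0" by simp
    then show ?thesis using norm_cosh_ge[of "of_real a * z"] by auto
  qed
  then show ?thesis
    unfolding csech_def[abs_def] cosh_field_def by (intro holomorphic_intros) auto
qed

lemma csech_translate_holomorphic: "(\<lambda>z. csech (z - of_int l)) holomorphic_on strip"
proof -
  have "(csech \<circ> (\<lambda>z. z - of_int l)) holomorphic_on strip"
    by (rule holomorphic_on_compose_gen[OF _ csech_holomorphic]) (auto intro!: holomorphic_intros)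
  then show ?thesis by (simp add: o_def)
qed

lemma norm_csech_le:
  assumes "\<bar>Im z\<bar> \<le> radius"
  shows "norm (csech z) \<le> 4 * exp (- a * \<bar>Re z\<bar>)"
proof -
  have "\<bar>a * Im z\<bar> \<le> pi / 3" using assms a_pos by (simp add: abs_mult field_simps)
  then have "cos (pi / 3) \<le> cos \<bar>a * Im z\<bar>" by (intro cos_monotone_0_pi_le) auto
  then have "cos (a * Im z) \<ge> 1 / 2" by (simp add: cos_60)
  moreover have "exp \<bar>a * Re z\<bar> / 2 \<le> cosh (a * Re z)"
    by (auto simp: cosh_field_def abs_if)
  ultimately have "exp \<bar>a * Re z\<bar> / 2 * (1 / 2) \<le> cosh (a * Re z) * cos (a * Im z)"
    by (intro mult_mono) auto
  also have "\<dots> \<le> norm (cosh (of_real a * z))" using norm_cosh_ge[of "of_real a * z"] by simp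
  finally have cosh_ge: "exp (a * \<bar>Re z\<bar>) / 4 \<le> norm (cosh (of_real a * z))"
    using a_pos by (simp add: abs_mult)
  then have "1 / norm (cosh (of_real a * z)) \<le> 1 / (exp (a * \<bar>Re z\<bar>) / 4)"
    by (rule divide_left_mono) (use less_le_trans[OF _ cosh_ge, of 0] in auto)
  also have "\<dots> = 4 * exp (- a * \<bar>Re z\<bar>)" by (simp add: exp_minus field_simps)
  finally show ?thesis by (simp add: csech_def norm_divide)
qed

lemma norm_csech_near_real_le:
  assumes "norm (z - of_real x) \<le> radius"
  shows "norm (csech (z - of_real y)) \<le> 4 * exp (pi / 3) * exp (- a * \<bar>x - y\<bar>)"
proof -
  have "\<bar>Re z - x\<bar> \<le> radius" "\<bar>Im z\<bar> \<le> radius"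
    using assms abs_Re_le_cmod[of "z - of_real x"] abs_Im_le_cmod[of "z - of_real x"] by auto
  then have "norm (csech (z - of_real y)) \<le> 4 * exp (- a * \<bar>Re z - y\<bar>)"
    using norm_csech_le[of "z - of_real y"] by simp
  also have "\<dots> \<le> 4 * exp (a * radius + - a * \<bar>x - y\<bar>)"
  proof -
    have "a * \<bar>x - y\<bar> \<le> a * (\<bar>Re z - y\<bar> + radius)"
      using a_pos \<open>\<bar>Re z - x\<bar> \<le> radius\<close> by (intro mult_left_mono) auto
    then show ?thesis by (simp add: algebra_simps)
  qed
  also have "\<dots> = 4 * exp (pi / 3) * exp (- a * \<bar>x - y\<bar>)" using a_pos unfolding exp_add by simp
  finally show ?thesis .
qed

definition dsech_bound :: "nat \<Rightarrow> real" where
  "dsech_bound M = (\<Sum>j\<le>M. fact j * (4 * exp (pi / 3)) / radius ^ j)"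

lemma dsech_bound_pos: "dsech_bound M > 0"
  unfolding dsech_bound_def using radius_pos by (intro sum_pos divide_pos_pos mult_pos_pos) auto

lemma norm_dsech_le:
  assumes "j \<le> M"
  shows "norm (dsech j x) \<le> dsech_bound M * exp (- a * \<bar>x\<bar>)"
proof -
  have hol: "csech holomorphic_on cball (of_real x) radius"
    using csech_holomorphic cball_subset_strip by (rule holomorphic_on_subset)
  have "norm (dsech j x) \<le> fact j * (4 * exp (pi / 3) * exp (- a * \<bar>x\<bar>)) / radius ^ j"
    unfolding dsech_def
  proof (rule Cauchy_inequality)
    fix z :: complex assume "norm (of_real x - z) = radius"
    then show "norm (csech z) \<le> 4 * exp (pi / 3) * exp (- a * \<bar>x\<bar>)"
      using norm_csech_near_real_le[of z x 0] by (simp add: norm_minus_commute)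
  qed (use hol radius_pos in \<open>auto intro: holomorphic_on_imp_continuous_on holomorphic_on_subset\<close>)
  also have "\<dots> = fact j * (4 * exp (pi / 3)) / radius ^ j * exp (- a * \<bar>x\<bar>)" by simp
  also have "\<dots> \<le> dsech_bound M * exp (- a * \<bar>x\<bar>)"
    unfolding dsech_bound_def using assms a_pos by (intro mult_right_mono member_le_sum) auto
  finally show ?thesis .
qed

lemma dsech_translate:
  "(deriv ^^ j) (\<lambda>z. csech (z - of_int l)) (of_real x) = dsech j (x - real_of_int l)"
  using higher_deriv_compose_linear'[OF csech_holomorphic open_strip[of pole_height]
      open_strip[of pole_height], of "of_real x" 1 "- of_int l" j] a_pos
  by (simp add: dsech_def)

definition csech_series :: "(int \<Rightarrow> complex) \<Rightarrow> complex \<Rightarrow> complex" where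
  "csech_series c z = (\<Sum>\<^sub>\<infinity>l. c l * csech (z - of_int l))"

lemma csech_terms_dominated:
  assumes "bounded (range c)"
  obtains b where "b summable_on UNIV"
    "\<And>l z. z \<in> ball (of_real x) radius \<Longrightarrow> norm (c l * csech (z - of_int l)) \<le> b l"
proof -
  obtain B where B: "\<And>l. norm (c l) \<le> B" using assms by (auto simp: bounded_iff)
  show thesis
  proof (rule that)
    show "(\<lambda>l. B * (4 * exp (pi / 3)) * exp (- a * \<bar>x - real_of_int l\<bar>)) summable_on UNIV"
      by (intro summable_on_cmult_right exp_summable_on_separated[OF a_pos zero_less_one]
          separated_family_of_int order_refl)
    fix l z assume "z \<in> ball (complex_of_real x) radius"
    then have "norm (csech (z - of_real (real_of_int l)))
        \<le> 4 * exp (pi / 3) * exp (- a * \<bar>x - real_of_int l\<bar>)"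
      by (intro norm_csech_near_real_le) (simp add: dist_norm norm_minus_commute)
    then have "norm (c l) * norm (csech (z - of_real (real_of_int l)))
        \<le> B * (4 * exp (pi / 3) * exp (- a * \<bar>x - real_of_int l\<bar>))"
      using B order_trans[OF norm_ge_zero B] by (intro mult_mono) auto
    then show "norm (c l * csech (z - of_int l))
        \<le> B * (4 * exp (pi / 3)) * exp (- a * \<bar>x - real_of_int l\<bar>)"
      by (simp add: norm_mult)
  qed
qed

lemma csech_series_has_sum:
  assumes "bounded (range c)" and z: "z \<in> ball (of_real x) radius"
  shows "((\<lambda>l. c l * csech (z - of_int l)) has_sum csech_series c z) UNIV"
proof -
  obtain b where b: "b summable_on UNIV"
      "\<And>l z. z \<in> ball (of_real x) radius \<Longrightarrow> norm (c l * csech (z - of_int l)) \<le> b l"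
    using csech_terms_dominated[OF assms(1)] by blast
  have "(\<lambda>l. norm (c l * csech (z - of_int l))) summable_on UNIV"
    by (rule summable_on_comparison_test[OF b(1)]) (use b(2)[OF z] in auto)
  then show ?thesis unfolding csech_series_def by (rule has_sum_infsum[OF abs_summable_summable])
qed

lemma
  assumes c: "bounded (range c)"
  shows csech_series_holomorphic_on_ball: "csech_series c holomorphic_on ball (of_real x) radius"
    and csech_series_higher_deriv:
      "((\<lambda>l. c l * dsech j (x - real_of_int l))
          has_sum (deriv ^^ j) (csech_series c) (of_real x)) UNIV"
proof -
  obtain b where b: "b summable_on UNIV"
      "\<And>l z. z \<in> ball (of_real x) radius \<Longrightarrow> norm (c l * csech (z - of_int l)) \<le> b l"
    using csech_terms_dominated[OF c] by blast
  have ball: "ball (of_real x) radius \<subseteq> strip"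
    using cball_subset_strip ball_subset_cball by blast
  have hol: "(\<lambda>z. c l * csech (z - of_int l)) holomorphic_on ball (of_real x) radius" for l
    by (intro holomorphic_on_mult holomorphic_on_const
        holomorphic_on_subset[OF csech_translate_holomorphic ball])
  show "csech_series c holomorphic_on ball (of_real x) radius"
    by (rule holomorphic_on_has_sum[OF hol open_ball b(2,1) csech_series_has_sum[OF c]])
  have "((\<lambda>l. (deriv ^^ j) (\<lambda>z. c l * csech (z - of_int l)) (of_real x))
      has_sum (deriv ^^ j) (csech_series c) (of_real x)) UNIV"
    by (rule higher_deriv_has_sum[OF hol open_ball b(2,1) csech_series_has_sum[OF c]])
      (simp_all add: a_pos)
  moreover have "(deriv ^^ j) (\<lambda>z. c l * csech (z - of_int l)) (of_real x)
      = c l * dsech j (x - real_of_int l)" for l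
    using a_pos higher_deriv_cmult[OF csech_translate_holomorphic _ open_strip, of "of_real x"]
    by (simp add: dsech_translate)
  ultimately show "((\<lambda>l. c l * dsech j (x - real_of_int l))
      has_sum (deriv ^^ j) (csech_series c) (of_real x)) UNIV"
    by simp
qed

lemma csech_series_holomorphic:
  assumes "bounded (range c)"
  shows "csech_series c holomorphic_on (\<Union>x. ball (of_real x) radius)"
  using csech_series_holomorphic_on_ball[OF assms] by (intro holomorphic_on_UN_open) auto

lemma of_real_in_union_ball: "complex_of_real x \<in> (\<Union>x. ball (of_real x) radius)"
  using radius_pos by (intro UN_I[of x]) auto

lemma generated_by_imp_csech_series:
  assumes c: "bounded (range c)" and f: "generated_by (sech_a a) c f"
  shows "f = (\<lambda>x. csech_series c (of_real x))"
proof
  fix x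
  have "csech (of_real x - of_int l) = of_real (sech_a a (x - real_of_int l))" for l
    using csech_of_real[of "x - real_of_int l"] by simp
  then have "((\<lambda>l. c l * csech (of_real x - of_int l)) has_sum f x) UNIV"
    using f unfolding generated_by_def by simp
  moreover have "((\<lambda>l. c l * csech (of_real x - of_int l)) has_sum csech_series c (of_real x)) UNIV"
    using radius_pos by (intro csech_series_has_sum[OF c, of _ x]) auto
  ultimately show "f x = csech_series c (of_real x)" by (rule has_sum_unique)
qed

lemma hderiv_has_sum:
  assumes c: "bounded (range c)" and f: "generated_by (sech_a a) c f"
  shows "((\<lambda>l. c l * dsech j (x - real_of_int l)) has_sum hderiv j f x) UNIV"
proof -
  have "hderiv j f x = (deriv ^^ j) (csech_series c) (of_real x)"
    unfolding generated_by_imp_csech_series[OF c f]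
    by (rule hderiv_of_holomorphic[OF csech_series_holomorphic[OF c] _ of_real_in_union_ball]) blast
  then show ?thesis using csech_series_higher_deriv[OF c] by simp
qed

lemma hderiv_translate:
  assumes c: "bounded (range c)" and f: "generated_by (sech_a a) c f"
  shows "hderiv j (\<lambda>x. f (x + real_of_int k)) x = hderiv j f (x + real_of_int k)"
proof -
  have "bounded (range (\<lambda>l. c (l + k)))" by (rule bounded_subset[OF c]) auto
  then have "((\<lambda>l. c (l + k) * dsech j (x - real_of_int l))
      has_sum hderiv j (\<lambda>x. f (x + real_of_int k)) x) UNIV"
    by (rule hderiv_has_sum[OF _ generated_by_translate[OF f]])
  moreover have "((\<lambda>l. c (l + k) * dsech j (x - real_of_int l))
      has_sum hderiv j f (x + real_of_int k)) UNIV"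
    using hderiv_has_sum[OF c f, of j "x + real_of_int k"]
    by (rule has_sum_reindex_bij_witness[of _ "\<lambda>l. l + k" "\<lambda>l. l - k", THEN iffD1, rotated -1])
      (auto simp: algebra_simps)
  ultimately show ?thesis by (rule has_sum_unique)
qed

lemma generated_by_continuous:
  assumes c: "bounded (range c)" and f: "generated_by (sech_a a) c f"
  shows "continuous_on UNIV f"
  unfolding generated_by_imp_csech_series[OF c f]
  using holomorphic_on_imp_continuous_on[OF csech_series_holomorphic[OF c]]
  by (rule continuous_on_compose2) (use of_real_in_union_ball in \<open>auto intro!: continuous_intros\<close>)

abbreviation coeff_conv :: "(int \<Rightarrow> complex) \<Rightarrow> real \<Rightarrow> real" where
  "coeff_conv c \<equiv> exp_conv a real_of_int UNIV (\<lambda>l. norm (c l))"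

lemma norm_hderiv_le_exp_conv:
  assumes \<epsilon>: "0 < \<epsilon>" "\<epsilon> \<le> a" and c: "bounded (range c)" and f: "generated_by (sech_a a) c f"
    and j: "j \<le> M"
    and far: "\<And>l. c l \<noteq> 0 \<Longrightarrow> d \<le> \<bar>x - real_of_int l\<bar>"
  shows "norm (hderiv j f x)
    \<le> dsech_bound M * exp (- (a - \<epsilon>) * d) * exp_conv \<epsilon> real_of_int UNIV (\<lambda>l. norm (c l)) x"
proof (rule norm_infsum_le[OF hderiv_has_sum[OF c f]])
  let ?D = "dsech_bound M * exp (- (a - \<epsilon>) * d)"
  obtain B where "\<And>l. norm (c l) \<le> B" using c by (auto simp: bounded_iff)
  then show "((\<lambda>l. ?D * (exp (- \<epsilon> * \<bar>x - real_of_int l\<bar>) * norm (c l)))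
      has_sum ?D * exp_conv \<epsilon> real_of_int UNIV (\<lambda>l. norm (c l)) x) UNIV"
    by (intro has_sum_cmult_right exp_conv_has_sum[OF \<epsilon>(1) zero_less_one]
        separated_family_of_int) auto
  fix l
  show "norm (c l * dsech j (x - real_of_int l))
      \<le> ?D * (exp (- \<epsilon> * \<bar>x - real_of_int l\<bar>) * norm (c l))"
  proof (cases "c l = 0")
    case False
    have "(a - \<epsilon>) * d \<le> (a - \<epsilon>) * \<bar>x - real_of_int l\<bar>"
      using far[OF False] \<epsilon>(2) by (intro mult_left_mono) auto
    then have "exp (- a * \<bar>x - real_of_int l\<bar>) \<le> exp (- (a - \<epsilon>) * d + - \<epsilon> * \<bar>x - real_of_int l\<bar>)"
      by (simp add: algebra_simps)
    then have "dsech_bound M * exp (- a * \<bar>x - real_of_int l\<bar>)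
        \<le> ?D * exp (- \<epsilon> * \<bar>x - real_of_int l\<bar>)"
      unfolding exp_add mult.assoc using dsech_bound_pos[of M] by (intro mult_left_mono) auto
    then have "norm (dsech j (x - real_of_int l)) \<le> ?D * exp (- \<epsilon> * \<bar>x - real_of_int l\<bar>)"
      using norm_dsech_le[OF j, of "x - real_of_int l"] by linarith
    then have "norm (c l) * norm (dsech j (x - real_of_int l))
        \<le> norm (c l) * (?D * exp (- \<epsilon> * \<bar>x - real_of_int l\<bar>))"
      by (rule mult_left_mono) simp
    then show ?thesis by (simp only: norm_mult mult_ac)
  qed simp
qed

lemma norm_hderiv_le:
  assumes "bounded (range c)" "generated_by (sech_a a) c f" "j \<le> M"
  shows "norm (hderiv j f x) \<le> dsech_bound M * coeff_conv c x"
  using norm_hderiv_le_exp_conv[OF a_pos order_refl assms, of 0 x] by simp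

lemma norm_hderiv_le_sup:
  assumes c: "\<And>l. norm (c l) \<le> B" and f: "generated_by (sech_a a) c f" and j: "j \<le> M"
  shows "norm (hderiv j f x) \<le> dsech_bound M * exp_sum_bound a 1 * B"
proof -
  have "bounded (range c)" using c by (auto simp: bounded_iff)
  then have "norm (hderiv j f x) \<le> dsech_bound M * coeff_conv c x"
    by (rule norm_hderiv_le[OF _ f j])
  also have "\<dots> \<le> dsech_bound M * (exp_sum_bound a 1 * B)"
    using dsech_bound_pos[of M] order_trans[OF norm_ge_zero c]
    by (intro mult_left_mono exp_conv_le a_pos separated_family_of_int c) auto
  finally show ?thesis by simp
qed

end

section \<open>Growth of the generating function\<close>

lemma one_plus_exp_le: "1 + exp y \<le> exp (max 0 y + exp (- \<bar>y\<bar>))" for y :: real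
proof (cases "y \<ge> 0")
  case True
  have "1 + exp y = exp y * (1 + exp (- y))" by (simp add: distrib_left flip: exp_add)
  also have "\<dots> \<le> exp y * exp (exp (- y))" by (intro mult_left_mono exp_ge_add_one_self) auto
  finally show ?thesis using True by (simp add: exp_add)
next
  case False
  then show ?thesis using exp_ge_add_one_self[of "exp y"] by (simp add: max_def)
qed

lemma exp_minus_quotient_le:
  fixes t :: real
  assumes "0 \<le> t" "t \<le> q" "q < 1"
  shows "exp (- (t / (1 - q))) \<le> 1 - t"
proof -
  have "1 / (1 - t) = 1 + t / (1 - t)" using assms by (simp add: field_simps)
  also have "\<dots> \<le> exp (t / (1 - t))" by (rule exp_ge_add_one_self)
  also have "\<dots> \<le> exp (t / (1 - q))" using assms by (auto intro!: divide_left_mono)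
  finally show ?thesis using assms by (simp add: exp_minus field_simps)
qed

lemma abs_one_minus_exp_ge:
  fixes y y0 :: real
  assumes "y0 > 0" "y0 \<le> \<bar>y\<bar>"
  shows "exp (max 0 y - exp (- \<bar>y\<bar>) / (1 - exp (- y0))) \<le> \<bar>1 - exp y\<bar>"
proof -
  have quotient: "exp (- (exp (- \<bar>y\<bar>) / (1 - exp (- y0)))) \<le> 1 - exp (- \<bar>y\<bar>)"
    using assms by (intro exp_minus_quotient_le) auto
  show ?thesis
  proof (cases "y \<ge> 0")
    case True
    have "exp y * exp (- (exp (- \<bar>y\<bar>) / (1 - exp (- y0)))) \<le> exp y * (1 - exp (- \<bar>y\<bar>))"
      using quotient by (intro mult_left_mono) auto
    also have "\<dots> = \<bar>1 - exp y\<bar>" using True by (simp add: right_diff_distrib flip: exp_add)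
    finally show ?thesis using True by (simp add: max_def exp_diff exp_minus divide_inverse)
  next
    case False then show ?thesis using quotient by (simp add: max_def)
  qed
qed

lemma norm_one_minus_exp_ge:
  fixes v :: complex
  assumes "norm v \<le> 1 / 4"
  shows "norm v / 2 \<le> norm (1 - exp v)"
proof -
  have "norm (exp v - (1 + v)) \<le> exp (norm v) * (norm v)\<^sup>2"
    using Taylor_exp_field[of v 1] by (simp add: power2_eq_square)
  also have "\<dots> \<le> 2 * (norm v)\<^sup>2"
    using exp_bound_half[of "norm v"] assms by (intro mult_right_mono) auto
  also have "\<dots> \<le> norm v / 2"
    using mult_right_mono[OF assms norm_ge_zero[of v]] by (simp add: power2_eq_square)
  finally have "norm (exp v - (1 + v)) \<le> norm v / 2" .
  moreover have "norm v \<le> norm (exp v - 1) + norm (exp v - (1 + v))"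
    using norm_triangle_ineq4[of "exp v - 1" "exp v - (1 + v)"] by simp
  ultimately show ?thesis by (simp add: norm_minus_commute)
qed

definition side :: "real \<Rightarrow> real" where
  "side x = (if x \<ge> 0 then 1 else - 1)"

lemma abs_side [simp]: "\<bar>side x\<bar> = 1"
  by (simp add: side_def)

definition growth :: "(real \<Rightarrow> nat) \<Rightarrow> real set \<Rightarrow> real \<Rightarrow> real" where
  "growth m P x = (\<Sum>l\<in>P. real (m l) * max 0 (side l * (x - l)))"

lemma growth_0: "growth m P 0 = 0"
  unfolding growth_def by (intro sum.neutral) (auto simp: side_def)

definition nonzero_ints :: "nat \<Rightarrow> real set" where
  "nonzero_ints N = {x \<in> \<int>. 0 < \<bar>x\<bar> \<and> \<bar>x\<bar> \<le> real N}"

lemma nonzero_ints_eq: "nonzero_ints N = real ` {1..N} \<union> (\<lambda>k. - real k) ` {1..N}"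
proof
  show "nonzero_ints N \<subseteq> real ` {1..N} \<union> (\<lambda>k. - real k) ` {1..N}"
  proof
    fix x assume "x \<in> nonzero_ints N"
    then obtain k :: int where k: "x = of_int k" "0 < \<bar>k\<bar>" "\<bar>k\<bar> \<le> int N"
      by (auto simp: nonzero_ints_def elim!: Ints_cases)
    then show "x \<in> real ` {1..N} \<union> (\<lambda>k. - real k) ` {1..N}"
      by (cases "k > 0") (auto intro!: image_eqI[of _ _ "nat \<bar>k\<bar>"])
  qed
qed (auto simp: nonzero_ints_def)

lemma finite_nonzero_ints: "finite (nonzero_ints N)"
  by (simp add: nonzero_ints_eq)

lemma separated_nonzero_ints:
  assumes "\<delta> \<le> 1"
  shows "separated_by \<delta> (nonzero_ints N)"
  using separated_family_of_int[OF assms, of UNIV]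
  unfolding separated_family_def nonzero_ints_def by (auto elim!: Ints_cases)

lemma growth_nonzero_ints:
  "growth (\<lambda>_. 1) (nonzero_ints N) x = (\<Sum>k<N. max 0 (\<bar>x\<bar> - real (Suc k)))"
proof -
  have "growth (\<lambda>_. 1) (nonzero_ints N) x
      = (\<Sum>k=1..N. max 0 (side (real k) * (x - real k)))
          + (\<Sum>k=1..N. max 0 (side (- real k) * (x + real k)))"
    unfolding growth_def nonzero_ints_eq
    by (subst sum.union_disjoint) (auto simp: sum.reindex inj_on_def)
  also have "\<dots> = (\<Sum>k=1..N. max 0 (\<bar>x\<bar> - real k))"
    unfolding sum.distrib[symmetric] by (intro sum.cong) (auto simp: side_def)
  also have "\<dots> = (\<Sum>k<N. max 0 (\<bar>x\<bar> - real (Suc k)))"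
    by (rule sum.reindex_bij_witness[of _ Suc "\<lambda>k. k - 1"]) auto
  finally show ?thesis .
qed

lemma growth_nonzero_ints_le:
  "growth (\<lambda>_. 1) (nonzero_ints (J * L)) x \<le> (\<Sum>j<J. real L * max 0 (\<bar>x\<bar> - real j * real L))"
proof -
  have "growth (\<lambda>_. 1) (nonzero_ints (J * L)) x
      = (\<Sum>j<J. \<Sum>k\<in>{j * L..<j * L + L}. max 0 (\<bar>x\<bar> - real (Suc k)))"
    unfolding growth_nonzero_ints by (rule sum.nat_group[symmetric])
  also have "\<dots> \<le> (\<Sum>j<J. \<Sum>k\<in>{j * L..<j * L + L}. max 0 (\<bar>x\<bar> - real j * real L))"
  proof (intro sum_mono max.mono diff_left_mono order_refl)
    fix j k assume "k \<in> {j * L..<j * L + L}"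
    then have "real (j * L) \<le> real (Suc k)" by (intro of_nat_mono) simp
    then show "real j * real L \<le> real (Suc k)" by simp
  qed
  finally show ?thesis by simp
qed

definition block :: "nat \<Rightarrow> real \<Rightarrow> nat \<Rightarrow> real set" where
  "block L \<sigma> j = {l. real j * real L < \<sigma> * l \<and> \<sigma> * l \<le> real (Suc j) * real L}"

lemma block_disjoint:
  assumes "i \<noteq> j"
  shows "block L \<sigma> i \<inter> block L \<sigma> j = {}"
proof -
  have "block L \<sigma> i \<inter> block L \<sigma> j = {}" if "i < j" for i j
  proof -
    have "real (Suc i) * real L \<le> real j * real L" using that by (intro mult_right_mono) auto
    then show ?thesis by (force simp: block_def)
  qed
  then show ?thesis using assms by (metis Int_commute linorder_neqE_nat)
qed

definition dense_blocks :: "nat \<Rightarrow> nat \<Rightarrow> real set \<Rightarrow> (real \<Rightarrow> nat) \<Rightarrow> bool" where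
  "dense_blocks L J P m \<longleftrightarrow>
     (\<forall>\<sigma>\<in>{-1, 1}. \<forall>j<J. real L + 1 \<le> (\<Sum>l\<in>P \<inter> block L \<sigma> j. real (m l)))"

lemma growth_ge_of_dense_blocks:
  assumes P: "finite P" and dense: "dense_blocks L J P m"
  shows "(\<Sum>j<J. (real L + 1) * max 0 (\<bar>x\<bar> - real (Suc j) * real L)) \<le> growth m P x"
proof -
  define \<sigma> where "\<sigma> = side x"
  have \<sigma>: "\<sigma> \<in> {-1, 1}" "\<bar>x\<bar> = \<sigma> * x" by (auto simp: \<sigma>_def side_def)
  define g where "g l = real (m l) * max 0 (side l * (x - l))" for l
  have block_le: "(real L + 1) * max 0 (\<bar>x\<bar> - real (Suc j) * real L) \<le> (\<Sum>l\<in>P \<inter> block L \<sigma> j. g l)"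
    if "j < J" for j
  proof -
    have "(real L + 1) * max 0 (\<bar>x\<bar> - real (Suc j) * real L)
        \<le> (\<Sum>l\<in>P \<inter> block L \<sigma> j. real (m l)) * max 0 (\<bar>x\<bar> - real (Suc j) * real L)"
      using dense \<sigma>(1) that unfolding dense_blocks_def by (intro mult_right_mono) auto
    also have "\<dots> \<le> (\<Sum>l\<in>P \<inter> block L \<sigma> j. g l)"
      unfolding sum_distrib_right
    proof (rule sum_mono)
      fix l assume "l \<in> P \<inter> block L \<sigma> j"
      then have l: "real j * real L < \<sigma> * l" "\<sigma> * l \<le> real (Suc j) * real L"
        by (auto simp: block_def)
      have "0 \<le> real j * real L" by simp
      then have "0 < \<sigma> * l" using l(1) by linarith
      then have "side l = \<sigma>" using \<sigma>(1) by (auto simp: side_def)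
      then show "real (m l) * max 0 (\<bar>x\<bar> - real (Suc j) * real L) \<le> g l"
        unfolding g_def \<sigma>(2) using l(2)
        by (intro mult_left_mono max.mono) (auto simp: right_diff_distrib)
    qed
    finally show ?thesis .
  qed
  have "(\<Sum>j<J. (real L + 1) * max 0 (\<bar>x\<bar> - real (Suc j) * real L))
      \<le> (\<Sum>j<J. \<Sum>l\<in>P \<inter> block L \<sigma> j. g l)"
    by (intro sum_mono block_le) simp
  also have "\<dots> = (\<Sum>l\<in>(\<Union>j<J. P \<inter> block L \<sigma> j). g l)"
    using P block_disjoint[of _ _ L \<sigma>] by (intro sum.UNION_disjoint[symmetric]) auto
  also have "\<dots> \<le> growth m P x"
    unfolding growth_def g_def using P by (intro sum_mono2) auto
  finally show ?thesis .
qed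

text \<open>
  A block of length \<open>L\<close> carries \<open>L\<close> integers but weight at least \<open>L + 1\<close>. The terms with factor
  \<open>L\<close> telescope, and each block left behind by \<open>\<bar>x\<bar>\<close> contributes its surplus weight.
\<close>

lemma growth_difference_le:
  assumes P: "finite P" and dense: "dense_blocks L J P m" and "n \<le> J"
  shows "growth (\<lambda>_. 1) (nonzero_ints (J * L)) x - growth m P x
      \<le> real n * real n * real L - (real n - real L) * \<bar>x\<bar>"
proof -
  define f where "f j = max 0 (\<bar>x\<bar> - real j * real L)" for j
  have "growth (\<lambda>_. 1) (nonzero_ints (J * L)) x - growth m P x
      \<le> (\<Sum>j<J. real L * f j) - (\<Sum>j<J. (real L + 1) * f (Suc j))"
    unfolding f_def by (intro diff_mono growth_nonzero_ints_le growth_ge_of_dense_blocks P dense)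
  also have "\<dots> = real L * (f 0 - f J) - (\<Sum>j<J. f (Suc j))"
    unfolding sum_lessThan_telescope'[symmetric] sum_subtractf[symmetric] sum_distrib_left
    by (intro sum.cong) (simp_all add: algebra_simps)
  also have "\<dots> \<le> real L * \<bar>x\<bar> - (\<Sum>j<n. f (Suc j))"
  proof (intro diff_mono mult_left_mono)
    show "f 0 - f J \<le> \<bar>x\<bar>" by (simp add: f_def)
    show "(\<Sum>j<n. f (Suc j)) \<le> (\<Sum>j<J. f (Suc j))"
      using \<open>n \<le> J\<close> by (intro sum_mono2) (auto simp: f_def)
  qed simp
  also have "\<dots> \<le> real L * \<bar>x\<bar> - (\<Sum>j<n. \<bar>x\<bar> - real n * real L)"
  proof (intro diff_left_mono sum_mono)
    fix j assume "j \<in> {..<n}"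
    then have "real (Suc j) * real L \<le> real n * real L" by (intro mult_right_mono) auto
    then show "\<bar>x\<bar> - real n * real L \<le> f (Suc j)" unfolding f_def by linarith
  qed
  also have "\<dots> = real n * real n * real L - (real n - real L) * \<bar>x\<bar>"
    by (simp add: algebra_simps)
  finally show ?thesis .
qed

context sech_generator
begin

text \<open>
  The factors of the generating function, normalised to be close to 1 on the side away from growth:
  \<open>factor s\<close> has simple zeros at the multiples of \<open>\<i> \<pi> / a\<close>.
\<close>

definition factor :: "real \<Rightarrow> complex \<Rightarrow> complex" where
  "factor s w = 1 - exp (of_real (2 * a * s) * w)"

lemma norm_factor_le:
  assumes "\<bar>s\<bar> = 1"
  shows "norm (factor s w) \<le> exp (2 * a * max 0 (s * Re w) + exp (- (2 * a) * \<bar>Re w\<bar>))"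
proof -
  have "norm (factor s w) \<le> 1 + exp (2 * a * s * Re w)"
    unfolding factor_def using norm_triangle_ineq4[of 1 "exp (of_real (2 * a * s) * w)"] by simp
  also have "\<dots> \<le> exp (max 0 (2 * a * s * Re w) + exp (- \<bar>2 * a * s * Re w\<bar>))"
    by (rule one_plus_exp_le)
  also have "max 0 (2 * a * s * Re w) = 2 * a * max 0 (s * Re w)"
    using a_pos by (simp add: max_mult_distrib_left mult.assoc)
  also have "\<bar>2 * a * s * Re w\<bar> = 2 * a * \<bar>Re w\<bar>" using assms a_pos by (simp add: abs_mult)
  finally show ?thesis by simp
qed

lemma norm_factor_ge_far:
  assumes "\<bar>s\<bar> = 1" "\<delta> > 0" "\<delta> \<le> \<bar>Re w\<bar>"
  shows "exp (2 * a * max 0 (s * Re w) - 1 / (1 - exp (- (2 * a * \<delta>))) * exp (- (2 * a) * \<bar>Re w\<bar>))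
      \<le> norm (factor s w)"
proof -
  have "max 0 (2 * a * s * Re w) = 2 * a * max 0 (s * Re w)"
    using a_pos by (simp add: max_mult_distrib_left mult.assoc)
  moreover have abs_eq: "\<bar>2 * a * s * Re w\<bar> = 2 * a * \<bar>Re w\<bar>"
    using a_pos assms(1) by (simp add: abs_mult)
  moreover have "2 * a * \<delta> \<le> \<bar>2 * a * s * Re w\<bar>" using a_pos assms(3) abs_eq by simp
  ultimately have "exp (2 * a * max 0 (s * Re w)
      - 1 / (1 - exp (- (2 * a * \<delta>))) * exp (- (2 * a) * \<bar>Re w\<bar>))
      \<le> \<bar>1 - exp (2 * a * s * Re w)\<bar>"
    using abs_one_minus_exp_ge[of "2 * a * \<delta>" "2 * a * s * Re w"] a_pos assms(2) by simp
  also have "\<dots> \<le> norm (factor s w)"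
    unfolding factor_def using norm_triangle_ineq3[of 1 "exp (of_real (2 * a * s) * w)"] by simp
  finally show ?thesis .
qed

lemma norm_factor_ge_circle:
  assumes s: "\<bar>s\<bar> = 1" and \<rho>: "0 < \<rho>" "8 * a * \<rho> \<le> 1" and w: "norm w = \<rho>"
  shows "exp (2 * a * max 0 (s * Re w)
      - exp (2 * a * \<rho>) * (2 * a * \<rho> - ln (a * \<rho>)) * exp (- (2 * a) * \<bar>Re w\<bar>))
    \<le> norm (factor s w)"
proof -
  have re: "\<bar>Re w\<bar> \<le> \<rho>" using w abs_Re_le_cmod by metis
  have "\<bar>s * Re w\<bar> \<le> \<rho>" using re s by (simp add: abs_mult)
  then have "max 0 (s * Re w) \<le> \<rho>" using \<rho> by linarith
  then have max_le: "2 * a * max 0 (s * Re w) \<le> 2 * a * \<rho>"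
    using a_pos
    by (intro mult_left_mono) auto
  have "a * \<rho> \<le> 1" using \<rho> a_pos by simp
  then have log_le: "ln (a * \<rho>) \<le> 0" using \<rho> a_pos by simp
  have "2 * a * \<rho> - ln (a * \<rho>) = exp (2 * a * \<rho>) * (2 * a * \<rho> - ln (a * \<rho>)) * exp (- (2 * a) * \<rho>)"
    by (simp add: exp_minus)
  also have "\<dots> \<le> exp (2 * a * \<rho>) * (2 * a * \<rho> - ln (a * \<rho>)) * exp (- (2 * a) * \<bar>Re w\<bar>)"
  proof (intro mult_left_mono mult_nonneg_nonneg)
    have "0 < 2 * a * \<rho>" using a_pos \<rho> by simp
    then show "0 \<le> 2 * a * \<rho> - ln (a * \<rho>)" using log_le by linarith
  qed (use a_pos re in auto)
  finally have "2 * a * \<rho> - ln (a * \<rho>)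
      \<le> exp (2 * a * \<rho>) * (2 * a * \<rho> - ln (a * \<rho>)) * exp (- (2 * a) * \<bar>Re w\<bar>)" .
  then have "exp (2 * a * max 0 (s * Re w)
      - exp (2 * a * \<rho>) * (2 * a * \<rho> - ln (a * \<rho>)) * exp (- (2 * a) * \<bar>Re w\<bar>))
      \<le> exp (ln (a * \<rho>))"
    using max_le by simp
  also have "\<dots> = norm (of_real (2 * a * s) * w) / 2"
    using a_pos \<rho> s w by (simp add: norm_mult)
  also have "\<dots> \<le> norm (factor s w)"
    unfolding factor_def using a_pos s \<rho> w by (intro norm_one_minus_exp_ge) (simp add: norm_mult)
  finally show ?thesis .
qed

lemma norm_factor_ge_pole_line:
  assumes s: "\<bar>s\<bar> = 1" and w: "Im w = pole_height"
  shows "exp (2 * a * max 0 (s * Re w)) \<le> norm (factor s w)"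
proof -
  have "s = 1 \<or> s = -1" using s by linarith
  then have "exp (of_real (2 * a * s) * w) = - of_real (exp (2 * a * s * Re w))"
    using w a_pos by (auto simp: complex_eq_iff Re_exp Im_exp)
  then have "factor s w = of_real (1 + exp (2 * a * s * Re w))" by (simp add: factor_def)
  then have "norm (factor s w) = 1 + exp (2 * a * s * Re w)"
    by (simp add: norm_of_real del: of_real_add)
  moreover have "exp (2 * a * max 0 (s * Re w)) \<le> 1 + exp (2 * a * s * Re w)"
    by (auto simp: max_def mult.assoc)
  ultimately show ?thesis by simp
qed

definition regular_point :: "real \<Rightarrow> real \<Rightarrow> complex \<Rightarrow> bool" where
  "regular_point \<delta> \<rho> w \<longleftrightarrow> \<delta> \<le> \<bar>Re w\<bar> \<or> norm w = \<rho> \<or> Im w = pole_height"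

definition factor_defect :: "real \<Rightarrow> real \<Rightarrow> real" where
  "factor_defect \<delta> \<rho>
      = max (1 / (1 - exp (- (2 * a * \<delta>)))) (exp (2 * a * \<rho>) * (2 * a * \<rho> - ln (a * \<rho>)))"

lemma factor_defect_nonneg: "\<delta> > 0 \<Longrightarrow> factor_defect \<delta> \<rho> \<ge> 0"
  unfolding factor_defect_def using a_pos by (simp add: le_max_iff_disj)

lemma norm_factor_ge:
  assumes s: "\<bar>s\<bar> = 1" and \<delta>: "\<delta> > 0" and \<rho>: "0 < \<rho>" "8 * a * \<rho> \<le> 1" and w: "regular_point \<delta> \<rho> w"
  shows "exp (2 * a * max 0 (s * Re w) - factor_defect \<delta> \<rho> * exp (- (2 * a) * \<bar>Re w\<bar>))
      \<le> norm (factor s w)"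
proof -
  have weaken: "exp (2 * a * max 0 (s * Re w) - factor_defect \<delta> \<rho> * exp (- (2 * a) * \<bar>Re w\<bar>))
      \<le> norm (factor s w)"
    if "exp (2 * a * max 0 (s * Re w) - \<kappa> * exp (- (2 * a) * \<bar>Re w\<bar>)) \<le> norm (factor s w)"
        "\<kappa> \<le> factor_defect \<delta> \<rho>" for \<kappa>
    using that(1) by (rule order_trans[rotated]) (use that(2) in \<open>simp add: mult_right_mono\<close>)
  from w consider (far) "\<delta> \<le> \<bar>Re w\<bar>" | (circle) "norm w = \<rho>" | (pole_line) "Im w = pole_height"
    unfolding regular_point_def by blast
  then show ?thesis
  proof cases
    case far
    show ?thesis by (rule weaken[OF norm_factor_ge_far[OF s \<delta> far]]) (simp add: factor_defect_def)
  next
    case circle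
    show ?thesis
      by (rule weaken[OF norm_factor_ge_circle[OF s \<rho> circle]]) (simp add: factor_defect_def)
  next
    case pole_line
    show ?thesis
      by (rule weaken[of 0])
        (use norm_factor_ge_pole_line[OF s pole_line] factor_defect_nonneg[OF \<delta>] in auto)
  qed
qed

definition factor_prod :: "real \<Rightarrow> (real \<Rightarrow> nat) \<Rightarrow> real set \<Rightarrow> complex \<Rightarrow> complex" where
  "factor_prod h m P z = (\<Prod>l\<in>P. factor (side l) (z - Complex l h) ^ m l)"

lemma norm_factor_prod:
  "norm (factor_prod h m P z) = (\<Prod>l\<in>P. norm (factor (side l) (z - Complex l h)) ^ m l)"
  by (simp add: factor_prod_def prod_norm[symmetric] norm_power)

lemma weighted_exp_sum_le:
  assumes "finite P" "separated_by \<delta> P" "\<And>l. l \<in> P \<Longrightarrow> m l \<le> M" "\<delta> > 0"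
  shows "(\<Sum>l\<in>P. real (m l) * exp (- (2 * a) * \<bar>x - l\<bar>)) \<le> real M * exp_sum_bound (2 * a) \<delta>"
proof -
  have "(\<Sum>l\<in>P. real (m l) * exp (- (2 * a) * \<bar>x - l\<bar>)) \<le> (\<Sum>l\<in>P. real M * exp (- (2 * a) * \<bar>x - l\<bar>))"
    using assms(3) by (intro sum_mono mult_right_mono) auto
  also have "\<dots> \<le> real M * exp_sum_bound (2 * a) \<delta>"
    unfolding sum_distrib_left[symmetric] using assms a_pos
    by (intro mult_left_mono sum_exp_separated_le) auto
  finally show ?thesis .
qed

lemma norm_factor_prod_le:
  assumes P: "finite P" "separated_by \<delta> P" "\<And>l. l \<in> P \<Longrightarrow> m l \<le> M" and \<delta>: "\<delta> > 0"
  shows "norm (factor_prod h m P z)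
      \<le> exp (2 * a * growth m P (Re z) + real M * exp_sum_bound (2 * a) \<delta>)"
proof -
  have "norm (factor_prod h m P z)
      \<le> (\<Prod>l\<in>P. exp (2 * a * max 0 (side l * (Re z - l)) + exp (- (2 * a) * \<bar>Re z - l\<bar>)) ^ m l)"
    unfolding norm_factor_prod
  proof (intro prod_mono conjI power_mono)
    fix l
    show "norm (factor (side l) (z - Complex l h))
        \<le> exp (2 * a * max 0 (side l * (Re z - l)) + exp (- (2 * a) * \<bar>Re z - l\<bar>))"
      using norm_factor_le[OF abs_side, of l "z - Complex l h"] by simp
  qed auto
  also have "\<dots>
      = exp (2 * a * growth m P (Re z) + (\<Sum>l\<in>P. real (m l) * exp (- (2 * a) * \<bar>Re z - l\<bar>)))"
    unfolding growth_def sum_distrib_left sum.distrib[symmetric] exp_of_nat_mult[symmetric]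
    by (simp add: exp_sum[OF P(1)] algebra_simps)
  also have "\<dots> \<le> exp (2 * a * growth m P (Re z) + real M * exp_sum_bound (2 * a) \<delta>)"
    using weighted_exp_sum_le[OF P \<delta>] by simp
  finally show ?thesis .
qed

lemma norm_factor_prod_ge:
  assumes P: "finite P" "separated_by \<delta> P" "\<And>l. l \<in> P \<Longrightarrow> m l \<le> M" and \<delta>: "\<delta> > 0"
    and \<delta>': "\<delta>' > 0" and \<rho>: "0 < \<rho>" "8 * a * \<rho> \<le> 1"
    and z: "\<And>l. l \<in> P \<Longrightarrow> regular_point \<delta>' \<rho> (z - Complex l h)"
  shows "exp (2 * a * growth m P (Re z) - factor_defect \<delta>' \<rho> * (real M * exp_sum_bound (2 * a) \<delta>))
    \<le> norm (factor_prod h m P z)"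
proof -
  have "exp (2 * a * growth m P (Re z) - factor_defect \<delta>' \<rho> * (real M * exp_sum_bound (2 * a) \<delta>))
      \<le> exp (2 * a * growth m P (Re z) - factor_defect \<delta>' \<rho>
          * (\<Sum>l\<in>P. real (m l) * exp (- (2 * a) * \<bar>Re z - l\<bar>)))"
    using mult_left_mono[OF weighted_exp_sum_le[OF P \<delta>] factor_defect_nonneg[OF \<delta>']] by simp
  also have "\<dots>
      = (\<Prod>l\<in>P. exp (2 * a * max 0 (side l * (Re z - l))
          - factor_defect \<delta>' \<rho> * exp (- (2 * a) * \<bar>Re z - l\<bar>)) ^ m l)"
    unfolding growth_def sum_distrib_left sum_subtractf[symmetric] exp_of_nat_mult[symmetric]
    by (simp add: exp_sum[OF P(1)] algebra_simps)
  also have "\<dots> \<le> norm (factor_prod h m P z)"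
    unfolding norm_factor_prod
  proof (intro prod_mono conjI power_mono)
    fix l assume "l \<in> P"
    then show "exp (2 * a * max 0 (side l * (Re z - l))
        - factor_defect \<delta>' \<rho> * exp (- (2 * a) * \<bar>Re z - l\<bar>))
        \<le> norm (factor (side l) (z - Complex l h))"
      using norm_factor_ge[OF abs_side \<delta>' \<rho> z, of l l] by simp
  qed auto
  finally show ?thesis .
qed

text \<open>
  The generating function has a pole of order \<open>m l\<close> at each node \<open>l \<in> P\<close>, and its zeros
  \<open>l + \<i> \<pi> / (2 a)\<close>, \<open>l \<noteq> 0\<close>, cancel the poles of the shifts of \<open>sech\<close>. The exponential makes it
  change sign under translation by \<open>\<i> \<pi> / a\<close>, as \<open>sech\<close> does.
\<close>

definition gen_fun :: "(real \<Rightarrow> nat) \<Rightarrow> real set \<Rightarrow> nat \<Rightarrow> complex \<Rightarrow> complex" where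
  "gen_fun m P N z =
     exp (of_real a * z) * factor_prod pole_height (\<lambda>_. 1) (nonzero_ints N) z / factor_prod 0 m P z"

end

locale sech_sampling = sech_generator +
  fixes \<delta> :: real and M L :: nat
  assumes \<delta>_pos: "\<delta> > 0" and \<delta>_le_1: "\<delta> \<le> 1" and L_pos: "L \<ge> 1"
begin

definition node_radius :: real where
  "node_radius = min (\<delta> / 2) (1 / (8 * a))"

lemma node_radius_bounds: "0 < node_radius" "node_radius \<le> \<delta> / 2" "8 * a * node_radius \<le> 1"
proof -
  have "8 * a * node_radius \<le> 8 * a * (1 / (8 * a))"
    unfolding node_radius_def using a_pos by (intro mult_left_mono) auto
  then show "8 * a * node_radius \<le> 1" using a_pos by simp
qed (use a_pos \<delta>_pos in \<open>auto simp: node_radius_def\<close>)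

abbreviation regular :: "complex \<Rightarrow> bool" where
  "regular \<equiv> regular_point (\<delta> / 2) node_radius"

abbreviation defect :: real where
  "defect \<equiv> factor_defect (\<delta> / 2) node_radius"

abbreviation exp_error :: real where
  "exp_error \<equiv> exp_sum_bound (2 * a) \<delta>"

definition block_threshold :: nat where
  "block_threshold = L + nat \<lceil>(a + 1) / (2 * a)\<rceil>"

lemma block_threshold_ge: "a + 1 \<le> 2 * a * (real block_threshold - real L)"
proof -
  have "(a + 1) / (2 * a) \<le> real block_threshold - real L" unfolding block_threshold_def by linarith
  then show ?thesis using a_pos by (simp add: field_simps)
qed

definition gen_fun_upper :: real where
  "gen_fun_upper =
     exp (exp_error + defect * (real M * exp_error)
       + 2 * a * (real block_threshold * real block_threshold * real L))"

definition gen_fun_lower :: real where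
  "gen_fun_lower = exp (- (defect * exp_error) - real M * exp_error)"

lemma gen_fun_upper_pos: "gen_fun_upper > 0"
  by (simp add: gen_fun_upper_def)

lemma gen_fun_lower_pos: "gen_fun_lower > 0"
  by (simp add: gen_fun_lower_def)

lemma growth_exponent_le:
  assumes P: "finite P" and dense: "dense_blocks L J P m" "block_threshold \<le> J"
  shows "a * x + 2 * a * (growth (\<lambda>_. 1) (nonzero_ints (J * L)) x - growth m P x)
    \<le> 2 * a * (real block_threshold * real block_threshold * real L) - \<bar>x\<bar>"
proof -
  have "2 * a * (growth (\<lambda>_. 1) (nonzero_ints (J * L)) x - growth m P x)
      \<le> 2 * a * (real block_threshold * real block_threshold * real L
          - (real block_threshold - real L) * \<bar>x\<bar>)"
    using a_pos by (intro mult_left_mono growth_difference_le P dense) auto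
  moreover have "(a + 1) * \<bar>x\<bar> \<le> 2 * a * (real block_threshold - real L) * \<bar>x\<bar>"
    using block_threshold_ge by (rule mult_right_mono) simp
  moreover have "a * x \<le> a * \<bar>x\<bar>" using a_pos by simp
  ultimately show ?thesis by (simp add: algebra_simps)
qed

lemma norm_gen_fun_le:
  assumes P: "finite P" "separated_by \<delta> P" "\<And>l. l \<in> P \<Longrightarrow> m l \<le> M"
    and dense: "dense_blocks L J P m" "block_threshold \<le> J"
    and z: "\<And>l. l \<in> P \<Longrightarrow> regular (z - of_real l)"
  shows "norm (gen_fun m P (J * L) z) \<le> gen_fun_upper * exp (- \<bar>Re z\<bar>)"
proof -
  define x where "x = Re z"
  define numerator where "numerator = growth (\<lambda>_. 1) (nonzero_ints (J * L)) x"
  define denominator where "denominator = growth m P x"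
  have upper: "norm (factor_prod pole_height (\<lambda>_. 1) (nonzero_ints (J * L)) z)
      \<le> exp (2 * a * numerator + exp_error)"
    using norm_factor_prod_le[OF finite_nonzero_ints separated_nonzero_ints[OF \<delta>_le_1] _ \<delta>_pos,
        where m = "\<lambda>_. 1" and M = 1]
    unfolding numerator_def x_def by simp
  have lower: "exp (2 * a * denominator - defect * (real M * exp_error))
      \<le> norm (factor_prod 0 m P z)"
    unfolding denominator_def x_def
    using z node_radius_bounds \<delta>_pos
    by (intro norm_factor_prod_ge P) (auto simp: complex_of_real_def)
  have "norm (gen_fun m P (J * L) z)
      = exp (a * x) * norm (factor_prod pole_height (\<lambda>_. 1) (nonzero_ints (J * L)) z)
          / norm (factor_prod 0 m P z)"
    by (simp add: gen_fun_def norm_mult norm_divide x_def)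
  also have "\<dots> \<le> exp (a * x) * exp (2 * a * numerator + exp_error)
      / exp (2 * a * denominator - defect * (real M * exp_error))"
    using upper lower by (intro frac_le mult_left_mono) auto
  also have "\<dots>
      = exp (a * x + 2 * a * (numerator - denominator) + exp_error + defect * (real M * exp_error))"
    by (simp add: exp_add[symmetric] exp_diff[symmetric] algebra_simps)
  also have "\<dots> \<le> exp (exp_error + defect * (real M * exp_error)
      + 2 * a * (real block_threshold * real block_threshold * real L) + - \<bar>x\<bar>)"
    using growth_exponent_le[OF P(1) dense, of x] unfolding numerator_def denominator_def by simp
  also have "\<dots> = gen_fun_upper * exp (- \<bar>Re z\<bar>)" unfolding gen_fun_upper_def x_def exp_add ..
  finally show ?thesis .
qed

lemma norm_gen_fun_pole_0_ge:
  assumes P: "finite P" "separated_by \<delta> P" "\<And>l. l \<in> P \<Longrightarrow> m l \<le> M"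
  shows "gen_fun_lower \<le> norm (gen_fun m P N (Complex 0 pole_height))"
proof -
  let ?numerator = "norm (factor_prod pole_height (\<lambda>_. 1) (nonzero_ints N) (Complex 0 pole_height))"
  let ?denominator = "norm (factor_prod 0 m P (Complex 0 pole_height))"
  have "regular (Complex 0 pole_height - Complex l pole_height)" if "l \<in> nonzero_ints N" for l
  proof -
    have "1 \<le> \<bar>l\<bar>" using that by (auto simp: nonzero_ints_eq)
    then show ?thesis using \<delta>_le_1 by (simp add: regular_point_def)
  qed
  then have numerator: "exp (- (defect * exp_error)) \<le> ?numerator"
    using norm_factor_prod_ge[OF finite_nonzero_ints separated_nonzero_ints[OF \<delta>_le_1] _ \<delta>_pos
        _ node_radius_bounds(1,3), where m = "\<lambda>_. 1" and M = 1 and z = "Complex 0 pole_height"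
          and h = pole_height] \<delta>_pos
    by (simp add: growth_0)
  have "0 < exp (2 * a * growth m P 0 - defect * (real M * exp_error))" by simp
  also have "\<dots> \<le> ?denominator"
    using norm_factor_prod_ge[OF P \<delta>_pos _ node_radius_bounds(1,3),
        where \<delta>' = "\<delta> / 2" and z = "Complex 0 pole_height" and h = 0] \<delta>_pos
    by (simp add: regular_point_def)
  finally have "0 < ?denominator" .
  moreover have "?denominator \<le> exp (real M * exp_error)"
    using norm_factor_prod_le[OF P \<delta>_pos, where z = "Complex 0 pole_height" and h = 0]
    by (simp add: growth_0)
  ultimately have "exp (- (defect * exp_error)) / exp (real M * exp_error)
      \<le> ?numerator / ?denominator"
    using numerator by (intro frac_le) auto
  also have "\<dots> = norm (gen_fun m P N (Complex 0 pole_height))"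
    by (simp add: gen_fun_def norm_mult norm_divide)
  finally show ?thesis unfolding gen_fun_lower_def exp_diff .
qed

end

section \<open>Residues of the generating function\<close>

lemma contour_integral_rectpath_eq_sum_residues:
  assumes S: "open S" "connected S" "cbox A B \<subseteq> S" and fin: "finite pts" and pts: "pts \<subseteq> box A B"
    and hol: "H holomorphic_on S - pts" and le: "Re A \<le> Re B" "Im A \<le> Im B"
  shows "contour_integral (rectpath A B) H = 2 * pi * \<i> * (\<Sum>p\<in>pts. residue H p)"
proof -
  have img: "path_image (rectpath A B) \<subseteq> S - pts"
    using S(3) pts by (auto simp: path_image_rectpath_cbox_minus_box[OF le])
  have "contour_integral (rectpath A B) H
      = 2 * pi * \<i> * (\<Sum>p\<in>pts. winding_number (rectpath A B) p * residue H p)"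
    using S img hol fin le
    by (intro Residue_theorem[OF S(1,2) fin]) (auto intro!: winding_number_rectpath_outside)
  also have "(\<Sum>p\<in>pts. winding_number (rectpath A B) p * residue H p) = (\<Sum>p\<in>pts. residue H p)"
    using pts by (intro sum.cong) (auto simp: winding_number_rectpath)
  finally show ?thesis .
qed

lemma contour_integral_rectpath_periodic:
  assumes cont: "continuous_on (path_image (rectpath A B)) H"
    and per: "\<And>z. H (z + Complex 0 h) = H z" and h: "Im B = Im A + h"
  shows "contour_integral (rectpath A B) H
    = contour_integral (linepath (Complex (Re B) (Im A)) B) H
        + contour_integral (linepath (Complex (Re A) (Im B)) A) H"
proof -
  define A' where "A' = Complex (Re B) (Im A)"
  define B' where "B' = Complex (Re A) (Im B)"
  have rect: "rectpath A B = linepath A A' +++ linepath A' B +++ linepath B B' +++ linepath B' A"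
    by (simp add: rectpath_def Let_def A'_def B'_def)
  have "path_image (rectpath A B)
      = closed_segment A A' \<union> closed_segment A' B \<union> closed_segment B B' \<union> closed_segment B' A"
    by (simp add: rect path_image_join Un_assoc)
  then have segments: "continuous_on (closed_segment A A') H"
      "continuous_on (closed_segment A' B) H"
      "continuous_on (closed_segment B B') H" "continuous_on (closed_segment B' A) H"
    using cont by (auto elim!: continuous_on_subset)
  note integrable = segments[THEN contour_integrable_continuous_linepath]
  have "contour_integral (rectpath A B) H = contour_integral (linepath A A') H
      + (contour_integral (linepath A' B) H
          + (contour_integral (linepath B B') H + contour_integral (linepath B' A) H))"
    unfolding rect using integrable by (simp add: contour_integrable_joinI)
  moreover have "contour_integral (linepath B B') H = - contour_integral (linepath A A') H"
  proof -
    have "linepath B' B = (+) (Complex 0 h) \<circ> linepath A A'"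
      using h by (auto simp: linepath_def A'_def B'_def complex_eq_iff fun_eq_iff algebra_simps)
    then have "contour_integral (linepath B' B) H = contour_integral (linepath A A') H"
      by (simp add: contour_integral_translate per)
    then show ?thesis using contour_integral_reverse_linepath[OF segments(3)] by simp
  qed
  ultimately show ?thesis unfolding A'_def B'_def by simp
qed

lemma norm_contour_integral_rectpath_periodic_le:
  assumes cont: "continuous_on (path_image (rectpath A B)) H"
    and per: "\<And>z. H (z + Complex 0 h) = H z"
    and AB: "Re A = - T" "Re B = T" "Im B = Im A + h" and T: "T \<ge> 0" and h: "h \<ge> 0"
    and bound: "\<And>z. \<bar>Re z\<bar> = T \<Longrightarrow> norm (H z) \<le> E"
  shows "norm (contour_integral (rectpath A B) H) \<le> 2 * h * E"
proof -
  have vertical: "norm (contour_integral (linepath u v) H) \<le> E * h"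
    if uv: "Re u = Re v" "\<bar>Re u\<bar> = T" "\<bar>Im v - Im u\<bar> = h"
      and segment: "closed_segment u v \<subseteq> path_image (rectpath A B)" for u v
  proof -
    have "norm (contour_integral (linepath u v) H) \<le> E * norm (v - u)"
    proof (rule contour_integral_bound_linepath)
      show "H contour_integrable_on linepath u v"
        by (rule contour_integrable_continuous_linepath[OF continuous_on_subset[OF cont segment]])
      show "0 \<le> E" using order_trans[OF norm_ge_zero bound[OF uv(2)]] .
      show "norm (H z) \<le> E" if "z \<in> closed_segment u v" for z
        using that uv by (intro bound) (simp add: closed_segment_same_Re)
    qed
    also have "norm (v - u) = h" using uv by (simp add: cmod_def)
    finally show ?thesis .
  qed
  have le: "Re A \<le> Re B" "Im A \<le> Im B" using AB T h by auto
  have "norm (contour_integral (linepath (Complex (Re B) (Im A)) B) H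
      + contour_integral (linepath (Complex (Re A) (Im B)) A) H) \<le> E * h + E * h"
    using AB T h
    by (intro norm_triangle_mono vertical)
      (auto simp: path_image_rectpath[OF le] closed_segment_same_Re closed_segment_eq_real_ivl)
  then show ?thesis
    unfolding contour_integral_rectpath_periodic[OF cont per AB(3)] by (simp add: algebra_simps)
qed

lemma norm_sum_residues_periodic_le:
  fixes H :: "complex \<Rightarrow> complex" and h :: real
  assumes h: "h > 0" and fin: "finite pts"
    and hol: "H holomorphic_on {z. - h / 2 < Im z \<and> Im z < h} - pts"
    and pts: "\<And>p. p \<in> pts \<Longrightarrow> \<bar>Re p\<bar> < T \<and> - h / 4 < Im p \<and> Im p < 3 * h / 4"
    and per: "\<And>z. H (z + Complex 0 h) = H z"
    and T: "T > 0" and bound: "\<And>z. \<bar>Re z\<bar> = T \<Longrightarrow> norm (H z) \<le> E"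
  shows "norm (2 * pi * \<i> * (\<Sum>p\<in>pts. residue H p)) \<le> 2 * h * E"
proof -
  define S where "S = {z. - h / 2 < Im z} \<inter> {z. Im z < h}"
  have S: "open S" "connected S"
    unfolding S_def
    by (intro open_Int open_Collect_less continuous_intros)
      (intro convex_connected convex_Int convex_halfspace_Im_gt convex_halfspace_Im_lt)
  have hol: "H holomorphic_on S - pts" using hol by (rule holomorphic_on_subset) (auto simp: S_def)
  define A where "A = Complex (- T) (- h / 4)"
  define B where "B = Complex T (3 * h / 4)"
  have le: "Re A \<le> Re B" "Im A \<le> Im B" using T h by (auto simp: A_def B_def)
  have box: "cbox A B \<subseteq> S" "pts \<subseteq> box A B"
    using h T pts
    by (force simp: in_cbox_complex_iff in_box_complex_iff A_def B_def S_def abs_less_iff)+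
  have "path_image (rectpath A B) \<subseteq> S - pts"
    using box by (auto simp: path_image_rectpath_cbox_minus_box[OF le])
  then have cont: "continuous_on (path_image (rectpath A B)) H"
    using hol by (meson continuous_on_subset holomorphic_on_imp_continuous_on)
  have "norm (contour_integral (rectpath A B) H) \<le> 2 * h * E"
    by (rule norm_contour_integral_rectpath_periodic_le[OF cont per _ _ _ _ _ bound])
      (use T h in \<open>auto simp: A_def B_def\<close>)
  then show ?thesis
    by (simp only: contour_integral_rectpath_eq_sum_residues[OF S box(1) fin box(2) hol le])
qed

lemma sum_residues_periodic:
  fixes H :: "complex \<Rightarrow> complex" and h :: real
  assumes h: "h > 0" and fin: "finite pts"
    and hol: "H holomorphic_on {z. - h / 2 < Im z \<and> Im z < h} - pts"
    and pts: "\<And>p. p \<in> pts \<Longrightarrow> - h / 4 < Im p \<and> Im p < 3 * h / 4"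
    and per: "\<And>z. H (z + Complex 0 h) = H z"
    and decay: "\<And>z. \<bar>Re z\<bar> \<ge> X \<Longrightarrow> norm (H z) \<le> C * exp (- \<bar>Re z\<bar>)"
  shows "(\<Sum>p\<in>pts. residue H p) = 0"
proof -
  obtain X' where X': "\<And>p. p \<in> pts \<Longrightarrow> \<bar>Re p\<bar> \<le> X'"
    using bdd_above_finite[OF finite_imageI[OF fin, of "\<lambda>p. \<bar>Re p\<bar>"]] by (auto simp: bdd_above_def)
  have bound: "norm (2 * pi * \<i> * (\<Sum>p\<in>pts. residue H p)) \<le> 2 * h * (C * exp (- T))"
    if T: "T > X" "T > X'" "T > 0" for T
  proof (rule norm_sum_residues_periodic_le[OF h fin hol _ per T(3)])
    show "\<bar>Re p\<bar> < T \<and> - h / 4 < Im p \<and> Im p < 3 * h / 4" if "p \<in> pts" for p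
      using pts[OF that] X'[OF that] T(2) by simp
    show "norm (H z) \<le> C * exp (- T)" if "\<bar>Re z\<bar> = T" for z
      using decay[of z] T(1) that by simp
  qed
  have "norm (2 * pi * \<i> * (\<Sum>p\<in>pts. residue H p)) \<le> 0"
  proof (rule tendsto_lowerbound)
    show "((\<lambda>T. 2 * h * (C * exp (- T))) \<longlongrightarrow> 0) at_top"
      by (intro tendsto_mult_right_zero filterlim_compose[OF exp_at_bot]
          filterlim_uminus_at_bot_at_top)
    show "\<forall>\<^sub>F T in at_top. norm (2 * pi * \<i> * (\<Sum>p\<in>pts. residue H p)) \<le> 2 * h * (C * exp (- T))"
      using eventually_gt_at_top[of "max X (max X' 0)"] by eventually_elim (rule bound, auto)
  qed simp
  then show ?thesis by simp
qed

context sech_generator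
begin

lemma factor_eq_0_imp:
  assumes "\<bar>s\<bar> = 1" "\<bar>Im w\<bar> < pi / a" "factor s w = 0"
  shows "w = 0"
proof -
  have "exp (of_real (2 * a * s) * w) = 1" using assms(3) by (simp add: factor_def)
  then obtain n :: int where n: "2 * a * s * Re w = 0" "2 * a * s * Im w = of_int (2 * n) * pi"
    by (auto simp: exp_eq_1)
  have "\<bar>2 * a * s * Im w\<bar> = 2 * (a * \<bar>Im w\<bar>)" using a_pos assms(1) by (simp add: abs_mult)
  also have "\<dots> < 2 * pi" using a_pos assms(2) by (simp add: field_simps)
  finally have "\<bar>real_of_int (2 * n)\<bar> * pi < 2 * pi" using n by (simp add: abs_mult)
  then have "\<bar>real_of_int (2 * n)\<bar> < 2" by simp
  then have "n = 0" by (simp flip: of_int_abs)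
  then show ?thesis using n a_pos assms(1) by (auto simp: complex_eq_iff)
qed

lemma factor_nonzero: "factor s w \<noteq> 0" if "\<bar>s\<bar> = 1" "\<bar>Im w\<bar> < pi / a" "w \<noteq> 0"
  using factor_eq_0_imp[of s w] that by blast

lemma exp_period: "exp (of_real a * (z + Complex 0 (pi / a))) = - exp (of_real a * z)"
proof -
  have "of_real a * (z + Complex 0 (pi / a)) = of_real a * z + \<i> * of_real pi"
    using a_pos by (simp add: complex_eq_iff algebra_simps)
  then show ?thesis by (simp add: exp_add mult.commute)
qed

lemma factor_periodic:
  assumes "\<bar>s\<bar> = 1"
  shows "factor s (w + Complex 0 (pi / a)) = factor s w"
proof -
  have "of_real (2 * a * s) * (w + Complex 0 (pi / a))
      = of_real (2 * a * s) * w + of_real (2 * s * pi) * \<i>"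
    using a_pos by (simp add: complex_eq_iff algebra_simps)
  moreover have "s = 1 \<or> s = - 1" using assms by linarith
  then have "exp (of_real (2 * s * pi) * \<i>) = 1"
    by (auto simp: exp_eq_1 intro: exI[of _ "- 1 :: int"])
  ultimately show ?thesis by (simp add: factor_def exp_add)
qed

lemma factor_holomorphic [holomorphic_intros]:
  "f holomorphic_on A \<Longrightarrow> (\<lambda>z. factor s (f z)) holomorphic_on A"
  unfolding factor_def by (intro holomorphic_intros)

lemma factor_prod_holomorphic [holomorphic_intros]:
  "f holomorphic_on A \<Longrightarrow> (\<lambda>z. factor_prod h m P (f z)) holomorphic_on A"
  unfolding factor_prod_def by (intro holomorphic_intros)

lemma factor_prod_periodic: "factor_prod h m P (z + Complex 0 (pi / a)) = factor_prod h m P z"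
proof -
  have "z + Complex 0 (pi / a) - Complex l h = z - Complex l h + Complex 0 (pi / a)" for l by simp
  then show ?thesis unfolding factor_prod_def by (simp only: factor_periodic[OF abs_side])
qed

lemma factor_prod_0_nonzero:
  assumes "finite P" "\<bar>Im z\<bar> < pi / a" "z \<notin> of_real ` P"
  shows "factor_prod 0 m P z \<noteq> 0"
proof -
  have "factor (side l) (z - Complex l 0) \<noteq> 0" if "l \<in> P" for l
    using assms that by (intro factor_nonzero) (auto simp: complex_of_real_def)
  then show ?thesis using assms(1) by (simp add: factor_prod_def)
qed

definition pole :: "int \<Rightarrow> complex" where
  "pole l = Complex (real_of_int l) pole_height"

lemma pole_simps [simp]: "Re (pole l) = real_of_int l" "Im (pole l) = pole_height"
  by (simp_all add: pole_def)

lemma csech_eq_factor: "csech (z - of_int l)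
    = 2 * exp (of_real a * (z - of_int l)) / factor 1 (z - pole l)"
proof -
  define w where "w = z - of_int l"
  have "of_real (2 * a * 1) * (z - pole l) = of_real a * w + of_real a * w - \<i> * of_real pi"
    using a_pos by (simp add: w_def complex_eq_iff algebra_simps)
  then have "exp (of_real (2 * a * 1) * (z - pole l))
      = exp (of_real a * w) * exp (of_real a * w) / exp (\<i> * of_real pi)"
    by (simp only: exp_diff exp_add)
  then have "factor 1 (z - pole l) = 1 + exp (of_real a * w) * exp (of_real a * w)"
    by (simp add: factor_def)
  then show ?thesis
    unfolding w_def[symmetric] by (simp add: csech_def cosh_field_def exp_minus field_simps)
qed

lemma csech_period: "csech (z + Complex 0 (pi / a) - of_int l) = - csech (z - of_int l)"
proof -
  have shift: "z + Complex 0 (pi / a) - w = z - w + Complex 0 (pi / a)" for w by simp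
  show ?thesis unfolding csech_eq_factor unfolding shift exp_period factor_periodic[OF abs_one]
    by simp
qed

lemma norm_csech_le_2:
  assumes "1 \<le> a * \<bar>Re w\<bar>"
  shows "norm (csech w) \<le> 2"
proof -
  let ?u = "of_real a * w"
  have "\<bar>Re ?u\<bar> \<ge> 1" using assms a_pos by (simp add: abs_mult)
  moreover have "exp (- \<bar>Re ?u\<bar>) \<le> 1" by simp
  ultimately have "1 \<le> exp \<bar>Re ?u\<bar> - exp (- \<bar>Re ?u\<bar>)"
    using exp_ge_add_one_self[of "\<bar>Re ?u\<bar>"] by linarith
  also have "\<dots> \<le> norm (exp ?u + exp (- ?u))"
    using norm_diff_ineq[of "exp ?u" "exp (- ?u)"] norm_diff_ineq[of "exp (- ?u)" "exp ?u"]
    by (cases "Re ?u \<ge> 0") (auto simp: add.commute)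
  also have "\<dots> = 2 * norm (cosh ?u)" by (simp add: cosh_field_def norm_divide)
  finally show ?thesis by (simp add: csech_def norm_divide divide_le_eq)
qed

definition factor_quot :: "real \<Rightarrow> complex \<Rightarrow> complex" where
  "factor_quot s w = (if w = 0 then - of_real (2 * a * s) else factor s w / w)"

lemma factor_eq_factor_quot: "factor s w = w * factor_quot s w"
  by (simp add: factor_quot_def factor_def)

lemma factor_quot_holomorphic [holomorphic_intros]:
  assumes "f holomorphic_on A"
  shows "(\<lambda>z. factor_quot s (f z)) holomorphic_on A"
proof -
  have "factor_quot s holomorphic_on UNIV"
  proof (rule pole_theorem_open_0[where g = "factor s" and a = 0])
    show "factor s holomorphic_on UNIV" using factor_holomorphic[of "\<lambda>z. z"] by simp
    have "(factor s has_field_derivative - of_real (2 * a * s)) (at 0)"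
      unfolding factor_def[abs_def] by (auto intro!: derivative_eq_intros)
    then show "factor_quot s 0 = deriv (factor s) 0" by (simp add: factor_quot_def DERIV_imp_deriv)
  qed (auto simp: factor_eq_factor_quot factor_def)
  then show ?thesis
    using holomorphic_on_compose_gen[OF assms, of "factor_quot s" UNIV] by (simp add: o_def)
qed

lemma factor_quot_nonzero:
  assumes "\<bar>s\<bar> = 1" "\<bar>Im w\<bar> < pi / a"
  shows "factor_quot s w \<noteq> 0"
  using factor_eq_0_imp[OF assms] a_pos assms(1) by (auto simp: factor_quot_def)

lemma gen_fun_periodic: "gen_fun m P N (z + Complex 0 (pi / a)) = - gen_fun m P N z"
  by (simp add: gen_fun_def exp_period factor_prod_periodic)

lemma gen_fun_holomorphic_on:
  assumes "finite P" "\<And>z. z \<in> A \<Longrightarrow> \<bar>Im z\<bar> < pi / a \<and> z \<notin> of_real ` P"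
  shows "gen_fun m P N holomorphic_on A"
  unfolding gen_fun_def[abs_def] using assms factor_prod_0_nonzero
  by (intro holomorphic_intros) auto

lemma gen_fun_pole_eq_0:
  assumes "l \<noteq> 0" "\<bar>l\<bar> \<le> int N"
  shows "gen_fun m P N (pole l) = 0"
proof -
  have "real_of_int l \<in> nonzero_ints N" using assms by (auto simp: nonzero_ints_def)
  moreover have "factor (side (real_of_int l)) (pole l - Complex (real_of_int l) pole_height) ^ 1
      = 0"
    by (simp add: factor_def pole_def)
  ultimately have "factor_prod pole_height (\<lambda>_. 1) (nonzero_ints N) (pole l) = 0"
    unfolding factor_prod_def by (intro prod_zero finite_nonzero_ints) blast
  then show ?thesis by (simp add: gen_fun_def)
qed

lemma residue_gen_fun_pole:
  assumes P: "finite P"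
  shows "residue (\<lambda>z. csech (z - of_int l) * gen_fun m P N z) (pole l)
      = - \<i> / of_real a * gen_fun m P N (pole l)"
proof -
  define U where "U = {z. 0 < Im z \<and> Im z < pi / a}"
  have U: "open U" unfolding U_def by (intro open_Collect_conj open_Collect_less continuous_intros)
  have pole: "pole l \<in> U" using a_pos by (simp add: U_def field_simps)
  define q where "q z
      = 2 * exp (of_real a * (z - of_int l)) * gen_fun m P N z / factor_quot 1 (z - pole l)" for z
  have "factor_quot 1 (z - pole l) \<noteq> 0" if "z \<in> U" for z
  proof (rule factor_quot_nonzero)
    have "\<bar>Im z - pole_height\<bar> < pole_height"
      using that by (auto simp: U_def field_simps abs_less_iff)
    also have "\<dots> < pi / a" using a_pos by (simp add: field_simps)
    finally show "\<bar>Im (z - pole l)\<bar> < pi / a" by simp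
  qed simp
  moreover have "gen_fun m P N holomorphic_on U"
    by (rule gen_fun_holomorphic_on[OF P]) (auto simp: U_def)
  ultimately have hol: "q holomorphic_on U"
    unfolding q_def[abs_def] by (intro holomorphic_intros) auto
  have "residue (\<lambda>z. csech (z - of_int l) * gen_fun m P N z) (pole l)
      = residue (\<lambda>z. q z / (z - pole l)) (pole l)"
    by (simp add: csech_eq_factor factor_eq_factor_quot q_def mult_ac)
  also have "\<dots> = q (pole l)" by (rule residue_simple[OF U pole hol])
  also have "exp (of_real a * (pole l - of_int l)) = \<i>"
  proof -
    have "of_real a * (pole l - of_int l) = \<i> * of_real (pi / 2)"
      using a_pos by (simp add: complex_eq_iff)
    moreover have "exp (\<i> * of_real (pi / 2)) = \<i>" by (simp add: complex_eq_iff Re_exp Im_exp)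
    ultimately show ?thesis by (simp only:)
  qed
  then have "q (pole l) = - \<i> / of_real a * gen_fun m P N (pole l)"
    using a_pos by (simp add: q_def factor_quot_def field_simps)
  finally show ?thesis .
qed

definition hermite_factor :: "(real \<Rightarrow> nat) \<Rightarrow> real set \<Rightarrow> nat \<Rightarrow> real \<Rightarrow> complex \<Rightarrow> complex" where
  "hermite_factor m P N x z =
     exp (of_real a * z) * factor_prod pole_height (\<lambda>_. 1) (nonzero_ints N) z /
       (factor_prod 0 m (P - {x}) z * factor_quot (side x) (z - of_real x) ^ m x)"

lemma gen_fun_eq_hermite_factor:
  assumes "finite P" "x \<in> P"
  shows "gen_fun m P N z = hermite_factor m P N x z / (z - of_real x) ^ m x"
proof -
  have "factor_prod 0 m P z
      = ((z - of_real x) * factor_quot (side x) (z - of_real x)) ^ m x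
          * factor_prod 0 m (P - {x}) z"
    unfolding factor_prod_def complex_of_real_def factor_eq_factor_quot[symmetric] using assms
    by (rule prod.remove)
  then show ?thesis
    by (simp add: gen_fun_def hermite_factor_def power_mult_distrib mult_ac)
qed

lemma hermite_factor_holomorphic:
  assumes P: "finite P"
  shows "hermite_factor m P N x holomorphic_on strip - of_real ` (P - {x})"
proof -
  have "pole_height < pi / a" using a_pos by (simp add: field_simps)
  then have im: "\<bar>Im z\<bar> < pi / a" if "z \<in> strip" for z using that by auto
  have "factor_prod 0 m (P - {x}) z \<noteq> 0" "factor_quot (side x) (z - of_real x) \<noteq> 0"
    if "z \<in> strip - of_real ` (P - {x})" for z
    using factor_prod_0_nonzero[of "P - {x}" z] factor_quot_nonzero[OF abs_side, of "z - of_real x"]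
      im[of z] that P by auto
  then show ?thesis
    unfolding hermite_factor_def by (intro holomorphic_intros) auto
qed

definition node_weight :: "(real \<Rightarrow> nat) \<Rightarrow> real set \<Rightarrow> nat \<Rightarrow> real \<Rightarrow> nat \<Rightarrow> complex" where
  "node_weight m P N x j =
     of_nat ((m x - 1) choose j) * (deriv ^^ (m x - 1 - j)) (hermite_factor m P N x) (of_real x)
         / fact (m x - 1)"

lemma residue_gen_fun_node:
  assumes P: "finite P" and x: "x \<in> P"
  shows "residue (\<lambda>z. csech (z - of_int l) * gen_fun m P N z) (of_real x)
    = (\<Sum>j<m x. node_weight m P N x j * dsech j (x - real_of_int l))"
proof -
  define U where "U = strip - of_real ` (P - {x})"
  have U: "open U"
    unfolding U_def using P
    by (intro open_Diff open_strip finite_imp_closed finite_imageI finite_Diff)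
  have xU: "of_real x \<in> U" using a_pos by (auto simp: U_def)
  have sech: "(\<lambda>z. csech (z - of_int l)) holomorphic_on U"
    using csech_translate_holomorphic by (rule holomorphic_on_subset) (auto simp: U_def)
  have hermite: "hermite_factor m P N x holomorphic_on U"
    unfolding U_def by (rule hermite_factor_holomorphic[OF P])
  have quotient: "(\<lambda>z. csech (z - of_int l) * gen_fun m P N z)
      = (\<lambda>z. (csech (z - of_int l) * hermite_factor m P N x z) / (z - of_real x) ^ m x)"
    by (simp add: gen_fun_eq_hermite_factor[OF P x])
  show ?thesis
  proof (cases "m x")
    case 0
    then show ?thesis
      unfolding quotient using residue_holo[OF U xU holomorphic_on_mult[OF sech hermite]] by simp
  next
    case (Suc n)
    have "residue (\<lambda>z. csech (z - of_int l) * gen_fun m P N z) (of_real x)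
        = (deriv ^^ n) (\<lambda>z. csech (z - of_int l) * hermite_factor m P N x z) (of_real x) / fact n"
      unfolding quotient Suc
      by (rule residue_holomorphic_over_power[OF U xU holomorphic_on_mult[OF sech hermite]])
    also have "(deriv ^^ n) (\<lambda>z. csech (z - of_int l) * hermite_factor m P N x z) (of_real x)
       = (\<Sum>j = 0..n. of_nat (n choose j) * (deriv ^^ j) (\<lambda>z. csech (z - of_int l)) (of_real x)
           * (deriv ^^ (n - j)) (hermite_factor m P N x) (of_real x))"
      by (rule higher_deriv_mult[OF sech hermite U xU])
    also have "\<dots> / fact n = (\<Sum>j<m x. node_weight m P N x j * dsech j (x - real_of_int l))"
      unfolding sum_divide_distrib
      by (intro sum.cong) (auto simp: Suc node_weight_def dsech_translate)
    finally show ?thesis .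
  qed
qed

lemma csech_gen_fun_holomorphic:
  assumes P: "finite P"
  shows "(\<lambda>z. csech (z - of_int l) * gen_fun m P N z)
    holomorphic_on {z. - (pi / a) / 2 < Im z \<and> Im z < pi / a} - insert (pole l) (of_real ` P)"
    (is "_ holomorphic_on ?U")
proof -
  have "factor 1 (z - pole l) \<noteq> 0" if "z \<in> ?U" for z
    using that a_pos by (intro factor_nonzero) (auto simp: abs_less_iff field_simps)
  moreover have "gen_fun m P N holomorphic_on ?U"
  proof (intro gen_fun_holomorphic_on[OF P] conjI)
    fix z assume z: "z \<in> ?U"
    have "- (pi / a) < - (pi / a) / 2" using a_pos by (simp add: field_simps)
    then show "\<bar>Im z\<bar> < pi / a" using z by auto
    show "z \<notin> of_real ` P" using z by auto
  qed
  ultimately show ?thesis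
    unfolding csech_eq_factor by (intro holomorphic_intros) auto
qed

lemma sum_node_weights:
  assumes P: "finite P"
    and decay: "\<And>z. \<bar>Re z\<bar> \<ge> X \<Longrightarrow> norm (gen_fun m P N z) \<le> C * exp (- \<bar>Re z\<bar>)"
  shows "(\<Sum>x\<in>P. \<Sum>j<m x. node_weight m P N x j * dsech j (x - real_of_int l))
      = \<i> / of_real a * gen_fun m P N (pole l)"
proof -
  define H where "H z = csech (z - of_int l) * gen_fun m P N z" for z
  have "(\<Sum>q\<in>insert (pole l) (of_real ` P). residue H q) = 0"
  proof (rule sum_residues_periodic[of "pi / a"])
    show "H holomorphic_on {z. - (pi / a) / 2 < Im z \<and> Im z < pi / a}
        - insert (pole l) (of_real ` P)"
      unfolding H_def[abs_def] by (rule csech_gen_fun_holomorphic[OF P])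
    show "- (pi / a) / 4 < Im q \<and> Im q < 3 * (pi / a) / 4" if "q \<in> insert (pole l) (of_real ` P)"
      for q
      using that a_pos by (auto simp: field_simps)
    show "H (z + Complex 0 (pi / a)) = H z" for z
      by (simp add: H_def csech_period gen_fun_periodic)
    show "norm (H z) \<le> 2 * C * exp (- \<bar>Re z\<bar>)" if "\<bar>Re z\<bar> \<ge> max X (\<bar>real_of_int l\<bar> + 1 / a)" for z
    proof -
      have "1 / a \<le> \<bar>Re z - real_of_int l\<bar>" using that by auto
      then have "norm (csech (z - of_int l)) \<le> 2"
        using a_pos by (intro norm_csech_le_2) (simp add: field_simps)
      moreover have "norm (gen_fun m P N z) \<le> C * exp (- \<bar>Re z\<bar>)" using decay that by simp
      ultimately have "norm (csech (z - of_int l)) * norm (gen_fun m P N z)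
          \<le> 2 * (C * exp (- \<bar>Re z\<bar>))"
        by (intro mult_mono) auto
      then show ?thesis by (simp add: H_def norm_mult)
    qed
  qed (use a_pos P in auto)
  moreover have "pole l \<notin> of_real ` P" using a_pos by (auto simp: pole_def complex_eq_iff)
  then have "(\<Sum>q\<in>insert (pole l) (of_real ` P). residue H q)
      = residue H (pole l) + (\<Sum>x\<in>P. residue H (of_real x))"
    using P by (subst sum.insert) (auto simp: sum.reindex inj_on_def)
  ultimately show ?thesis
    unfolding H_def[abs_def] by (simp add: residue_gen_fun_pole residue_gen_fun_node P)
qed

end

lemma choose_fact_le: "real (n choose j) * fact (n - j) \<le> fact n"
proof (cases "j \<le> n")
  case True
  have "fact j * fact (n - j) * (n choose j) = (fact n :: nat)"
    by (rule binomial_fact_lemma[OF True])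
  moreover have "fact (n - j) * (n choose j) \<le> fact j * (fact (n - j) * (n choose j))"
    by (simp add: fact_ge_1)
  ultimately have "(n choose j) * fact (n - j) \<le> fact n" by (simp add: mult_ac)
  then have "real ((n choose j) * fact (n - j)) \<le> real (fact n)" by (rule of_nat_mono)
  then show ?thesis by simp
qed (simp add: binomial_eq_0)

context sech_sampling
begin

lemma regular_on_node_circle:
  assumes P: "separated_by \<delta> P" "x \<in> P" and z: "norm (z - of_real x) = node_radius" and l: "l \<in> P"
  shows "regular (z - of_real l)"
proof (cases "l = x")
  case True then show ?thesis using z by (simp add: regular_point_def)
next
  case False
  then have "\<delta> \<le> \<bar>l - x\<bar>" using separated_familyD[OF P(1) l P(2)] by simp
  moreover have "\<bar>Re z - x\<bar> \<le> \<delta> / 2"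
    using abs_Re_le_cmod[of "z - of_real x"] z node_radius_bounds(2) by simp
  ultimately have "\<delta> / 2 \<le> \<bar>Re z - l\<bar>" by linarith
  then show ?thesis by (simp add: regular_point_def)
qed

lemma node_cball_subset:
  assumes P: "separated_by \<delta> P" "x \<in> P"
  shows "cball (of_real x) node_radius \<subseteq> strip - of_real ` (P - {x})"
proof
  fix z assume z: "z \<in> cball (complex_of_real x) node_radius"
  have "a * node_radius \<le> a * radius" using node_radius_bounds pi_gt3 a_pos by simp
  then have "node_radius \<le> radius" using a_pos by (rule mult_left_le_imp_le)
  then have "z \<in> cball (of_real x) radius" using z by auto
  then have "z \<in> strip" using cball_subset_strip by blast
  moreover have "z \<notin> of_real ` (P - {x})"
  proof
    assume "z \<in> of_real ` (P - {x})"
    then obtain y where y: "y \<in> P" "y \<noteq> x" "z = of_real y" by auto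
    then have "\<delta> \<le> \<bar>x - y\<bar>" using separated_familyD[OF P(1,2)] by simp
    moreover have "\<bar>x - y\<bar> \<le> node_radius" using z y by (simp add: dist_norm flip: of_real_diff)
    ultimately show False using node_radius_bounds(2) \<delta>_pos by simp
  qed
  ultimately show "z \<in> strip - of_real ` (P - {x})" by simp
qed

lemma norm_hermite_factor_le:
  assumes P: "finite P" "separated_by \<delta> P" and x: "x \<in> P"
    and gen_fun_le: "\<And>z. (\<And>l. l \<in> P \<Longrightarrow> regular (z - of_real l)) \<Longrightarrow>
        norm (gen_fun m P N z) \<le> C * exp (- \<bar>Re z\<bar>)"
    and C: "C > 0" and z: "norm (z - of_real x) = node_radius"
  shows "norm (hermite_factor m P N x z) \<le> C * exp 1 * exp (- \<bar>x\<bar>) * node_radius ^ m x"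
proof -
  have "\<bar>Re z - x\<bar> \<le> 1"
    using abs_Re_le_cmod[of "z - of_real x"] z node_radius_bounds(2) \<delta>_le_1 by simp
  then have "C * exp (- \<bar>Re z\<bar>) \<le> C * exp (1 + - \<bar>x\<bar>)" using C by simp
  then have "norm (gen_fun m P N z) \<le> C * exp (1 + - \<bar>x\<bar>)"
    using gen_fun_le[OF regular_on_node_circle[OF P(2) x z]] by linarith
  then have gen_fun_le': "norm (gen_fun m P N z) \<le> C * exp 1 * exp (- \<bar>x\<bar>)"
    unfolding exp_add by (simp only: mult.assoc)
  have "z \<noteq> of_real x" using z node_radius_bounds(1) by auto
  then have "norm (hermite_factor m P N x z) = norm (gen_fun m P N z) * node_radius ^ m x"
    using z node_radius_bounds(1)
    by (simp add: gen_fun_eq_hermite_factor[OF P(1) x] norm_divide norm_power)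
  also have "\<dots> \<le> C * exp 1 * exp (- \<bar>x\<bar>) * node_radius ^ m x"
    using gen_fun_le' node_radius_bounds(1) by (intro mult_right_mono) auto
  finally show ?thesis .
qed

lemma norm_node_weight_le:
  assumes P: "finite P" "separated_by \<delta> P" and x: "x \<in> P" "j < m x"
    and gen_fun_le: "\<And>z. (\<And>l. l \<in> P \<Longrightarrow> regular (z - of_real l)) \<Longrightarrow>
        norm (gen_fun m P N z) \<le> C * exp (- \<bar>Re z\<bar>)"
    and C: "C > 0"
  shows "norm (node_weight m P N x j) \<le> C * exp 1 * exp (- \<bar>x\<bar>)"
proof -
  obtain n where n: "m x = Suc n" using x by (cases "m x") auto
  define B where "B = C * exp 1 * exp (- \<bar>x\<bar>) * node_radius ^ Suc n"
  have hol: "hermite_factor m P N x holomorphic_on cball (of_real x) node_radius"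
    using hermite_factor_holomorphic[OF P(1)] node_cball_subset[OF P(2) x(1)]
    by (rule holomorphic_on_subset)
  have deriv_le: "norm ((deriv ^^ (n - j)) (hermite_factor m P N x) (of_real x))
      \<le> fact (n - j) * B / node_radius ^ (n - j)"
  proof (rule Cauchy_inequality)
    fix z assume "norm (complex_of_real x - z) = node_radius"
    then show "norm (hermite_factor m P N x z) \<le> B"
      using norm_hermite_factor_le[OF P x(1) gen_fun_le C, of z]
      by (simp add: n B_def norm_minus_commute)
  qed (use hol node_radius_bounds in
      \<open>auto intro: holomorphic_on_imp_continuous_on elim: holomorphic_on_subset\<close>)
  have "norm (node_weight m P N x j)
      = real (n choose j) * norm ((deriv ^^ (n - j)) (hermite_factor m P N x) (of_real x)) / fact n"
    by (simp add: node_weight_def n norm_mult norm_divide)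
  also have "\<dots> \<le> real (n choose j) * (fact (n - j) * B / node_radius ^ (n - j)) / fact n"
    using deriv_le by (intro divide_right_mono mult_left_mono) auto
  also have "\<dots> = (real (n choose j) * fact (n - j)) / fact n * (B / node_radius ^ (n - j))"
    by (simp add: mult_ac)
  also have "\<dots> \<le> 1 * (B / node_radius ^ (n - j))"
    using choose_fact_le[of n j] C node_radius_bounds(1)
    by (intro mult_right_mono) (auto simp: B_def)
  also have "\<dots> = C * exp 1 * exp (- \<bar>x\<bar>) * node_radius ^ Suc j"
  proof -
    have "j \<le> n" using x(2) n by simp
    then have "node_radius ^ Suc n = node_radius ^ Suc j * node_radius ^ (n - j)"
      by (simp flip: power_add)
    then show ?thesis using node_radius_bounds(1) by (simp add: B_def)
  qed
  also have "\<dots> \<le> C * exp 1 * exp (- \<bar>x\<bar>) * 1"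
    using node_radius_bounds \<delta>_le_1 C by (intro mult_left_mono power_le_one) auto
  finally show ?thesis by simp
qed

end

section \<open>Reconstruction of the coefficients\<close>

definition uniformly_dense :: "nat \<Rightarrow> real set \<Rightarrow> (real \<Rightarrow> nat) \<Rightarrow> bool" where
  "uniformly_dense L A m \<longleftrightarrow> (\<forall>y. real L + 1 \<le> (\<Sum>l\<in>A \<inter> {y..y + real L - 1}. real (m l)))"

lemma dense_blocks_Int_Icc:
  assumes "\<delta> > 0" "separated_by \<delta> A" and dense: "uniformly_dense L A m"
  shows "dense_blocks L J (A \<inter> {- real (J * L)..real (J * L)}) m"
  unfolding dense_blocks_def
proof (intro ballI allI impI)
  fix \<sigma> :: real and j assume \<sigma>: "\<sigma> \<in> {-1, 1}" and "j < J"
  then have "real (Suc j) * real L \<le> real J * real L" by (intro mult_right_mono) auto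
  then have le: "real (Suc j) * real L \<le> real (J * L)" by simp
  have "0 \<le> real j * real L" "0 \<le> real (J * L)" by simp_all
  then have ge: "- (real j * real L) \<le> real (J * L)" by linarith
  define y where "y = (if \<sigma> = 1 then real j * real L + 1 else - real (Suc j) * real L)"
  have "real L + 1 \<le> (\<Sum>l\<in>A \<inter> {y..y + real L - 1}. real (m l))"
    using dense unfolding uniformly_dense_def by blast
  also have "\<dots> \<le> (\<Sum>l\<in>A \<inter> {- real (J * L)..real (J * L)} \<inter> block L \<sigma> j. real (m l))"
  proof (rule sum_mono2)
    show "finite (A \<inter> {- real (J * L)..real (J * L)} \<inter> block L \<sigma> j)"
      using finite_separated_Int_Icc[OF assms(1,2)] by blast
    show "A \<inter> {y..y + real L - 1} \<subseteq> A \<inter> {- real (J * L)..real (J * L)} \<inter> block L \<sigma> j"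
      using \<sigma> le ge by (auto simp: y_def block_def algebra_simps simp del: of_nat_mult)
  qed simp
  finally show "real L + 1 \<le> (\<Sum>l\<in>A \<inter> {- real (J * L)..real (J * L)} \<inter> block L \<sigma> j. real (m l))" .
qed

lemma uniformly_dense_translate:
  assumes "uniformly_dense L A m"
  shows "uniformly_dense L ((\<lambda>x. x - t) ` A) (\<lambda>x. m (x + t))"
  unfolding uniformly_dense_def
proof
  fix y
  have "(\<Sum>l\<in>(\<lambda>x. x - t) ` A \<inter> {y..y + real L - 1}. real (m (l + t)))
      = (\<Sum>l\<in>A \<inter> {y + t..y + t + real L - 1}. real (m l))"
    by (rule sum.reindex_bij_witness[of _ "\<lambda>x. x - t" "\<lambda>x. x + t"]) auto
  then show "real L + 1 \<le> (\<Sum>l\<in>(\<lambda>x. x - t) ` A \<inter> {y..y + real L - 1}. real (m (l + t)))"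
    using assms unfolding uniformly_dense_def by simp
qed

definition sample_energy :: "real \<Rightarrow> (real \<Rightarrow> nat) \<Rightarrow> (real \<Rightarrow> complex) \<Rightarrow> real \<Rightarrow> real" where
  "sample_energy p m f x = (\<Sum>j<m x. norm (hderiv j f x) powr p)"

lemma sample_energy_nonneg: "sample_energy p m f x \<ge> 0"
  unfolding sample_energy_def by (intro sum_nonneg) simp

lemma sample_energy_1: "sample_energy 1 m f x = (\<Sum>j<m x. norm (hderiv j f x))"
  by (simp add: sample_energy_def)

lemma sample_energy_le:
  assumes "p \<ge> 0" "m x \<le> M" "\<And>j. j < m x \<Longrightarrow> norm (hderiv j f x) \<le> \<sigma>"
  shows "sample_energy p m f x \<le> real M * \<sigma> powr p"
proof -
  have "sample_energy p m f x \<le> (\<Sum>j<m x. \<sigma> powr p)"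
    unfolding sample_energy_def using assms by (intro sum_mono powr_mono2) auto
  also have "\<dots> \<le> real M * \<sigma> powr p" using assms(2) by (simp add: mult_right_mono)
  finally show ?thesis .
qed

lemma has_sum_sum:
  fixes f :: "'i \<Rightarrow> 'a \<Rightarrow> 'b :: {topological_comm_monoid_add, comm_monoid_add}"
  assumes "\<And>i. i \<in> I \<Longrightarrow> (f i has_sum s i) A"
  shows "((\<lambda>x. \<Sum>i\<in>I. f i x) has_sum (\<Sum>i\<in>I. s i)) A"
  using assms by (induction I rule: infinite_finite_induct) (auto intro!: has_sum_add)

context sech_generator
begin

lemma interpolation_formula:
  assumes P: "finite P" and decay: "\<And>z. \<bar>Re z\<bar> \<ge> X \<Longrightarrow> norm (gen_fun m P N z) \<le> C * exp (- \<bar>Re z\<bar>)"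
    and c: "bounded (range c)" and f: "generated_by (sech_a a) c f"
  shows "((\<lambda>l. c l * gen_fun m P N (pole l))
    has_sum of_real a / \<i> * (\<Sum>x\<in>P. \<Sum>j<m x. node_weight m P N x j * hderiv j f x)) UNIV"
proof -
  have "((\<lambda>l. of_real a / \<i>
      * (\<Sum>x\<in>P. \<Sum>j<m x. node_weight m P N x j * (c l * dsech j (x - real_of_int l))))
      has_sum of_real a / \<i> * (\<Sum>x\<in>P. \<Sum>j<m x. node_weight m P N x j * hderiv j f x)) UNIV"
    by (intro has_sum_cmult_right has_sum_sum hderiv_has_sum c f)
  moreover have "of_real a / \<i>
      * (\<Sum>x\<in>P. \<Sum>j<m x. node_weight m P N x j * (c l * dsech j (x - real_of_int l)))
      = c l * gen_fun m P N (pole l)" for l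
  proof -
    have node_sum: "(\<Sum>x\<in>P. \<Sum>j<m x. node_weight m P N x j * dsech j (x - real_of_int l))
        = \<i> / of_real a * gen_fun m P N (pole l)"
      by (rule sum_node_weights[OF P decay])
    have "(\<Sum>x\<in>P. \<Sum>j<m x. node_weight m P N x j * (c l * dsech j (x - real_of_int l)))
        = c l * (\<Sum>x\<in>P. \<Sum>j<m x. node_weight m P N x j * dsech j (x - real_of_int l))"
      unfolding sum_distrib_left by (simp add: mult_ac)
    also have "\<dots> = c l * (\<i> / of_real a * gen_fun m P N (pole l))"
      unfolding node_sum ..
    finally show ?thesis using a_pos by (simp add: field_simps)
  qed
  ultimately show ?thesis by simp
qed

end

context sech_sampling
begin

definition admissible :: "real set \<Rightarrow> (real \<Rightarrow> nat) \<Rightarrow> bool" where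
  "admissible A m \<longleftrightarrow> separated_by \<delta> A \<and> (\<forall>l\<in>A. m l \<le> M) \<and> uniformly_dense L A m"

lemma admissibleD:
  assumes "admissible A m"
  shows "separated_by \<delta> A" "\<And>x. x \<in> A \<Longrightarrow> m x \<le> M"
  using assms by (auto simp: admissible_def)

lemma admissible_translate:
  assumes "admissible A m"
  shows "admissible ((\<lambda>x. x - t) ` A) (\<lambda>x. m (x + t))"
  using assms uniformly_dense_translate[of L A m t]
  by (auto simp: admissible_def separated_family_def)

abbreviation sample_conv :: "real set \<Rightarrow> (real \<Rightarrow> nat) \<Rightarrow> (real \<Rightarrow> complex) \<Rightarrow> real \<Rightarrow> real" where
  "sample_conv A m f \<equiv> exp_conv 1 (\<lambda>x. x) A (sample_energy 1 m f)"

lemma sample_conv_has_sum: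
  assumes A: "admissible A m" and c: "bounded (range c)" and f: "generated_by (sech_a a) c f"
  shows "((\<lambda>x. exp (- 1 * \<bar>y - x\<bar>) * sample_energy 1 m f x) has_sum sample_conv A m f y) A"
proof -
  obtain B where B: "\<And>l. norm (c l) \<le> B" using c by (auto simp: bounded_iff)
  have "sample_energy 1 m f x \<le> real M * (dsech_bound M * exp_sum_bound a 1 * B) powr 1" if "x \<in> A"
    for x
    using A that by (intro sample_energy_le norm_hderiv_le_sup[OF B f]) (auto simp: admissible_def)
  then show ?thesis
    using A sample_energy_nonneg
    by (intro exp_conv_has_sum[OF zero_less_one \<delta>_pos]) (auto simp: admissible_def)
qed

definition coeff_bound :: real where
  "coeff_bound = a * (gen_fun_upper * exp 1) / gen_fun_lower"

lemma coeff_bound_pos: "coeff_bound > 0"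
  unfolding coeff_bound_def using a_pos gen_fun_upper_pos gen_fun_lower_pos by simp

context
  fixes A :: "real set" and m :: "real \<Rightarrow> nat" and c :: "int \<Rightarrow> complex" and f :: "real \<Rightarrow> complex"
    and B :: real and J :: nat
  assumes A: "admissible A m" and B: "\<And>l. norm (c l) \<le> B" and f: "generated_by (sech_a a) c f"
    and J: "block_threshold \<le> J"
begin

private abbreviation window :: "real set" where
  "window \<equiv> A \<inter> {- real (J * L)..real (J * L)}"

private abbreviation K :: "complex \<Rightarrow> complex" where
  "K \<equiv> gen_fun m window (J * L)"

private abbreviation node_functional :: complex where
  "node_functional \<equiv> of_real a / \<i>
      * (\<Sum>x\<in>window. \<Sum>j<m x. node_weight m window (J * L) x j * hderiv j f x)"

private lemma bounded_coeffs: "bounded (range c)"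
  using B by (auto simp: bounded_iff)

private lemma window_nodes: "finite window" "separated_by \<delta> window" "\<And>l. l \<in> window \<Longrightarrow> m l \<le> M"
  using A finite_separated_Int_Icc[OF \<delta>_pos]
  by (auto simp: admissible_def intro: separated_family_subset)

private lemma norm_K_le: "norm (K z) \<le> gen_fun_upper * exp (- \<bar>Re z\<bar>)"
  if "\<And>l. l \<in> window \<Longrightarrow> regular (z - of_real l)" for z
  using A by (intro norm_gen_fun_le window_nodes dense_blocks_Int_Icc[OF \<delta>_pos] J that)
    (auto simp: admissible_def)

private lemma norm_K_pole_le: "norm (K (pole l)) \<le> gen_fun_upper * exp (- \<bar>real_of_int l\<bar>)"
  using norm_K_le[of "pole l"] by (simp add: regular_point_def)

private lemma has_sum_coeff_K: "((\<lambda>l. c l * K (pole l)) has_sum node_functional) UNIV"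
proof (rule interpolation_formula[OF window_nodes(1) _ bounded_coeffs f])
  fix z assume z: "\<bar>Re z\<bar> \<ge> real (J * L) + 1"
  show "norm (K z) \<le> gen_fun_upper * exp (- \<bar>Re z\<bar>)"
  proof (rule norm_K_le)
    fix l assume "l \<in> window"
    then have "\<bar>l\<bar> \<le> real (J * L)" by (auto simp: abs_le_iff simp del: of_nat_mult)
    then have "1 \<le> \<bar>Re z - l\<bar>" using z by linarith
    then show "regular (z - of_real l)" using \<delta>_le_1 by (simp add: regular_point_def)
  qed
qed

private lemma norm_node_functional_le:
  "norm node_functional \<le> a * (gen_fun_upper * exp 1) * sample_conv A m f 0"
proof -
  have "norm (\<Sum>x\<in>window. \<Sum>j<m x. node_weight m window (J * L) x j * hderiv j f x)
      \<le> (\<Sum>x\<in>window. \<Sum>j<m x. gen_fun_upper * exp 1 * exp (- \<bar>x\<bar>) * norm (hderiv j f x))"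
  proof (intro order_trans[OF norm_sum] sum_mono)
    fix x j assume "x \<in> window" "j \<in> {..<m x}"
    then show "norm (node_weight m window (J * L) x j * hderiv j f x)
        \<le> gen_fun_upper * exp 1 * exp (- \<bar>x\<bar>) * norm (hderiv j f x)"
      unfolding norm_mult
      by (intro mult_right_mono norm_node_weight_le window_nodes norm_K_le gen_fun_upper_pos) auto
  qed
  also have "\<dots> = gen_fun_upper * exp 1 * (\<Sum>x\<in>window. exp (- 1 * \<bar>0 - x\<bar>) * sample_energy 1 m f x)"
    unfolding sample_energy_1 sum_distrib_left by (simp add: mult_ac)
  also have "\<dots> \<le> gen_fun_upper * exp 1 * sample_conv A m f 0"
    using gen_fun_upper_pos sample_energy_nonneg window_nodes(1)
    by (intro mult_left_mono
        finite_sum_le_has_sum[OF sample_conv_has_sum[OF A bounded_coeffs f]]) auto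
  finally show ?thesis using a_pos by (simp add: norm_mult norm_divide mult_left_mono mult.assoc)
qed

private lemma norm_node_functional_diff_le:
  "norm (node_functional - c 0 * K (pole 0))
    \<le> B * gen_fun_upper * exp (- real (J * L) / 2) * exp_sum_bound (1 / 2) 1"
proof -
  define D where "D = B * gen_fun_upper * exp (- real (J * L) / 2)"
  define E where "E = exp_conv (1 / 2) real_of_int UNIV (\<lambda>_. 1) 0"
  have B_nonneg: "B \<ge> 0" using B[of 0] norm_ge_zero order_trans by blast
  have D: "D \<ge> 0" using B_nonneg gen_fun_upper_pos by (simp add: D_def)
  have "((\<lambda>l. if l = 0 then c 0 * K (pole 0) else 0) has_sum c 0 * K (pole 0)) UNIV"
    by (rule has_sum_finite_neutralI[of "{0}"]) auto
  from has_sum_add[OF has_sum_coeff_K has_sum_uminusI[OF this]]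
  have "norm (node_functional + - (c 0 * K (pole 0))) \<le> D * E"
  proof (rule norm_infsum_le)
    have "((\<lambda>l. exp (- (1 / 2) * \<bar>0 - real_of_int l\<bar>) * 1) has_sum E) UNIV"
      unfolding E_def
      by (intro exp_conv_has_sum[where \<delta> = 1 and B = 1] separated_family_of_int) auto
    then show "((\<lambda>l. D * exp (- \<bar>real_of_int l\<bar> / 2)) has_sum D * E) UNIV"
      by (intro has_sum_cmult_right) simp
    fix l :: int
    show "norm (c l * K (pole l) + - (if l = 0 then c 0 * K (pole 0) else 0))
        \<le> D * exp (- \<bar>real_of_int l\<bar> / 2)"
    proof (cases "\<bar>l\<bar> \<le> int (J * L)")
      case True
      then have "l = 0 \<or> K (pole l) = 0" using gen_fun_pole_eq_0 by blast
      then show ?thesis using D by auto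
    next
      case False
      then have far: "real (J * L) \<le> \<bar>real_of_int l\<bar>" by linarith
      have "norm (c l * K (pole l)) \<le> B * (gen_fun_upper * exp (- \<bar>real_of_int l\<bar>))"
        unfolding norm_mult using B_nonneg by (intro mult_mono B norm_K_pole_le) auto
      also have "\<dots> \<le> B * (gen_fun_upper * exp (- real (J * L) / 2 + - \<bar>real_of_int l\<bar> / 2))"
        using far B_nonneg gen_fun_upper_pos by (intro mult_left_mono) auto
      finally have "norm (c l * K (pole l)) \<le> D * exp (- \<bar>real_of_int l\<bar> / 2)"
        unfolding D_def exp_add by (simp only: mult.assoc)
      moreover have "l \<noteq> 0" using False by auto
      ultimately show ?thesis by simp
    qed
  qed
  also have "\<dots> \<le> D * (exp_sum_bound (1 / 2) 1 * 1)"
    unfolding E_def using D by (intro mult_left_mono exp_conv_le separated_family_of_int) auto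
  finally show ?thesis by (simp add: D_def)
qed

lemma norm_coeff_0_le_window:
  "gen_fun_lower * norm (c 0) \<le> a * (gen_fun_upper * exp 1) * sample_conv A m f 0
    + B * gen_fun_upper * exp (- real (J * L) / 2) * exp_sum_bound (1 / 2) 1"
proof -
  have "gen_fun_lower \<le> norm (K (pole 0))"
    using norm_gen_fun_pole_0_ge[OF window_nodes] by (simp add: pole_def)
  then have "gen_fun_lower * norm (c 0) \<le> norm (c 0 * K (pole 0))"
    by (simp add: norm_mult mult.commute mult_left_mono)
  also have "\<dots> \<le> norm node_functional + norm (node_functional - c 0 * K (pole 0))"
    using norm_triangle_ineq4[of node_functional "node_functional - c 0 * K (pole 0)"] by simp
  finally show ?thesis
    using norm_node_functional_le norm_node_functional_diff_le by linarith
qed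

end

lemma norm_coeff_0_le:
  assumes A: "admissible A m" and c: "bounded (range c)" and f: "generated_by (sech_a a) c f"
  shows "norm (c 0) \<le> coeff_bound * sample_conv A m f 0"
proof -
  obtain B where B: "\<And>l. norm (c l) \<le> B" using c by (auto simp: bounded_iff)
  define T where "T = a * (gen_fun_upper * exp 1) * sample_conv A m f 0"
  have "gen_fun_lower * norm (c 0) \<le> T + B * gen_fun_upper * 0 * exp_sum_bound (1 / 2) 1"
  proof (rule tendsto_lowerbound)
    have "filterlim (\<lambda>J. real (J * L)) at_top sequentially"
      by (rule filterlim_at_top_mono[OF filterlim_real_sequentially])
        (use L_pos in \<open>auto intro!: always_eventually simp del: of_nat_mult\<close>)
    then have "filterlim (\<lambda>J. 1 / 2 * real (J * L)) at_top sequentially"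
      by (rule filterlim_tendsto_pos_mult_at_top[OF tendsto_const, rotated]) simp
    then have "((\<lambda>J. exp (- (1 / 2 * real (J * L)))) \<longlongrightarrow> 0) sequentially"
      by (intro filterlim_compose[OF exp_at_bot]) (simp only: filterlim_uminus_at_bot minus_minus)
    then have "((\<lambda>J. exp (- real (J * L) / 2)) \<longlongrightarrow> 0) sequentially"
      by (simp del: of_nat_mult)
    then show "((\<lambda>J. T + B * gen_fun_upper * exp (- real (J * L) / 2) * exp_sum_bound (1 / 2) 1)
        \<longlongrightarrow> T + B * gen_fun_upper * 0 * exp_sum_bound (1 / 2) 1) sequentially"
      by (intro tendsto_intros)
    show "\<forall>\<^sub>F J in sequentially. gen_fun_lower * norm (c 0)
        \<le> T + B * gen_fun_upper * exp (- real (J * L) / 2) * exp_sum_bound (1 / 2) 1"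
      using eventually_ge_at_top[of block_threshold]
      by eventually_elim (unfold T_def, rule norm_coeff_0_le_window[OF A B f])
  qed simp
  then show ?thesis
    using gen_fun_lower_pos by (simp add: coeff_bound_def T_def field_simps)
qed

lemma norm_coeff_le:
  assumes A: "admissible A m" and c: "bounded (range c)" and f: "generated_by (sech_a a) c f"
  shows "norm (c k) \<le> coeff_bound * sample_conv A m f (real_of_int k)"
proof -
  define t where "t = real_of_int k"
  have "bounded (range (\<lambda>l. c (l + k)))" by (rule bounded_subset[OF c]) auto
  then have "norm (c (0 + k))
      \<le> coeff_bound * sample_conv ((\<lambda>x. x - t) ` A) (\<lambda>x. m (x + t)) (\<lambda>x. f (x + t)) 0"
    unfolding t_def
    by (rule norm_coeff_0_le[OF admissible_translate[OF A] _ generated_by_translate[OF f]])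
  also have "sample_conv ((\<lambda>x. x - t) ` A) (\<lambda>x. m (x + t)) (\<lambda>x. f (x + t)) 0 = sample_conv A m f t"
  proof -
    have "sample_energy 1 (\<lambda>x. m (x + t)) (\<lambda>x. f (x + t)) (x - t) = sample_energy 1 m f x" for x
      unfolding sample_energy_def t_def by (simp add: hderiv_translate[OF c f])
    then show ?thesis
      unfolding exp_conv_def
      by (subst infsum_reindex) (simp_all add: inj_on_def o_def abs_minus_commute)
  qed
  finally show ?thesis by (simp add: t_def)
qed

lemma norm_coeff_le_sup:
  assumes A: "admissible A m" and c: "bounded (range c)" and f: "generated_by (sech_a a) c f"
    and \<sigma>: "\<sigma> \<ge> 0" "\<And>x j. x \<in> A \<Longrightarrow> j < m x \<Longrightarrow> norm (hderiv j f x) \<le> \<sigma>"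
  shows "norm (c k) \<le> coeff_bound * (exp_sum_bound 1 \<delta> * real (Suc M)) * \<sigma>"
proof -
  have "sample_energy 1 m f x \<le> real (Suc M) * \<sigma>" if "x \<in> A" for x
    using sample_energy_le[of 1 m x "Suc M" f \<sigma>] A that \<sigma> by (force simp: admissible_def)
  then have "sample_conv A m f (real_of_int k) \<le> exp_sum_bound 1 \<delta> * (real (Suc M) * \<sigma>)"
    using A \<sigma>(1) sample_energy_nonneg
    by (intro exp_conv_le \<delta>_pos) (auto simp: admissible_def)
  then have "coeff_bound * sample_conv A m f (real_of_int k)
      \<le> coeff_bound * (exp_sum_bound 1 \<delta> * (real (Suc M) * \<sigma>))"
    using coeff_bound_pos by (intro mult_left_mono) auto
  then show ?thesis using norm_coeff_le[OF A c f, of k] by (simp only: mult.assoc)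
qed

end

section \<open>Integrals and sums over lattices\<close>

definition shifted_lattice :: "real \<Rightarrow> real \<Rightarrow> real set" where
  "shifted_lattice h t = range (\<lambda>n::int. t + real_of_int n * h)"

lemma inj_lattice: "h > 0 \<Longrightarrow> inj (\<lambda>n::int. t + real_of_int n * h)"
  by (auto simp: inj_on_def)

lemma separated_lattice:
  assumes "h > 0"
  shows "separated_by h (shifted_lattice h t)"
  unfolding separated_family_def shifted_lattice_def
proof safe
  fix n k :: int assume "t + real_of_int n * h \<noteq> t + real_of_int k * h"
  then have "1 \<le> \<bar>n - k\<bar>" by force
  then have "1 \<le> \<bar>real_of_int n - real_of_int k\<bar>" by linarith
  then have "1 * h \<le> \<bar>real_of_int n - real_of_int k\<bar> * h"
    using assms
    by (intro mult_right_mono) auto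
  also have "\<dots> = \<bar>(real_of_int n - real_of_int k) * h\<bar>" using assms by (simp add: abs_mult)
  finally show "h \<le> \<bar>t + real_of_int n * h - (t + real_of_int k * h)\<bar>"
    by (simp add: left_diff_distrib)
qed

lemma nn_integral_periodize:
  fixes g :: "real \<Rightarrow> ennreal"
  assumes [measurable]: "g \<in> borel_measurable borel" and h: "h > 0"
  shows "(\<integral>\<^sup>+x. g x \<partial>lborel)
    = (\<integral>\<^sup>+t. (\<integral>\<^sup>+n. g (t + real_of_int n * h) \<partial>count_space UNIV) * indicator {0..<h} t \<partial>lborel)"
proof -
  let ?cell = "\<lambda>n::int. {real_of_int n * h..<real_of_int n * h + h}"
  have cell: "indicator (?cell n) x = (indicator {\<lfloor>x / h\<rfloor>} n :: ennreal)" for n x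
  proof -
    have "x \<in> ?cell n \<longleftrightarrow> real_of_int n \<le> x / h \<and> x / h < real_of_int n + 1"
      using h by (simp add: field_simps)
    also have "\<dots> \<longleftrightarrow> n \<in> {\<lfloor>x / h\<rfloor>}"
      by (auto simp: floor_eq_iff intro: floor_unique[symmetric])
    finally show ?thesis by (simp add: indicator_def)
  qed
  have shift: "(\<integral>\<^sup>+x. g x * indicator (?cell n) x \<partial>lborel)
      = (\<integral>\<^sup>+t. g (t + real_of_int n * h) * indicator {0..<h} t \<partial>lborel)" for n
    by (subst nn_integral_real_affine[where c = 1 and t = "real_of_int n * h"])
      (auto intro!: nn_integral_cong simp: add.commute split: split_indicator)
  have "(\<integral>\<^sup>+x. g x \<partial>lborel) = (\<integral>\<^sup>+x. (\<integral>\<^sup>+n. g x * indicator (?cell n) x \<partial>count_space UNIV) \<partial>lborel)"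
    unfolding cell by (simp add: nn_integral_cmult)
  also have "\<dots> = (\<integral>\<^sup>+n. (\<integral>\<^sup>+x. g x * indicator (?cell n) x \<partial>lborel) \<partial>count_space UNIV)"
    by (rule nn_integral_count_space_nn_integral) auto
  also have "\<dots>
      = (\<integral>\<^sup>+n. (\<integral>\<^sup>+t. g (t + real_of_int n * h) * indicator {0..<h} t \<partial>lborel) \<partial>count_space UNIV)"
    unfolding shift ..
  also have "\<dots>
      = (\<integral>\<^sup>+t. (\<integral>\<^sup>+n. g (t + real_of_int n * h) * indicator {0..<h} t \<partial>count_space UNIV) \<partial>lborel)"
    by (rule nn_integral_count_space_nn_integral[symmetric]) auto
  also have "\<dots>
      = (\<integral>\<^sup>+t. (\<integral>\<^sup>+n. g (t + real_of_int n * h) \<partial>count_space UNIV) * indicator {0..<h} t \<partial>lborel)"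
    by (intro nn_integral_cong) (simp add: nn_integral_multc)
  finally show ?thesis .
qed

lemma nn_integral_count_space_lattice:
  fixes g :: "real \<Rightarrow> real"
  assumes "h > 0" and g: "\<And>x. g x \<ge> 0" and summable: "g summable_on shifted_lattice h t"
  shows "(\<integral>\<^sup>+n. ennreal (g (t + real_of_int n * h)) \<partial>count_space UNIV)
      = ennreal (\<Sum>\<^sub>\<infinity>x\<in>shifted_lattice h t. g x)"
proof -
  define u where "u n = g (t + real_of_int n * h)" for n :: int
  have "u summable_on UNIV"
    using summable unfolding u_def shifted_lattice_def
    by (subst (asm) summable_on_reindex[OF inj_lattice[OF assms(1)]]) (simp add: o_def)
  moreover have u_nonneg: "u n \<ge> 0" for n using g by (simp add: u_def)
  ultimately have "Infinite_Set_Sum.abs_summable_on u UNIV"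
    unfolding abs_summable_equivalent[symmetric] by simp
  then have "(\<integral>\<^sup>+n. ennreal (u n) \<partial>count_space UNIV) = ennreal (\<Sum>\<^sub>\<infinity>n. u n)"
    using u_nonneg by (subst nn_integral_conv_infsetsum) (auto simp: infsetsum_infsum)
  also have "(\<Sum>\<^sub>\<infinity>n. u n) = (\<Sum>\<^sub>\<infinity>x\<in>shifted_lattice h t. g x)"
    unfolding shifted_lattice_def u_def
    by (subst infsum_reindex[OF inj_lattice[OF assms(1)]]) (simp add: o_def)
  finally show ?thesis unfolding u_def .
qed

lemma
  fixes g :: "real \<Rightarrow> real"
  assumes [measurable]: "g \<in> borel_measurable borel" and g: "\<And>x. g x \<ge> 0" and h: "h > 0"
    and u: "u \<ge> 0"
    and summable: "\<And>t. g summable_on shifted_lattice h t"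
    and lower: "\<And>t. u \<le> (\<Sum>\<^sub>\<infinity>x\<in>shifted_lattice h t. g x)"
    and upper: "\<And>t. (\<Sum>\<^sub>\<infinity>x\<in>shifted_lattice h t. g x) \<le> v"
  shows integrable_of_lattice_sums: "integrable lborel g"
    and integral_ge_of_lattice_sums: "h * u \<le> (\<integral>x. g x \<partial>lborel)"
    and integral_le_of_lattice_sums: "(\<integral>x. g x \<partial>lborel) \<le> h * v"
proof -
  have v: "v \<ge> 0" using u lower[of 0] upper[of 0] by linarith
  have periodized: "(\<integral>\<^sup>+x. ennreal (g x) \<partial>lborel)
      = (\<integral>\<^sup>+t. ennreal (\<Sum>\<^sub>\<infinity>x\<in>shifted_lattice h t. g x) * indicator {0..<h} t \<partial>lborel)"
    by (subst nn_integral_periodize[OF _ h])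
      (simp_all add: nn_integral_count_space_lattice[OF h g summable])
  have const: "(\<integral>\<^sup>+t. ennreal w * indicator {0..<h} t \<partial>lborel) = ennreal (h * w)" if "w \<ge> 0" for w
    using that h by (subst nn_integral_cmult) (simp_all add: ennreal_mult mult.commute)
  have le: "(\<integral>\<^sup>+x. ennreal (g x) \<partial>lborel) \<le> ennreal (h * v)"
    unfolding periodized const[OF v, symmetric]
    by (intro nn_integral_mono mult_right_mono ennreal_leI upper) auto
  have ge: "ennreal (h * u) \<le> (\<integral>\<^sup>+x. ennreal (g x) \<partial>lborel)"
    unfolding periodized const[OF u, symmetric]
    by (intro nn_integral_mono mult_right_mono ennreal_leI lower) auto
  show integrable: "integrable lborel g"
  proof (rule integrableI_bounded)
    show "(\<integral>\<^sup>+x. ennreal (norm (g x)) \<partial>lborel) < \<infinity>"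
      using order_le_less_trans[OF le ennreal_less_top] g by simp
  qed simp
  then have eq: "(\<integral>\<^sup>+x. ennreal (g x) \<partial>lborel) = ennreal (\<integral>x. g x \<partial>lborel)"
    using g by (intro nn_integral_eq_integral) auto
  have nonneg: "0 \<le> (\<integral>x. g x \<partial>lborel)" using g by (rule Bochner_Integration.integral_nonneg)
  show "(\<integral>x. g x \<partial>lborel) \<le> h * v" using le h v unfolding eq by (simp add: ennreal_le_iff)
  show "h * u \<le> (\<integral>x. g x \<partial>lborel)" using ge nonneg unfolding eq by (simp add: ennreal_le_iff)
qed

lemma uniformly_dense_half_lattice: "uniformly_dense 3 (shifted_lattice (1 / 2) t) (\<lambda>_. 1)"
  unfolding uniformly_dense_def
proof
  fix y :: real
  define n where "n = \<lceil>2 * (y - t)\<rceil>"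
  have n: "2 * (y - t) \<le> real_of_int n" "real_of_int n < 2 * (y - t) + 1"
    unfolding n_def by linarith+
  define F where "F = (\<lambda>k::int. t + real_of_int k * (1 / 2)) ` {n..n + 3}"
  have "card F = 4"
    unfolding F_def using inj_lattice[of "1 / 2" t] by (subst card_image) (auto elim: inj_on_subset)
  moreover have "F \<subseteq> shifted_lattice (1 / 2) t \<inter> {y..y + real 3 - 1}"
  proof
    fix x assume "x \<in> F"
    then obtain k where k: "x = t + real_of_int k * (1 / 2)" "n \<le> k" "k \<le> n + 3"
      by (auto simp: F_def)
    then have "real_of_int n \<le> real_of_int k" "real_of_int k \<le> real_of_int n + 3" by linarith+
    then have "x \<in> {y..y + real 3 - 1}" using n k by auto
    then show "x \<in> shifted_lattice (1 / 2) t \<inter> {y..y + real 3 - 1}"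
      using k by (auto simp: shifted_lattice_def)
  qed
  then have "card F \<le> card (shifted_lattice (1 / 2) t \<inter> {y..y + real 3 - 1})"
    by (intro card_mono finite_separated_Int_Icc[OF _ separated_lattice]) auto
  ultimately show "real 3 + 1 \<le> (\<Sum>l\<in>shifted_lattice (1 / 2) t \<inter> {y..y + real 3 - 1}. real 1)"
    by simp
qed

section \<open>Samples, coefficients and norms\<close>

definition coeff_energy :: "real \<Rightarrow> (int \<Rightarrow> complex) \<Rightarrow> real" where
  "coeff_energy p c = (\<Sum>\<^sub>\<infinity>l. norm (c l) powr p)"

lemma coeff_energy_nonneg: "coeff_energy p c \<ge> 0"
  unfolding coeff_energy_def by (intro infsum_nonneg) simp

lemma lp_seq_bounded:
  assumes "p \<ge> 1" "lp_seq p c"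
  shows "bounded (range c)"
  using le_infsum_powr[of p "\<lambda>l. norm (c l)" UNIV] assms by (auto simp: bounded_iff lp_seq_def)

lemma Lp_norm_powr:
  assumes "p \<ge> 1"
  shows "Lp_norm p f powr p = (\<integral>x. norm (f x) powr p \<partial>lborel)"
proof -
  have "0 \<le> (\<integral>x. norm (f x) powr p \<partial>lborel)" by (rule Bochner_Integration.integral_nonneg) simp
  then show ?thesis using assms by (simp add: Lp_norm_def powr_powr)
qed

lemma sample_energy_1_powr_le:
  assumes "p \<ge> 1" "m x \<le> M"
  shows "sample_energy 1 m f x powr p \<le> real (Suc M) powr (p - 1) * sample_energy p m f x"
  using powr_weighted_sum_le[OF assms(1), of "{..<m x}" "\<lambda>_. 1" "\<lambda>j. norm (hderiv j f x)"
      "real (Suc M)"] assms(2)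
  by (simp add: sample_energy_def)

lemma
  assumes \<epsilon>: "\<epsilon> > 0" and \<delta>: "0 < \<delta>" "\<delta> \<le> 1" and p: "p \<ge> 1"
    and A: "separated_by \<delta> A" "\<And>x. x \<in> A \<Longrightarrow> m x \<le> M" and c: "lp_seq p c"
    and hderiv_le: "\<And>x j. x \<in> A \<Longrightarrow> j < m x \<Longrightarrow>
      norm (hderiv j f x) \<le> D * exp_conv \<epsilon> real_of_int UNIV (\<lambda>l. norm (c l)) x"
  shows sample_energy_summable_of_exp_conv: "sample_energy p m f summable_on A"
    and infsum_sample_energy_le_of_exp_conv:
      "(\<Sum>\<^sub>\<infinity>x\<in>A. sample_energy p m f x)
          \<le> real (Suc M) * (D * exp_sum_bound \<epsilon> \<delta>) powr p * coeff_energy p c"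
proof -
  let ?b = "\<lambda>x. exp_conv \<epsilon> real_of_int UNIV (\<lambda>l. norm (c l)) x powr p"
  define Q where "Q = real (Suc M) * D powr p"
  have pointwise: "sample_energy p m f x \<le> Q * ?b x" if "x \<in> A" for x
  proof -
    have "sample_energy p m f x
        \<le> real (Suc M) * (D * exp_conv \<epsilon> real_of_int UNIV (\<lambda>l. norm (c l)) x) powr p"
      using p A(2)[OF that] hderiv_le[OF that] by (intro sample_energy_le) auto
    then show ?thesis by (simp add: Q_def powr_mult mult.assoc)
  qed
  note schur = exp_conv_schur[OF \<epsilon> \<delta>(1) p separated_family_of_int[OF \<delta>(2)] A(1),
      of UNIV "\<lambda>l. norm (c l)"]
  have dominated: "(\<lambda>x. Q * ?b x) summable_on A"
    using c by (intro summable_on_cmult_right schur(1)) (auto simp: lp_seq_def)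
  show summable: "sample_energy p m f summable_on A"
    by (rule summable_on_comparison_test[OF dominated pointwise sample_energy_nonneg])
  have "(\<Sum>\<^sub>\<infinity>x\<in>A. sample_energy p m f x) \<le> (\<Sum>\<^sub>\<infinity>x\<in>A. Q * ?b x)"
    by (rule infsum_mono[OF summable dominated pointwise])
  also have "\<dots> = Q * (\<Sum>\<^sub>\<infinity>x\<in>A. ?b x)" by (rule infsum_cmult_right')
  also have "\<dots> \<le> Q * (exp_sum_bound \<epsilon> \<delta> powr p * coeff_energy p c)"
    unfolding coeff_energy_def using c
    by (intro mult_left_mono schur(2)) (auto simp: lp_seq_def Q_def)
  finally show "(\<Sum>\<^sub>\<infinity>x\<in>A. sample_energy p m f x)
      \<le> real (Suc M) * (D * exp_sum_bound \<epsilon> \<delta>) powr p * coeff_energy p c"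
    by (simp add: Q_def powr_mult mult.assoc)
qed

context sech_sampling
begin

definition sample_bound :: "real \<Rightarrow> real" where
  "sample_bound p = real (Suc M) * (dsech_bound M * exp_sum_bound a \<delta>) powr p"

lemma sample_bound_pos: "sample_bound p > 0"
  unfolding sample_bound_def using dsech_bound_pos[of M] exp_sum_bound_pos[OF a_pos \<delta>_pos] by simp

lemma
  assumes A: "separated_by \<delta> A" "\<And>x. x \<in> A \<Longrightarrow> m x \<le> M" and p: "p \<ge> 1"
    and c: "lp_seq p c" and f: "generated_by (sech_a a) c f"
  shows sample_energy_summable: "sample_energy p m f summable_on A"
    and infsum_sample_energy_le: "(\<Sum>\<^sub>\<infinity>x\<in>A. sample_energy p m f x)
        \<le> sample_bound p * coeff_energy p c"
proof -
  have hderiv_le: "norm (hderiv j f x) \<le> dsech_bound M * coeff_conv c x" if "x \<in> A" "j < m x"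
    for x j
    using A(2)[OF that(1)] that(2) by (intro norm_hderiv_le[OF lp_seq_bounded[OF p c] f]) simp
  show "sample_energy p m f summable_on A"
    by (rule sample_energy_summable_of_exp_conv[OF a_pos \<delta>_pos \<delta>_le_1 p A c hderiv_le])
  show "(\<Sum>\<^sub>\<infinity>x\<in>A. sample_energy p m f x) \<le> sample_bound p * coeff_energy p c"
    unfolding sample_bound_def
    by (rule infsum_sample_energy_le_of_exp_conv[OF a_pos \<delta>_pos \<delta>_le_1 p A c hderiv_le])
qed

definition reconstruction_bound :: "real \<Rightarrow> real" where
  "reconstruction_bound p = (coeff_bound * exp_sum_bound 1 \<delta>) powr p * real (Suc M) powr (p - 1)"

lemma reconstruction_bound_pos: "reconstruction_bound p > 0"
  unfolding reconstruction_bound_def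
  using coeff_bound_pos exp_sum_bound_pos[OF zero_less_one \<delta>_pos] by simp

lemma coeff_energy_le:
  assumes A: "admissible A m" and p: "p \<ge> 1" and c: "lp_seq p c"
    and f: "generated_by (sech_a a) c f"
  shows "coeff_energy p c \<le> reconstruction_bound p * (\<Sum>\<^sub>\<infinity>x\<in>A. sample_energy p m f x)"
proof -
  define Q where "Q = real (Suc M) powr (p - 1)"
  note sep = admissibleD(1)[OF A]
  have pointwise: "sample_energy 1 m f x powr p \<le> Q * sample_energy p m f x" if "x \<in> A" for x
    unfolding Q_def using A that by (intro sample_energy_1_powr_le p) (simp add: admissible_def)
  have dominated: "(\<lambda>x. Q * sample_energy p m f x) summable_on A"
    by (intro summable_on_cmult_right sample_energy_summable[OF admissibleD[OF A] p c f])
  have summable: "(\<lambda>x. sample_energy 1 m f x powr p) summable_on A"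
    by (rule summable_on_comparison_test[OF dominated pointwise]) simp_all
  note schur = exp_conv_schur[OF zero_less_one \<delta>_pos p sep separated_family_of_int[OF \<delta>_le_1]
      sample_energy_nonneg summable, of UNIV]
  have "coeff_energy p c \<le> (\<Sum>\<^sub>\<infinity>k. coeff_bound powr p * sample_conv A m f (real_of_int k) powr p)"
    unfolding coeff_energy_def
  proof (rule infsum_mono)
    show "(\<lambda>k. norm (c k) powr p) summable_on UNIV" using c by (simp add: lp_seq_def)
    show "(\<lambda>k. coeff_bound powr p * sample_conv A m f (real_of_int k) powr p) summable_on UNIV"
      by (intro summable_on_cmult_right schur(1))
    show "norm (c k) powr p \<le> coeff_bound powr p * sample_conv A m f (real_of_int k) powr p" for k
      unfolding powr_mult[symmetric]
      using p by (intro powr_mono2 norm_coeff_le A lp_seq_bounded[OF p c] f) auto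
  qed
  also have "\<dots> = coeff_bound powr p * (\<Sum>\<^sub>\<infinity>k. sample_conv A m f (real_of_int k) powr p)"
    by (rule infsum_cmult_right')
  also have "\<dots>
      \<le> coeff_bound powr p * (exp_sum_bound 1 \<delta> powr p * (\<Sum>\<^sub>\<infinity>x\<in>A. sample_energy 1 m f x powr p))"
    by (intro mult_left_mono schur(2)) simp
  also have "\<dots>
      \<le> coeff_bound powr p * (exp_sum_bound 1 \<delta> powr p * (\<Sum>\<^sub>\<infinity>x\<in>A. Q * sample_energy p m f x))"
    by (intro mult_left_mono infsum_mono summable dominated pointwise) auto
  also have "\<dots> = reconstruction_bound p * (\<Sum>\<^sub>\<infinity>x\<in>A. sample_energy p m f x)"
    by (simp add: infsum_cmult_right' reconstruction_bound_def Q_def powr_mult mult.assoc)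
  finally show ?thesis .
qed

end

text \<open>
  Applying the sampling estimates to the lattices \<open>t + \<int> / 2\<close> of density 2 and integrating over \<open>t\<close>
  turns them into the equivalence of the norm of \<open>f\<close> and the norm of its coefficients.
\<close>

context sech_generator
begin

interpretation half: sech_sampling a "1 / 2" 1 3
  by unfold_locales simp_all

lemma admissible_half_lattice: "half.admissible (shifted_lattice (1 / 2) t) (\<lambda>_. 1)"
  using separated_lattice[of "1 / 2" t] uniformly_dense_half_lattice[of t]
  unfolding half.admissible_def by simp

definition norm_equiv_bound :: "real \<Rightarrow> real" where
  "norm_equiv_bound p = max (half.sample_bound p) (2 * half.reconstruction_bound p)"

lemma norm_equiv_bound_pos: "norm_equiv_bound p > 0"
  unfolding norm_equiv_bound_def using half.sample_bound_pos[of p] by (simp add: less_max_iff_disj)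

lemma
  assumes p: "p \<ge> 1" and c: "lp_seq p c" and f: "generated_by (sech_a a) c f"
  shows Lp_fun_generated: "Lp_fun p f"
    and Lp_norm_le_coeff_energy: "Lp_norm p f powr p \<le> norm_equiv_bound p * coeff_energy p c"
    and coeff_energy_le_Lp_norm: "coeff_energy p c \<le> norm_equiv_bound p * Lp_norm p f powr p"
proof -
  define X where "X = coeff_energy p c"
  define R where "R = half.reconstruction_bound p"
  have X: "X \<ge> 0" unfolding X_def by (rule coeff_energy_nonneg)
  have R: "R > 0" unfolding R_def by (rule half.reconstruction_bound_pos)
  have meas [measurable]: "f \<in> borel_measurable borel"
    by (intro borel_measurable_continuous_onI generated_by_continuous[OF lp_seq_bounded[OF p c] f])
  have energy: "sample_energy p (\<lambda>_. 1) f = (\<lambda>x. norm (f x) powr p)"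
    by (simp add: sample_energy_def fun_eq_iff)
  note lattice = half.sample_energy_summable[OF half.admissibleD[OF admissible_half_lattice] p c f,
      unfolded energy]
      half.infsum_sample_energy_le[OF half.admissibleD[OF admissible_half_lattice] p c f,
          unfolded energy, folded X_def]
      half.coeff_energy_le[OF admissible_half_lattice p c f, unfolded energy, folded X_def R_def]
  have lower: "X / R \<le> (\<Sum>\<^sub>\<infinity>x\<in>shifted_lattice (1 / 2) t. norm (f x) powr p)" for t
    using lattice(3)[of t] R by (simp add: field_simps)
  note integral = integrable_of_lattice_sums[OF _ _ _ _ lattice(1) lower lattice(2)]
      integral_ge_of_lattice_sums[OF _ _ _ _ lattice(1) lower lattice(2)]
      integral_le_of_lattice_sums[OF _ _ _ _ lattice(1) lower lattice(2)]
  show "Lp_fun p f"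
    unfolding Lp_fun_def using integral(1) X R by simp
  have "Lp_norm p f powr p \<le> 1 / 2 * (half.sample_bound p * X)"
    unfolding Lp_norm_powr[OF p] using integral(3) X R by simp
  also have "\<dots> \<le> half.sample_bound p * X" using X half.sample_bound_pos[of p] by simp
  also have "\<dots> \<le> norm_equiv_bound p * X"
    unfolding norm_equiv_bound_def using X by (intro mult_right_mono) auto
  finally show "Lp_norm p f powr p \<le> norm_equiv_bound p * coeff_energy p c" unfolding X_def .
  have "1 / 2 * (X / R) \<le> Lp_norm p f powr p"
    unfolding Lp_norm_powr[OF p] using integral(2) X R by simp
  then have "X \<le> 2 * R * Lp_norm p f powr p" using R by (simp add: field_simps)
  also have "\<dots> \<le> norm_equiv_bound p * Lp_norm p f powr p"
    unfolding norm_equiv_bound_def R_def by (intro mult_right_mono) auto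
  finally show "coeff_energy p c \<le> norm_equiv_bound p * Lp_norm p f powr p" unfolding X_def .
qed

definition sup_equiv_bound :: real where
  "sup_equiv_bound = half.coeff_bound * (exp_sum_bound 1 (1 / 2) * 2)"

lemma sup_equiv_bound_pos: "sup_equiv_bound > 0"
  unfolding sup_equiv_bound_def using half.coeff_bound_pos exp_sum_bound_pos[of 1 "1 / 2"] by simp

lemma norm_coeff_le_sup_norm:
  assumes c: "bounded (range c)" and f: "generated_by (sech_a a) c f" and N: "\<And>x. norm (f x) \<le> N"
  shows "norm (c k) \<le> sup_equiv_bound * N"
proof -
  have "0 \<le> N" using N norm_ge_zero order_trans by blast
  then show ?thesis
    using half.norm_coeff_le_sup[OF admissible_half_lattice c f, of N 0 k] N
    by (simp add: sup_equiv_bound_def)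
qed

end

lemma norm_le_Linf_norm:
  assumes cont: "continuous_on UNIV f" and N: "Linf_norm f \<le> ereal N"
  shows "norm (f x) \<le> N"
proof (rule ccontr)
  assume "\<not> norm (f x) \<le> N"
  define U where "U = {x. N < norm (f x)}"
  have "open U"
    unfolding U_def
    by (intro open_Collect_less continuous_on_const continuous_on_norm cont)
  moreover have "x \<in> U" using \<open>\<not> norm (f x) \<le> N\<close> by (simp add: U_def)
  moreover have "AE x in lborel. ereal (norm (f x)) \<le> Linf_norm f"
    unfolding Linf_norm_def by (rule esssup_AE)
  then have "AE x in lborel. x \<notin> U"
  proof eventually_elim
    case (elim x)
    then have "ereal (norm (f x)) \<le> ereal N" using N by (rule order_trans)
    then show ?case by (simp add: U_def)
  qed
  ultimately obtain e where e: "e > 0" "ball x e \<subseteq> U" and ae: "AE x in lborel. x \<notin> U"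
    by (meson open_contains_ball)
  have "AE y in lborel. y \<notin> {x - e<..<x + e}"
    using ae e(2) by (auto elim!: eventually_mono simp: ball_eq_greaterThanLessThan)
  then have "{x - e<..<x + e} \<in> null_sets lborel" by (subst AE_iff_null_sets) auto
  then show False using e(1) by (simp add: null_sets_def)
qed

lemma Linf_norm_le:
  assumes "continuous_on UNIV f" "\<And>x. norm (f x) \<le> N"
  shows "Linf_norm f \<le> ereal N"
  unfolding Linf_norm_def using borel_measurable_continuous_onI[OF assms(1)] assms(2)
  by (intro esssup_I) auto

lemma Linf_norm_eq_ereal:
  assumes cont: "continuous_on UNIV f" and "Linf_norm f < \<infinity>"
  obtains N where "N \<ge> 0" "Linf_norm f = ereal N"
proof -
  have "Linf_norm f \<noteq> - \<infinity>"
  proof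
    assume "Linf_norm f = - \<infinity>"
    then have "norm (f 0) \<le> - 1" by (intro norm_le_Linf_norm[OF cont]) simp
    then show False using norm_ge_zero[of "f 0"] by linarith
  qed
  then obtain N where N: "Linf_norm f = ereal N" using assms(2) by (cases "Linf_norm f") auto
  then have "0 \<le> N" using order_trans[OF norm_ge_zero norm_le_Linf_norm[OF cont, of N 0]] by simp
  then show thesis using N that by blast
qed

section \<open>Sufficiency of the density condition\<close>

context sech_sampling
begin

lemma sampling_set_p_if_admissible:
  assumes A: "admissible A m" and p: "p \<ge> 1"
  shows "sampling_set_p p (sech_a a) A m"
proof -
  define B where "B = norm_equiv_bound p"
  have B: "B > 0" unfolding B_def by (rule norm_equiv_bound_pos)
  have "sample_energy p m f summable_on A \<and>
      1 / (B * reconstruction_bound p) * Lp_norm p f powr p \<le> (\<Sum>\<^sub>\<infinity>l\<in>A. sample_energy p m f l) \<and>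
      (\<Sum>\<^sub>\<infinity>l\<in>A. sample_energy p m f l) \<le> sample_bound p * B * Lp_norm p f powr p"
    if mem: "f \<in> Vp p (sech_a a)" for f
  proof (intro conjI)
    obtain c where c: "lp_seq p c" and f: "generated_by (sech_a a) c f"
      using mem unfolding Vp_def by blast
    show "sample_energy p m f summable_on A"
      by (rule sample_energy_summable[OF admissibleD[OF A] p c f])
    have "Lp_norm p f powr p \<le> B * coeff_energy p c"
      unfolding B_def by (rule Lp_norm_le_coeff_energy[OF p c f])
    also have "\<dots> \<le> B * (reconstruction_bound p * (\<Sum>\<^sub>\<infinity>l\<in>A. sample_energy p m f l))"
      using B by (intro mult_left_mono coeff_energy_le[OF A p c f]) auto
    finally show "1 / (B * reconstruction_bound p) * Lp_norm p f powr p
        \<le> (\<Sum>\<^sub>\<infinity>l\<in>A. sample_energy p m f l)"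
      using B reconstruction_bound_pos[of p] by (simp add: field_simps)
    have "(\<Sum>\<^sub>\<infinity>l\<in>A. sample_energy p m f l) \<le> sample_bound p * coeff_energy p c"
      by (rule infsum_sample_energy_le[OF admissibleD[OF A] p c f])
    also have "\<dots> \<le> sample_bound p * (B * Lp_norm p f powr p)"
      unfolding B_def using sample_bound_pos[of p]
      by (intro mult_left_mono coeff_energy_le_Lp_norm[OF p c f]) auto
    finally show "(\<Sum>\<^sub>\<infinity>l\<in>A. sample_energy p m f l) \<le> sample_bound p * B * Lp_norm p f powr p"
      by (simp only: mult.assoc)
  qed
  moreover have "0 < 1 / (B * reconstruction_bound p)" "0 < sample_bound p * B"
    using B reconstruction_bound_pos[of p] sample_bound_pos[of p] by auto
  ultimately show ?thesis unfolding sampling_set_p_def sample_energy_def by blast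
qed

lemma admissible_obtain_node:
  assumes "admissible A m"
  obtains l where "l \<in> A" "m l \<ge> 1"
proof -
  have "real L + 1 \<le> (\<Sum>l\<in>A \<inter> {0..0 + real L - 1}. real (m l))"
    using assms unfolding admissible_def uniformly_dense_def by blast
  then have "(\<Sum>l\<in>A \<inter> {0..0 + real L - 1}. real (m l)) \<noteq> 0" by linarith
  then obtain l where "l \<in> A \<inter> {0..0 + real L - 1}" "real (m l) \<noteq> 0"
    by (rule sum.not_neutral_contains_not_neutral)
  then show thesis using that by auto
qed

definition sup_sample_bound :: real where
  "sup_sample_bound = dsech_bound M * exp_sum_bound a 1"

lemma sup_sample_bound_pos: "sup_sample_bound > 0"
  unfolding sup_sample_bound_def
  using dsech_bound_pos[of M] exp_sum_bound_pos[OF a_pos zero_less_one] by simp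

definition sup_reconstruction_bound :: real where
  "sup_reconstruction_bound = coeff_bound * (exp_sum_bound 1 \<delta> * real (Suc M))"

lemma sup_reconstruction_bound_pos: "sup_reconstruction_bound > 0"
  unfolding sup_reconstruction_bound_def
  using coeff_bound_pos exp_sum_bound_pos[OF zero_less_one \<delta>_pos] by simp

lemma Linf_norm_le_sup_samples:
  assumes A: "admissible A m" and c: "bounded (range c)" and f: "generated_by (sech_a a) c f"
  shows "ereal (1 / (sup_sample_bound * sup_reconstruction_bound)) * Linf_norm f
    \<le> (SUP l\<in>A. SUP j\<in>{..<m l}. ereal (norm (hderiv j f l)))" (is "ereal ?C * _ \<le> ?T")
proof -
  have upper: "ereal (norm (hderiv j f l)) \<le> ?T" if "l \<in> A" "j < m l" for l j
    using that by (intro SUP_upper2[of l] SUP_upper) auto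
  obtain l where "l \<in> A" "m l \<ge> 1" using admissible_obtain_node[OF A] .
  then have "0 \<le> ?T" using order_trans[OF _ upper[of l 0]] by simp
  show ?thesis
  proof (cases ?T)
    case (real \<sigma>)
    have \<sigma>: "norm (hderiv j f l) \<le> \<sigma>" if "l \<in> A" "j < m l" for l j
      using upper[OF that] real by simp
    have "\<sigma> \<ge> 0" using \<open>0 \<le> ?T\<close> real by simp
    then have "norm (c k) \<le> sup_reconstruction_bound * \<sigma>" for k
      unfolding sup_reconstruction_bound_def by (intro norm_coeff_le_sup[OF A c f _ \<sigma>])
    then have "norm (f x) \<le> sup_sample_bound * (sup_reconstruction_bound * \<sigma>)" for x
      unfolding sup_sample_bound_def using norm_hderiv_le_sup[OF _ f, of _ 0 M x] by simp
    then have "Linf_norm f \<le> ereal (sup_sample_bound * (sup_reconstruction_bound * \<sigma>))"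
      by (rule Linf_norm_le[OF generated_by_continuous[OF c f]])
    then have "ereal ?C * Linf_norm f
        \<le> ereal ?C * ereal (sup_sample_bound * (sup_reconstruction_bound * \<sigma>))"
      using sup_sample_bound_pos sup_reconstruction_bound_pos by (intro ereal_mult_left_mono) auto
    also have "\<dots> = ?T"
      using sup_sample_bound_pos sup_reconstruction_bound_pos real by simp
    finally show ?thesis .
  qed (use \<open>0 \<le> ?T\<close> in auto)
qed

lemma sup_samples_le_Linf_norm:
  assumes m: "\<And>l. l \<in> A \<Longrightarrow> m l \<le> M" and c: "bounded (range c)" and f: "generated_by (sech_a a) c f"
    and fin: "Linf_norm f < \<infinity>"
  shows "(SUP l\<in>A. SUP j\<in>{..<m l}. ereal (norm (hderiv j f l)))
      \<le> ereal (sup_sample_bound * sup_equiv_bound) * Linf_norm f"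
proof -
  have cont: "continuous_on UNIV f" by (rule generated_by_continuous[OF c f])
  obtain N where N: "Linf_norm f = ereal N" using Linf_norm_eq_ereal[OF cont fin] by blast
  then have "norm (c k) \<le> sup_equiv_bound * N" for k
    by (intro norm_coeff_le_sup_norm[OF c f] norm_le_Linf_norm[OF cont]) simp
  then have "norm (hderiv j f l) \<le> sup_sample_bound * (sup_equiv_bound * N)" if "l \<in> A" "j < m l"
    for l j
    unfolding sup_sample_bound_def using m[OF that(1)] that(2)
    by (intro norm_hderiv_le_sup[OF _ f]) auto
  then show ?thesis by (intro SUP_least) (simp add: N mult.assoc)
qed

lemma sampling_set_inf_if_admissible:
  assumes A: "admissible A m"
  shows "sampling_set_inf (sech_a a) A m"
proof -
  have "ereal (1 / (sup_sample_bound * sup_reconstruction_bound)) * Linf_norm f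
        \<le> (SUP l\<in>A. SUP j\<in>{..<m l}. ereal (norm (hderiv j f l))) \<and>
      (SUP l\<in>A. SUP j\<in>{..<m l}. ereal (norm (hderiv j f l)))
          \<le> ereal (sup_sample_bound * sup_equiv_bound) * Linf_norm f"
    if "f \<in> Vinf (sech_a a)" for f
    using that Linf_norm_le_sup_samples[OF A] sup_samples_le_Linf_norm[OF admissibleD(2)[OF A]]
    by (auto simp: Vinf_def linf_seq_def Linf_fun_def)
  moreover have "0 < 1 / (sup_sample_bound * sup_reconstruction_bound)"
      "0 < sup_sample_bound * sup_equiv_bound"
    using sup_sample_bound_pos sup_reconstruction_bound_pos sup_equiv_bound_pos by auto
  ultimately show ?thesis unfolding sampling_set_inf_def by blast
qed

end

lemma uniformly_dense_if_lower_density: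
  assumes "lower_density A m > 1"
  obtains L where "L \<ge> 1" "uniformly_dense L A m"
proof -
  obtain D where D: "1 < ereal D" "ereal D < lower_density A m"
    using ereal_dense2[OF assms] by blast
  have "\<forall>\<^sub>F r in at_top. ereal D < (INF x. ereal ((\<Sum>l\<in>A \<inter> {x - r..x + r}. real (m l)) / (2 * r)))"
    using D(2) unfolding lower_density_def by (rule less_LiminfD)
  then obtain r0
    where r0: "\<And>r. r \<ge> r0 \<Longrightarrow>
      ereal D < (INF x. ereal ((\<Sum>l\<in>A \<inter> {x - r..x + r}. real (m l)) / (2 * r)))"
    unfolding eventually_at_top_linorder by blast
  have "D > 1" using D(1) by simp
  obtain L :: nat where L: "real L \<ge> max (max 2 (2 * r0 + 1)) ((D + 1) / (D - 1))"
    using real_arch_simple by blast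
  define r where "r = (real L - 1) / 2"
  have r: "r > 0" "r \<ge> r0" using L by (auto simp: r_def)
  have surplus: "real L + 1 \<le> D * (2 * r)"
  proof -
    have "(D + 1) / (D - 1) \<le> real L" using L by simp
    then have "D + 1 \<le> real L * (D - 1)" using \<open>D > 1\<close> by (simp add: field_simps)
    then show ?thesis by (simp add: r_def algebra_simps)
  qed
  have "real L + 1 \<le> (\<Sum>l\<in>A \<inter> {y..y + real L - 1}. real (m l))" for y
  proof -
    have bounds: "y + r - r = y" "y + r + r = y + real L - 1" by (simp_all add: r_def field_simps)
    have "ereal D < ereal ((\<Sum>l\<in>A \<inter> {y + r - r..y + r + r}. real (m l)) / (2 * r))"
      by (rule less_le_trans[OF r0[OF r(2)] INF_lower]) simp
    then have "D * (2 * r) \<le> (\<Sum>l\<in>A \<inter> {y + r - r..y + r + r}. real (m l))"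
      using r by (simp add: field_simps)
    then show ?thesis using surplus unfolding bounds by linarith
  qed
  moreover have "L \<ge> 1" using L by simp
  ultimately show thesis using that unfolding uniformly_dense_def by blast
qed

section \<open>Necessity of the density condition\<close>

lemma sparse_interval_if_lower_density_less:
  assumes "lower_density A m < ereal \<theta>"
  shows "\<exists>r x. r \<ge> r0 \<and> (\<Sum>l\<in>A \<inter> {x - r..x + r}. real (m l)) < \<theta> * (2 * r)"
proof (rule ccontr)
  assume "\<not> ?thesis"
  then have dense: "\<theta> * (2 * r) \<le> (\<Sum>l\<in>A \<inter> {x - r..x + r}. real (m l))" if "r \<ge> r0" for r x
    using that by (simp add: not_less)
  have "\<forall>\<^sub>F r in at_top. ereal \<theta> \<le> (INF x. ereal ((\<Sum>l\<in>A \<inter> {x - r..x + r}. real (m l)) / (2 * r)))"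
    using eventually_ge_at_top[of "max r0 1"]
  proof eventually_elim
    case (elim r)
    then show ?case using dense[of r] by (intro INF_greatest) (simp add: field_simps)
  qed
  then have "ereal \<theta> \<le> lower_density A m" unfolding lower_density_def by (rule Liminf_bounded)
  then show False using assms by simp
qed

lemma
  fixes x s :: real
  shows finite_ints_cball: "finite {l::int. \<bar>x - real_of_int l\<bar> \<le> s}"
    and card_ints_cball_ge: "2 * s - 1 \<le> real (card {l::int. \<bar>x - real_of_int l\<bar> \<le> s})"
proof -
  have interval: "{l::int. \<bar>x - real_of_int l\<bar> \<le> s} = {\<lceil>x - s\<rceil>..\<lfloor>x + s\<rfloor>}"
    by (auto simp: ceiling_le_iff le_floor_iff abs_le_iff)
  show "finite {l::int. \<bar>x - real_of_int l\<bar> \<le> s}" unfolding interval by simp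
  show "2 * s - 1 \<le> real (card {l::int. \<bar>x - real_of_int l\<bar> \<le> s})"
    unfolding interval card_atLeastAtMost_int by linarith
qed

lemma generated_by_finite_support:
  assumes "finite I" "\<And>l. l \<notin> I \<Longrightarrow> c l = 0"
  shows "generated_by \<psi> c (\<lambda>x. \<Sum>l\<in>I. c l * complex_of_real (\<psi> (x - real_of_int l)))"
  unfolding generated_by_def using assms by (intro allI has_sum_finite_neutralI[OF assms(1)]) auto

lemma lp_seq_finite_support:
  assumes "finite I" "\<And>l. l \<notin> I \<Longrightarrow> c l = 0"
  shows "lp_seq p c"
  unfolding lp_seq_def
  by (rule has_sum_imp_summable, rule has_sum_finite_neutralI[OF assms(1)]) (use assms(2) in auto)

lemma coeff_energy_pos:
  assumes "lp_seq p c" "c l \<noteq> 0"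
  shows "coeff_energy p c > 0"
proof -
  have "0 < (\<Sum>l\<in>{l}. norm (c l) powr p)" using assms(2) by simp
  also have "\<dots> \<le> coeff_energy p c"
    unfolding coeff_energy_def using assms(1)
    by (intro finite_sum_le_infsum) (auto simp: lp_seq_def)
  finally show ?thesis .
qed

context sech_generator
begin

lemma vanishing_coefficients:
  assumes "finite P" "finite I" and card: "(\<Sum>x\<in>P. m x) < card I"
  obtains c l where "\<And>l. l \<notin> I \<Longrightarrow> c l = 0" "c l \<noteq> 0"
    "\<And>f x j. generated_by (sech_a a) c f \<Longrightarrow> x \<in> P \<Longrightarrow> j < m x \<Longrightarrow> hderiv j f x = 0"
proof -
  define J where "J = (SIGMA x:P. {..<m x})"
  have "finite J" "card J < card I" using assms by (auto simp: J_def)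
  then obtain c l where c: "\<And>l. l \<notin> I \<Longrightarrow> c l = 0" "c l \<noteq> 0"
      and row: "\<And>y. y \<in> J \<Longrightarrow> (\<Sum>l\<in>I. dsech (snd y) (fst y - real_of_int l) * c l) = 0"
    using underdetermined_system[of J I "\<lambda>y l. dsech (snd y) (fst y - real_of_int l)"] assms(2)
    by blast
  have "hderiv j f x = 0" if f: "generated_by (sech_a a) c f" and "x \<in> P" "j < m x" for f x j
  proof (rule has_sum_unique)
    have "bounded (range c)"
      by (rule lp_seq_bounded[OF order_refl lp_seq_finite_support[OF assms(2) c(1)]])
    then show "((\<lambda>l. c l * dsech j (x - real_of_int l)) has_sum hderiv j f x) UNIV"
      by (rule hderiv_has_sum[OF _ f])
    show "((\<lambda>l. c l * dsech j (x - real_of_int l)) has_sum 0) UNIV"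
      using row[of "(x, j)"] that c(1)
      by (intro has_sum_finite_neutralI[OF assms(2)]) (auto simp: J_def mult.commute)
  qed
  then show thesis using that c by blast
qed

definition leakage :: "real \<Rightarrow> nat \<Rightarrow> real \<Rightarrow> real \<Rightarrow> real" where
  "leakage \<delta> M p d
      = real (Suc M) * (dsech_bound M * exp (- (a / 2) * d) * exp_sum_bound (a / 2) \<delta>) powr p"

lemma leakage_tendsto_0:
  assumes "p \<ge> 1"
  shows "(leakage \<delta> M p \<longlongrightarrow> 0) at_top"
proof -
  have "leakage \<delta> M p
      = (\<lambda>d. real (Suc M) * (dsech_bound M * exp_sum_bound (a / 2) \<delta>) powr p
          * exp (- (a / 2 * p * d)))"
    by (simp add: leakage_def fun_eq_iff powr_mult exp_powr_real mult_ac)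
  moreover have "filterlim (\<lambda>d. a / 2 * p * d) at_top at_top"
    using a_pos assms
    by (intro filterlim_tendsto_pos_mult_at_top[OF tendsto_const] filterlim_ident) simp
  then have "((\<lambda>d. exp (- (a / 2 * p * d))) \<longlongrightarrow> 0) at_top"
    by (intro filterlim_compose[OF exp_at_bot]) (simp only: filterlim_uminus_at_bot minus_minus)
  ultimately show ?thesis by (simp only: tendsto_mult_right_zero)
qed

lemma sampling_constant_le_leakage:
  assumes \<delta>: "0 < \<delta>" "\<delta> \<le> 1" and A: "separated_by \<delta> A" "\<And>x. x \<in> A \<Longrightarrow> m x \<le> M" and p: "p \<ge> 1"
    and sampling: "\<And>f. f \<in> Vp p (sech_a a) \<Longrightarrow>
        K * Lp_norm p f powr p \<le> (\<Sum>\<^sub>\<infinity>x\<in>A. sample_energy p m f x)"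
    and K: "K \<ge> 0" and c: "lp_seq p c" "c k \<noteq> 0" and f: "generated_by (sech_a a) c f"
    and off_support: "\<And>x j l. x \<in> A \<Longrightarrow> j < m x \<Longrightarrow> hderiv j f x \<noteq> 0 \<Longrightarrow> c l \<noteq> 0 \<Longrightarrow>
        d \<le> \<bar>x - real_of_int l\<bar>"
  shows "K \<le> norm_equiv_bound p * leakage \<delta> M p d"
proof -
  let ?B = "norm_equiv_bound p"
  have hderiv_le: "norm (hderiv j f x)
      \<le> dsech_bound M * exp (- (a / 2) * d) * exp_conv (a / 2) real_of_int UNIV (\<lambda>l. norm (c l)) x"
    if "x \<in> A" "j < m x" for x j
  proof (cases "hderiv j f x = 0")
    case True
    then show ?thesis using dsech_bound_pos[of M] by (simp add: exp_conv_nonneg)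
  next
    case False
    then show ?thesis
      using A(2)[OF that(1)] that off_support[OF that] a_pos
        norm_hderiv_le_exp_conv[of "a / 2", OF _ _ lp_seq_bounded[OF p c(1)] f, of j M d x]
      by simp
  qed
  have mem: "f \<in> Vp p (sech_a a)"
    unfolding Vp_def using Lp_fun_generated[OF p c(1) f] c(1) f by blast
  have "K * coeff_energy p c \<le> K * (?B * Lp_norm p f powr p)"
    using K by (intro mult_left_mono coeff_energy_le_Lp_norm[OF p c(1) f])
  also have "\<dots> = ?B * (K * Lp_norm p f powr p)" by simp
  also have "\<dots> \<le> ?B * (\<Sum>\<^sub>\<infinity>x\<in>A. sample_energy p m f x)"
    using norm_equiv_bound_pos[of p] by (intro mult_left_mono sampling[OF mem]) simp
  also have "\<dots> \<le> ?B * (leakage \<delta> M p d * coeff_energy p c)"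
    unfolding leakage_def using norm_equiv_bound_pos[of p] a_pos
    by (intro mult_left_mono infsum_sample_energy_le_of_exp_conv[OF _ \<delta> p A c(1) hderiv_le]) auto
  finally have "K * coeff_energy p c \<le> (?B * leakage \<delta> M p d) * coeff_energy p c"
    by (simp only: mult.assoc)
  then show ?thesis using coeff_energy_pos[OF c] by simp
qed

lemma sampling_constant_le_leakage_if_sparse:
  assumes \<delta>: "0 < \<delta>" "\<delta> \<le> 1" and A: "separated_by \<delta> A" "\<And>x. x \<in> A \<Longrightarrow> m x \<le> M" and p: "p \<ge> 1"
    and sampling: "\<And>f. f \<in> Vp p (sech_a a) \<Longrightarrow>
        K * Lp_norm p f powr p \<le> (\<Sum>\<^sub>\<infinity>x\<in>A. sample_energy p m f x)"
    and K: "K \<ge> 0" and sparse: "(\<Sum>l\<in>A \<inter> {x - (s + d)..x + (s + d)}. real (m l)) < 2 * s - 1"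
  shows "K \<le> norm_equiv_bound p * leakage \<delta> M p d"
proof -
  define P where "P = A \<inter> {x - (s + d)..x + (s + d)}"
  define I where "I = {l::int. \<bar>x - real_of_int l\<bar> \<le> s}"
  have fin: "finite P" "finite I"
    unfolding P_def I_def by (rule finite_separated_Int_Icc[OF \<delta>(1) A(1)], rule finite_ints_cball)
  have "real (\<Sum>l\<in>P. m l) < 2 * s - 1" using sparse by (simp add: P_def)
  also have "\<dots> \<le> real (card I)" unfolding I_def by (rule card_ints_cball_ge)
  finally have "(\<Sum>l\<in>P. m l) < card I" by (simp only: of_nat_less_iff)
  from vanishing_coefficients[OF fin this] obtain c k where c: "\<And>l. l \<notin> I \<Longrightarrow> c l = 0" "c k \<noteq> 0"
      and vanish: "\<And>f y j. generated_by (sech_a a) c f \<Longrightarrow> y \<in> P \<Longrightarrow> j < m y \<Longrightarrow> hderiv j f y = 0"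
    by blast
  have lp: "lp_seq p c" using c(1) by (rule lp_seq_finite_support[OF fin(2)])
  obtain f where f: "generated_by (sech_a a) c f"
    using generated_by_finite_support[OF fin(2), of c] c(1) by blast
  have "d \<le> \<bar>y - real_of_int l\<bar>" if "y \<in> A" "j < m y" "hderiv j f y \<noteq> 0" "c l \<noteq> 0" for y j l
  proof -
    have "y \<notin> P" using vanish[OF f, of y j] that by blast
    then have "s + d < \<bar>x - y\<bar>" using \<open>y \<in> A\<close> by (auto simp: P_def)
    moreover have "\<bar>x - real_of_int l\<bar> \<le> s" using c(1)[of l] \<open>c l \<noteq> 0\<close> by (auto simp: I_def)
    ultimately show ?thesis by linarith
  qed
  then show ?thesis
    by (intro sampling_constant_le_leakage[OF \<delta> A p sampling K lp c(2) f]) auto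
qed

lemma lower_density_ge_1_if_sampling_set_p:
  assumes \<delta>: "0 < \<delta>" "\<delta> \<le> 1" and A: "separated_by \<delta> A" "\<And>x. x \<in> A \<Longrightarrow> m x \<le> M" and p: "p \<ge> 1"
    and "sampling_set_p p (sech_a a) A m"
  shows "lower_density A m \<ge> 1"
proof (rule ccontr)
  assume "\<not> lower_density A m \<ge> 1"
  then obtain \<theta> where \<theta>: "lower_density A m < ereal \<theta>" "\<theta> < 1"
    using ereal_dense2[of "lower_density A m" 1] by (auto simp: not_le)
  obtain K where K: "K > 0"
      and sampling: "\<And>f. f \<in> Vp p (sech_a a) \<Longrightarrow>
          K * Lp_norm p f powr p \<le> (\<Sum>\<^sub>\<infinity>x\<in>A. sample_energy p m f x)"
    using \<open>sampling_set_p p (sech_a a) A m\<close> unfolding sampling_set_p_def sample_energy_def by blast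
  have "((\<lambda>d. norm_equiv_bound p * leakage \<delta> M p d) \<longlongrightarrow> 0) at_top"
    by (intro tendsto_mult_right_zero leakage_tendsto_0 p)
  then have "\<forall>\<^sub>F d in at_top. norm_equiv_bound p * leakage \<delta> M p d < K"
    using K by (rule order_tendstoD)
  then obtain d0 where small: "\<And>d. d \<ge> d0 \<Longrightarrow> norm_equiv_bound p * leakage \<delta> M p d < K"
    unfolding eventually_at_top_linorder by blast
  obtain r x where r: "r \<ge> max (1 / (1 - \<theta>)) (2 * d0 / (1 - \<theta>))"
      and sparse: "(\<Sum>l\<in>A \<inter> {x - r..x + r}. real (m l)) < \<theta> * (2 * r)"
    using sparse_interval_if_lower_density_less[OF \<theta>(1)] by blast
  define s where "s = (1 + \<theta>) / 2 * r"
  define d where "d = (1 - \<theta>) / 2 * r"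
  have d: "d \<ge> d0" and "\<theta> * (2 * r) \<le> 2 * s - 1" and "r = s + d"
    using r \<theta>(2) by (auto simp: s_def d_def field_simps)
  then have "(\<Sum>l\<in>A \<inter> {x - (s + d)..x + (s + d)}. real (m l)) < 2 * s - 1" using sparse by simp
  then have "K \<le> norm_equiv_bound p * leakage \<delta> M p d"
    using K by (intro sampling_constant_le_leakage_if_sparse[OF \<delta> A p sampling]) auto
  then show False using small[OF d] by simp
qed

end

lemma separated_imp_separated_by:
  assumes "separated \<Lambda>"
  obtains \<delta> where "0 < \<delta>" "\<delta> \<le> 1" "separated_by \<delta> \<Lambda>"
proof -
  obtain \<delta> where "\<delta> > 0" "separated_by \<delta> \<Lambda>"
    using assms unfolding separated_def separated_family_def by blast
  then show thesis using that[of "min \<delta> 1"] separated_family_mono[of \<delta> "\<lambda>x. x" \<Lambda> "min \<delta> 1"] by simp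
qed

theorem theorem1p2:
  fixes a :: real and \<Lambda> :: "real set" and m :: "real \<Rightarrow> nat"
  assumes "a > 0"
    and "separated \<Lambda>"
    and "\<forall>l\<in>\<Lambda>. m l \<ge> 1"
    and "bdd_above (m ` \<Lambda>)"
  shows "(lower_density \<Lambda> m > 1 \<longrightarrow>
            (\<forall>p::real. 1 \<le> p \<longrightarrow> sampling_set_p p (sech_a a) \<Lambda> m) \<and>
            sampling_set_inf (sech_a a) \<Lambda> m)
       \<and> (sampling_set_p 2 (sech_a a) \<Lambda> m \<longrightarrow> lower_density \<Lambda> m \<ge> 1)"
proof -
  interpret sech_generator a by unfold_locales fact
  obtain \<delta> where \<delta>: "0 < \<delta>" "\<delta> \<le> 1" and sep: "separated_by \<delta> \<Lambda>"
    using separated_imp_separated_by[OF assms(2)] .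
  obtain M where M: "\<And>l. l \<in> \<Lambda> \<Longrightarrow> m l \<le> M" using assms(4) by (auto simp: bdd_above_def)
  have "(\<forall>p::real. 1 \<le> p \<longrightarrow> sampling_set_p p (sech_a a) \<Lambda> m) \<and> sampling_set_inf (sech_a a) \<Lambda> m"
    if dense: "lower_density \<Lambda> m > 1"
  proof -
    obtain L where L: "L \<ge> 1" "uniformly_dense L \<Lambda> m"
      using uniformly_dense_if_lower_density[OF dense] .
    interpret sech_sampling a \<delta> M L using \<delta> L(1) by unfold_locales
    have "admissible \<Lambda> m" using sep M L(2) by (simp add: admissible_def)
    then show ?thesis using sampling_set_p_if_admissible sampling_set_inf_if_admissible by blast
  qed
  moreover have "lower_density \<Lambda> m \<ge> 1" if "sampling_set_p 2 (sech_a a) \<Lambda> m"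
    using lower_density_ge_1_if_sampling_set_p[OF \<delta> sep M _ that] by simp
  ultimately show ?thesis by blast
qed

end
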